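(* Let $\mathcal C$ be a weakly abelian category with Freyd category $\hat{\mathcal C}$ and let $n\ge2$. The functor $K:\mathcal C(\dot\Delta_n)\to\hat{\mathcal C}(\dot\Delta_{n-1})$ given by $(KX)_i=\mathrm{Ker}(X_i\to X_n)$ (kernel taken in $\hat{\mathcal C}$) for $1\le i\le n-1$, with the induced morphisms, induces an equivalence $$\underline K:\ \underline{\mathcal C(\dot\Delta_n)}\;\longrightarrow\;\underline{\hat{\mathcal C}(\dot\Delta_{n-1})},\qquad X\mapsto KX.$$
   Context: For an additive category $\mathcal A$ and a full additive subcategory $\mathcal B$, $\mathcal A/\mathcal B$ has the objects of $\mathcal A$ and, as morphisms, morphisms of $\mathcal A$ modulo those factoring over an object of $\mathcal B$. For a category $D$, $\mathcal A(D)$ is the category of functors $D\to\mathcal A$; posets are viewed as categories. $\dot\Delta_n=\{1<2<\dots<n\}$. A weak kernel of $f:X\to Y$ in an additive category is a morphism $i:K\to X$ such that $\mathrm{Hom}(S,K)\to\mathrm{Hom}(S,X)\to\mathrm{Hom}(S,Y)$ is exact at the middle term for all objects $S$; weak cokernels are dual. An additive category is weakly abelian if every morphism has a weak kernel and a weak cokernel, and is itself a weak kernel and a weak cokernel. The Freyd category $\hat{\mathcal C}$ of a weakly abelian category $\mathcal C$ is the quotient of the category of morphisms of $\mathcal C$ (commutative squares as morphisms) by the full subcategory of zero morphisms; it is abelian, and $\mathcal C$ embeds fully faithfully via $X\mapsto \mathrm{id}_X$; $\mathcal C$ is identified with its image. A morphism is split if it is isomorphic, as an object of the category of morphisms, to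 a morphism $X\oplus Y\to Y\oplus Z$ whose only nonzero component is $\mathrm{id}_Y$. For $m\ge1$, $\mathcal C^{split}(\dot\Delta_m)\subseteq\mathcal C(\dot\Delta_m)$ is the full subcategory of diagrams $X$ such that $X_i\to X_j$ is split in $\hat{\mathcal C}$ for all $1\le i\le j\le m$. Put $\underline{\mathcal C(\dot\Delta_n)}:=\mathcal C(\dot\Delta_n)/\mathcal C^{split}(\dot\Delta_n)$ and $\underline{\hat{\mathcal C}(\dot\Delta_{n-1})}:=\hat{\mathcal C}(\dot\Delta_{n-1})/\mathcal C^{split}(\dot\Delta_{n-1})$. *)

theory Defs
  imports "HOL-Algebra.Coset"
begin

section \<open>Categories and functors\<close>

text \<open>
  Hom sets need not be disjoint; therefore composition, identities, the group structure on
  the hom sets, and the action of functors on morphisms take the objects involved as arguments.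
  \<open>Comp C a b c g f\<close> is the composite of \<open>f : a \<rightarrow> b\<close> followed by \<open>g : b \<rightarrow> c\<close>.
\<close>

record ('o, 'm) cat =
  Obj :: "'o set"
  Hom :: "'o \<Rightarrow> 'o \<Rightarrow> 'm set"
  Id :: "'o \<Rightarrow> 'm"
  Comp :: "'o \<Rightarrow> 'o \<Rightarrow> 'o \<Rightarrow> 'm \<Rightarrow> 'm \<Rightarrow> 'm"

locale category =
  fixes C :: "('o, 'm, 'z) cat_scheme"
  assumes Id_in_Hom: "a \<in> Obj C \<Longrightarrow> Id C a \<in> Hom C a a"
    and Comp_in_Hom: "\<lbrakk>a \<in> Obj C; b \<in> Obj C; c \<in> Obj C; f \<in> Hom C a b; g \<in> Hom C b c\<rbrakk>
      \<Longrightarrow> Comp C a b c g f \<in> Hom C a c"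
    and Comp_Id_right: "\<lbrakk>a \<in> Obj C; b \<in> Obj C; f \<in> Hom C a b\<rbrakk> \<Longrightarrow> Comp C a a b f (Id C a) = f"
    and Comp_Id_left: "\<lbrakk>a \<in> Obj C; b \<in> Obj C; f \<in> Hom C a b\<rbrakk> \<Longrightarrow> Comp C a b b (Id C b) f = f"
    and Comp_assoc: "\<lbrakk>a \<in> Obj C; b \<in> Obj C; c \<in> Obj C; d \<in> Obj C;
        f \<in> Hom C a b; g \<in> Hom C b c; h \<in> Hom C c d\<rbrakk>
      \<Longrightarrow> Comp C a c d h (Comp C a b c g f) = Comp C a b d (Comp C b c d h g) f"

definition is_iso :: "('o, 'm, 'z) cat_scheme \<Rightarrow> 'o \<Rightarrow> 'o \<Rightarrow> 'm \<Rightarrow> bool" where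
  "is_iso C a b f \<longleftrightarrow> f \<in> Hom C a b \<and>
     (\<exists>g\<in>Hom C b a. Comp C a b a g f = Id C a \<and> Comp C b a b f g = Id C b)"

definition isomorphic :: "('o, 'm, 'z) cat_scheme \<Rightarrow> 'o \<Rightarrow> 'o \<Rightarrow> bool" where
  "isomorphic C a b \<longleftrightarrow> (\<exists>f. is_iso C a b f)"

record ('o1, 'm1, 'o2, 'm2) fun_data =
  omap :: "'o1 \<Rightarrow> 'o2"
  mmap :: "'o1 \<Rightarrow> 'o1 \<Rightarrow> 'm1 \<Rightarrow> 'm2"

text \<open>
  Functor data are normalised to \<open>undefined\<close> outside the source category, so that functors
  are equal as soon as they agree on the source category.
\<close>

definition mk_functor ::
  "('o1, 'm1, 'z) cat_scheme \<Rightarrow> ('o1 \<Rightarrow> 'o2) \<Rightarrow> ('o1 \<Rightarrow> 'o1 \<Rightarrow> 'm1 \<Rightarrow> 'm2)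
    \<Rightarrow> ('o1, 'm1, 'o2, 'm2) fun_data" where
  "mk_functor A F F' =
     \<lparr>omap = (\<lambda>a\<in>Obj A. F a),
      mmap = (\<lambda>a b f. if a \<in> Obj A \<and> b \<in> Obj A \<and> f \<in> Hom A a b then F' a b f else undefined)\<rparr>"

definition is_functor ::
  "('o1, 'm1, 'y) cat_scheme \<Rightarrow> ('o2, 'm2, 'z) cat_scheme \<Rightarrow> ('o1, 'm1, 'o2, 'm2) fun_data \<Rightarrow> bool"
  where
  "is_functor A B F \<longleftrightarrow> category A \<and> category B \<and>
     F = mk_functor A (omap F) (mmap F) \<and>
     (\<forall>a\<in>Obj A. omap F a \<in> Obj B) \<and>
     (\<forall>a\<in>Obj A. \<forall>b\<in>Obj A. \<forall>f\<in>Hom A a b. mmap F a b f \<in> Hom B (omap F a) (omap F b)) \<and>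
     (\<forall>a\<in>Obj A. mmap F a a (Id A a) = Id B (omap F a)) \<and>
     (\<forall>a\<in>Obj A. \<forall>b\<in>Obj A. \<forall>c\<in>Obj A. \<forall>f\<in>Hom A a b. \<forall>g\<in>Hom A b c.
        mmap F a c (Comp A a b c g f)
          = Comp B (omap F a) (omap F b) (omap F c) (mmap F b c g) (mmap F a b f))"

definition id_functor :: "('o, 'm, 'z) cat_scheme \<Rightarrow> ('o, 'm, 'o, 'm) fun_data" where
  "id_functor A = mk_functor A (\<lambda>a. a) (\<lambda>a b f. f)"

text \<open>\<open>comp_functor A G F\<close> is \<open>G \<circ> F\<close>, where \<open>A\<close> is the source of \<open>F\<close>.\<close>

definition comp_functor ::
  "('o1, 'm1, 'z) cat_scheme \<Rightarrow> ('o2, 'm2, 'o3, 'm3) fun_data \<Rightarrow> ('o1, 'm1, 'o2, 'm2) fun_data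
    \<Rightarrow> ('o1, 'm1, 'o3, 'm3) fun_data" where
  "comp_functor A G F =
     mk_functor A (\<lambda>a. omap G (omap F a)) (\<lambda>a b f. mmap G (omap F a) (omap F b) (mmap F a b f))"

definition naturally_isomorphic ::
  "('o1, 'm1, 'y) cat_scheme \<Rightarrow> ('o2, 'm2, 'z) cat_scheme
    \<Rightarrow> ('o1, 'm1, 'o2, 'm2) fun_data \<Rightarrow> ('o1, 'm1, 'o2, 'm2) fun_data \<Rightarrow> bool" where
  "naturally_isomorphic A B F G \<longleftrightarrow> is_functor A B F \<and> is_functor A B G \<and>
     (\<exists>t. (\<forall>a\<in>Obj A. is_iso B (omap F a) (omap G a) (t a)) \<and>
          (\<forall>a\<in>Obj A. \<forall>b\<in>Obj A. \<forall>f\<in>Hom A a b.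
             Comp B (omap F a) (omap G a) (omap G b) (mmap G a b f) (t a)
               = Comp B (omap F a) (omap F b) (omap G b) (t b) (mmap F a b f)))"

definition is_equivalence ::
  "('o1, 'm1, 'y) cat_scheme \<Rightarrow> ('o2, 'm2, 'z) cat_scheme \<Rightarrow> ('o1, 'm1, 'o2, 'm2) fun_data \<Rightarrow> bool"
  where
  "is_equivalence A B F \<longleftrightarrow> is_functor A B F \<and>
     (\<exists>G. is_functor B A G \<and>
          naturally_isomorphic A A (comp_functor A G F) (id_functor A) \<and>
          naturally_isomorphic B B (comp_functor B F G) (id_functor B))"

definition poset_category :: "'a::order set \<Rightarrow> ('a, unit) cat" where
  "poset_category P =
     \<lparr>Obj = P, Hom = (\<lambda>i j. if i \<le> j then {()} else {}), Id = (\<lambda>i. ()), Comp = (\<lambda>i j k g f. ())\<rparr>"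

abbreviation chain :: "nat \<Rightarrow> (nat, unit) cat" where
  "chain n \<equiv> poset_category {1..n}"


section \<open>Additive categories\<close>

record ('o, 'm) acat = "('o, 'm) cat" +
  Plus :: "'o \<Rightarrow> 'o \<Rightarrow> 'm \<Rightarrow> 'm \<Rightarrow> 'm"
  Null :: "'o \<Rightarrow> 'o \<Rightarrow> 'm"

text \<open>The group of morphisms, written multiplicatively in the style of \<open>HOL-Algebra\<close>.\<close>

definition hom_group :: "('o, 'm, 'z) acat_scheme \<Rightarrow> 'o \<Rightarrow> 'o \<Rightarrow> 'm monoid" where
  "hom_group C a b = \<lparr>carrier = Hom C a b, monoid.mult = Plus C a b, one = Null C a b\<rparr>"

definition is_zero_object :: "('o, 'm, 'z) acat_scheme \<Rightarrow> 'o \<Rightarrow> bool" where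
  "is_zero_object C z \<longleftrightarrow> z \<in> Obj C \<and>
     (\<forall>a\<in>Obj C. Hom C a z = {Null C a z} \<and> Hom C z a = {Null C z a})"

definition is_direct_sum ::
  "('o, 'm, 'z) acat_scheme \<Rightarrow> 'o \<Rightarrow> 'o \<Rightarrow> 'o \<Rightarrow> 'm \<Rightarrow> 'm \<Rightarrow> 'm \<Rightarrow> 'm \<Rightarrow> bool" where
  "is_direct_sum C a b s i1 i2 p1 p2 \<longleftrightarrow>
     a \<in> Obj C \<and> b \<in> Obj C \<and> s \<in> Obj C \<and>
     i1 \<in> Hom C a s \<and> i2 \<in> Hom C b s \<and> p1 \<in> Hom C s a \<and> p2 \<in> Hom C s b \<and>
     Comp C a s a p1 i1 = Id C a \<and> Comp C b s b p2 i2 = Id C b \<and>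
     Comp C a s b p2 i1 = Null C a b \<and> Comp C b s a p1 i2 = Null C b a \<and>
     Plus C s s (Comp C s a s i1 p1) (Comp C s b s i2 p2) = Id C s"

locale additive_category = category C for C :: "('o, 'm, 'z) acat_scheme" +
  assumes hom_group: "\<lbrakk>a \<in> Obj C; b \<in> Obj C\<rbrakk> \<Longrightarrow> comm_group (hom_group C a b)"
    and Comp_Plus_left: "\<lbrakk>a \<in> Obj C; b \<in> Obj C; c \<in> Obj C;
        f \<in> Hom C a b; g \<in> Hom C b c; h \<in> Hom C b c\<rbrakk>
      \<Longrightarrow> Comp C a b c (Plus C b c g h) f = Plus C a c (Comp C a b c g f) (Comp C a b c h f)"
    and Comp_Plus_right: "\<lbrakk>a \<in> Obj C; b \<in> Obj C; c \<in> Obj C;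
        f \<in> Hom C a b; g \<in> Hom C a b; h \<in> Hom C b c\<rbrakk>
      \<Longrightarrow> Comp C a b c h (Plus C a b f g) = Plus C a c (Comp C a b c h f) (Comp C a b c h g)"
    and zero_object: "\<exists>z. is_zero_object C z"
    and direct_sum: "\<lbrakk>a \<in> Obj C; b \<in> Obj C\<rbrakk> \<Longrightarrow> \<exists>s i1 i2 p1 p2. is_direct_sum C a b s i1 i2 p1 p2"

definition is_weak_kernel ::
  "('o, 'm, 'z) acat_scheme \<Rightarrow> 'o \<Rightarrow> 'o \<Rightarrow> 'm \<Rightarrow> 'o \<Rightarrow> 'm \<Rightarrow> bool" where
  "is_weak_kernel C x y f k i \<longleftrightarrow> k \<in> Obj C \<and> i \<in> Hom C k x \<and>
     (\<forall>s\<in>Obj C. (\<lambda>u. Comp C s k x i u) ` Hom C s k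
                  = {v \<in> Hom C s x. Comp C s x y f v = Null C s y})"

definition is_weak_cokernel ::
  "('o, 'm, 'z) acat_scheme \<Rightarrow> 'o \<Rightarrow> 'o \<Rightarrow> 'm \<Rightarrow> 'o \<Rightarrow> 'm \<Rightarrow> bool" where
  "is_weak_cokernel C x y f c p \<longleftrightarrow> c \<in> Obj C \<and> p \<in> Hom C y c \<and>
     (\<forall>s\<in>Obj C. (\<lambda>u. Comp C y c s u p) ` Hom C c s
                  = {v \<in> Hom C y s. Comp C x y s v f = Null C x s})"

definition is_kernel ::
  "('o, 'm, 'z) acat_scheme \<Rightarrow> 'o \<Rightarrow> 'o \<Rightarrow> 'm \<Rightarrow> 'o \<Rightarrow> 'm \<Rightarrow> bool" where
  "is_kernel C x y f k i \<longleftrightarrow> k \<in> Obj C \<and> i \<in> Hom C k x \<and> Comp C k x y f i = Null C k y \<and>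
     (\<forall>s\<in>Obj C. \<forall>v\<in>Hom C s x. Comp C s x y f v = Null C s y \<longrightarrow>
        (\<exists>!u. u \<in> Hom C s k \<and> Comp C s k x i u = v))"

locale weakly_abelian_category = additive_category C for C :: "('o, 'm, 'z) acat_scheme" +
  assumes has_weak_kernel: "\<lbrakk>x \<in> Obj C; y \<in> Obj C; f \<in> Hom C x y\<rbrakk> \<Longrightarrow>
      \<exists>k i. is_weak_kernel C x y f k i"
    and has_weak_cokernel: "\<lbrakk>x \<in> Obj C; y \<in> Obj C; f \<in> Hom C x y\<rbrakk> \<Longrightarrow>
      \<exists>c p. is_weak_cokernel C x y f c p"
    and weak_kernel: "\<lbrakk>x \<in> Obj C; y \<in> Obj C; f \<in> Hom C x y\<rbrakk> \<Longrightarrow>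
      \<exists>z\<in>Obj C. \<exists>g\<in>Hom C y z. is_weak_kernel C y z g x f"
    and weak_cokernel: "\<lbrakk>x \<in> Obj C; y \<in> Obj C; f \<in> Hom C x y\<rbrakk> \<Longrightarrow>
      \<exists>w\<in>Obj C. \<exists>g\<in>Hom C w x. is_weak_cokernel C w x g y f"


section \<open>Diagram categories and categories of morphisms\<close>

definition diagram_category ::
  "('d, 'e, 'y) cat_scheme \<Rightarrow> ('o, 'm, 'z) acat_scheme
    \<Rightarrow> (('d, 'e, 'o, 'm) fun_data, 'd \<Rightarrow> 'm) acat" where
  "diagram_category D A =
     \<lparr>Obj = {X. is_functor D A X},
      Hom = (\<lambda>X Y. {t \<in> (\<Pi>\<^sub>E d\<in>Obj D. Hom A (omap X d) (omap Y d)).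
               \<forall>d\<in>Obj D. \<forall>d'\<in>Obj D. \<forall>e\<in>Hom D d d'.
                 Comp A (omap X d) (omap Y d) (omap Y d') (mmap Y d d' e) (t d)
                   = Comp A (omap X d) (omap X d') (omap Y d') (t d') (mmap X d d' e)}),
      Id = (\<lambda>X. \<lambda>d\<in>Obj D. Id A (omap X d)),
      Comp = (\<lambda>X Y Z s t. \<lambda>d\<in>Obj D. Comp A (omap X d) (omap Y d) (omap Z d) (s d) (t d)),
      Plus = (\<lambda>X Y s t. \<lambda>d\<in>Obj D. Plus A (omap X d) (omap Y d) (s d) (t d)),
      Null = (\<lambda>X Y. \<lambda>d\<in>Obj D. Null A (omap X d) (omap Y d))\<rparr>"

text \<open>A morphism \<open>f : a \<rightarrow> b\<close>, as an object of the category of morphisms, is the triple \<open>(a, b, f)\<close>.\<close>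

definition arrow_category ::
  "('o, 'm, 'z) acat_scheme \<Rightarrow> ('o \<times> 'o \<times> 'm, 'm \<times> 'm) acat" where
  "arrow_category C =
     \<lparr>Obj = {(a, b, f). a \<in> Obj C \<and> b \<in> Obj C \<and> f \<in> Hom C a b},
      Hom = (\<lambda>(a, b, f) (a', b', f').
               {(u, v) \<in> Hom C a a' \<times> Hom C b b'. Comp C a a' b' f' u = Comp C a b b' v f}),
      Id = (\<lambda>(a, b, f). (Id C a, Id C b)),
      Comp = (\<lambda>(a, b, f) (a', b', f') (a'', b'', f'') (u', v') (u, v).
               (Comp C a a' a'' u' u, Comp C b b' b'' v' v)),
      Plus = (\<lambda>(a, b, f) (a', b', f') (u, v) (u', v'). (Plus C a a' u u', Plus C b b' v v')),
      Null = (\<lambda>(a, b, f) (a', b', f'). (Null C a a', Null C b b'))\<rparr>"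

definition is_split :: "('o, 'm, 'z) acat_scheme \<Rightarrow> 'o \<Rightarrow> 'o \<Rightarrow> 'm \<Rightarrow> bool" where
  "is_split C a b f \<longleftrightarrow>
     (\<exists>x\<in>Obj C. \<exists>y\<in>Obj C. \<exists>z\<in>Obj C. \<exists>s ix iy px py t jy jz qy qz. \<exists>g\<in>Hom C s t.
        is_direct_sum C x y s ix iy px py \<and>
        is_direct_sum C y z t jy jz qy qz \<and>
        Comp C x t y qy (Comp C x s t g ix) = Null C x y \<and>
        Comp C x t z qz (Comp C x s t g ix) = Null C x z \<and>
        Comp C y t y qy (Comp C y s t g iy) = Id C y \<and>
        Comp C y t z qz (Comp C y s t g iy) = Null C y z \<and>
        isomorphic (arrow_category C) (a, b, f) (s, t, g))"


section \<open>Quotients of additive categories\<close>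

text \<open>The full subcategory is given by its set \<open>B\<close> of objects.\<close>

definition factoring :: "('o, 'm, 'z) acat_scheme \<Rightarrow> 'o set \<Rightarrow> 'o \<Rightarrow> 'o \<Rightarrow> 'm set" where
  "factoring A B x y = {Comp A x b y h g |b g h. b \<in> B \<and> g \<in> Hom A x b \<and> h \<in> Hom A b y}"

definition mor_class :: "('o, 'm, 'z) acat_scheme \<Rightarrow> 'o set \<Rightarrow> 'o \<Rightarrow> 'o \<Rightarrow> 'm \<Rightarrow> 'm set" where
  "mor_class A B x y f = factoring A B x y #>\<^bsub>hom_group A x y\<^esub> f"

text \<open>
  Operations on residue classes are given by taking the union of the residue classes obtained
  from all representatives (cf. \<open>rcoset_mult\<close> for ideals); if the operation is
  well defined, then all of these residue classes coincide.
\<close>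

definition quotient_category ::
  "('o, 'm, 'z) acat_scheme \<Rightarrow> 'o set \<Rightarrow> ('o, 'm set) acat" where
  "quotient_category A B =
     \<lparr>Obj = Obj A,
      Hom = (\<lambda>x y. carrier (hom_group A x y Mod factoring A B x y)),
      Id = (\<lambda>x. mor_class A B x x (Id A x)),
      Comp = (\<lambda>x y z G F. \<Union>g\<in>G. \<Union>f\<in>F. mor_class A B x z (Comp A x y z g f)),
      Plus = (\<lambda>x y. monoid.mult (hom_group A x y Mod factoring A B x y)),
      Null = (\<lambda>x y. one (hom_group A x y Mod factoring A B x y))\<rparr>"

definition quotient_functor ::
  "('o, 'm, 'z) acat_scheme \<Rightarrow> 'o set \<Rightarrow> ('o, 'm, 'o, 'm set) fun_data" where
  "quotient_functor A B = mk_functor A (\<lambda>x. x) (mor_class A B)"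

text \<open>The functor \<open>A/B \<rightarrow> A'/B'\<close> induced by a functor \<open>K : A \<rightarrow> A'\<close>.\<close>

definition induced_functor ::
  "('o1, 'm1, 'y) acat_scheme \<Rightarrow> 'o1 set \<Rightarrow> ('o2, 'm2, 'z) acat_scheme \<Rightarrow> 'o2 set
    \<Rightarrow> ('o1, 'm1, 'o2, 'm2) fun_data \<Rightarrow> ('o1, 'm1 set, 'o2, 'm2 set) fun_data" where
  "induced_functor A B A' B' K =
     mk_functor (quotient_category A B) (omap K)
       (\<lambda>x y F. \<Union>f\<in>F. mor_class A' B' (omap K x) (omap K y) (mmap K x y f))"


section \<open>The Freyd category\<close>

type_synonym ('o, 'm) freyd_obj = "'o \<times> 'o \<times> 'm"
type_synonym 'm freyd_mor = "('m \<times> 'm) set"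

definition zero_arrows :: "('o, 'm, 'z) acat_scheme \<Rightarrow> ('o \<times> 'o \<times> 'm) set" where
  "zero_arrows C = {(a, b, f) \<in> Obj (arrow_category C). f = Null C a b}"

definition freyd :: "('o, 'm, 'z) acat_scheme \<Rightarrow> (('o, 'm) freyd_obj, 'm freyd_mor) acat" where
  "freyd C = quotient_category (arrow_category C) (zero_arrows C)"

definition freyd_embedding ::
  "('o, 'm, 'z) acat_scheme \<Rightarrow> ('o, 'm, ('o, 'm) freyd_obj, 'm freyd_mor) fun_data" where
  "freyd_embedding C =
     comp_functor C (quotient_functor (arrow_category C) (zero_arrows C))
       (mk_functor C (\<lambda>x. (x, x, Id C x)) (\<lambda>x y f. (f, f)))"

text \<open>A \<open>D\<close>-diagram in \<open>C\<close>, regarded as a diagram in the Freyd category.\<close>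

abbreviation embedded_diagram ::
  "('d, 'e, 'y) cat_scheme \<Rightarrow> ('o, 'm, 'z) acat_scheme \<Rightarrow> ('d, 'e, 'o, 'm) fun_data
    \<Rightarrow> ('d, 'e, ('o, 'm) freyd_obj, 'm freyd_mor) fun_data" where
  "embedded_diagram D C X \<equiv> comp_functor D (freyd_embedding C) X"

text \<open>The objects of \<open>C\<^sup>s\<^sup>p\<^sup>l\<^sup>i\<^sup>t(chain m)\<close>.\<close>

definition split_diagrams ::
  "('o, 'm, 'z) acat_scheme \<Rightarrow> nat \<Rightarrow> (nat, unit, 'o, 'm) fun_data set" where
  "split_diagrams C m =
     {X \<in> Obj (diagram_category (chain m) C). \<forall>i j. 1 \<le> i \<and> i \<le> j \<and> j \<le> m \<longrightarrow>
        is_split (freyd C)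
          (omap (freyd_embedding C) (omap X i)) (omap (freyd_embedding C) (omap X j))
          (mmap (freyd_embedding C) (omap X i) (omap X j) (mmap X i j ()))}"

definition stable_diagrams ::
  "('o, 'm, 'z) acat_scheme \<Rightarrow> nat \<Rightarrow> ((nat, unit, 'o, 'm) fun_data, (nat \<Rightarrow> 'm) set) acat" where
  "stable_diagrams C n = quotient_category (diagram_category (chain n) C) (split_diagrams C n)"

text \<open>
  Here the full subcategory consists of the split diagrams with values in \<open>C\<close>, viewed
  inside the category of diagrams with values in the Freyd category.
\<close>

definition stable_freyd_diagrams ::
  "('o, 'm, 'z) acat_scheme \<Rightarrow> nat
    \<Rightarrow> ((nat, unit, ('o, 'm) freyd_obj, 'm freyd_mor) fun_data, (nat \<Rightarrow> 'm freyd_mor) set) acat"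
  where
  "stable_freyd_diagrams C m =
     quotient_category (diagram_category (chain m) (freyd C))
       (embedded_diagram (chain m) C ` split_diagrams C m)"


section \<open>The kernel functor\<close>

text \<open>
  A choice of kernels assigns to each morphism \<open>f : x \<rightarrow> y\<close> a kernel object \<open>fst (ker x y f)\<close>
  with its inclusion \<open>snd (ker x y f)\<close> into \<open>x\<close>.
\<close>

definition kernel_choice ::
  "('o, 'm, 'z) acat_scheme \<Rightarrow> ('o \<Rightarrow> 'o \<Rightarrow> 'm \<Rightarrow> 'o \<times> 'm) \<Rightarrow> bool" where
  "kernel_choice E ker \<longleftrightarrow>
     (\<forall>x\<in>Obj E. \<forall>y\<in>Obj E. \<forall>f\<in>Hom E x y. is_kernel E x y f (fst (ker x y f)) (snd (ker x y f)))"

definition kernel_map ::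
  "('o, 'm, 'z) acat_scheme \<Rightarrow> ('o \<Rightarrow> 'o \<Rightarrow> 'm \<Rightarrow> 'o \<times> 'm)
    \<Rightarrow> 'o \<Rightarrow> 'o \<Rightarrow> 'm \<Rightarrow> 'o \<Rightarrow> 'o \<Rightarrow> 'm \<Rightarrow> 'm \<Rightarrow> 'm" where
  "kernel_map E ker x y f x' y' f' v =
     (THE u. u \<in> Hom E (fst (ker x y f)) (fst (ker x' y' f')) \<and>
        Comp E (fst (ker x y f)) (fst (ker x' y' f')) x' (snd (ker x' y' f')) u
          = Comp E (fst (ker x y f)) x x' v (snd (ker x y f)))"

definition kernel_diagram ::
  "('o, 'm, 'z) acat_scheme \<Rightarrow> ('o \<Rightarrow> 'o \<Rightarrow> 'm \<Rightarrow> 'o \<times> 'm) \<Rightarrow> nat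
    \<Rightarrow> (nat, unit, 'o, 'm) fun_data \<Rightarrow> (nat, unit, 'o, 'm) fun_data" where
  "kernel_diagram E ker n X =
     mk_functor (chain (n - 1))
       (\<lambda>i. fst (ker (omap X i) (omap X n) (mmap X i n ())))
       (\<lambda>i j e. kernel_map E ker (omap X i) (omap X n) (mmap X i n ())
                  (omap X j) (omap X n) (mmap X j n ()) (mmap X i j e))"

definition kernel_diagram_map ::
  "('o, 'm, 'z) acat_scheme \<Rightarrow> ('o \<Rightarrow> 'o \<Rightarrow> 'm \<Rightarrow> 'o \<times> 'm) \<Rightarrow> nat
    \<Rightarrow> (nat, unit, 'o, 'm) fun_data \<Rightarrow> (nat, unit, 'o, 'm) fun_data \<Rightarrow> (nat \<Rightarrow> 'm) \<Rightarrow> (nat \<Rightarrow> 'm)"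
  where
  "kernel_diagram_map E ker n X Y t =
     (\<lambda>i\<in>{1..n - 1}. kernel_map E ker (omap X i) (omap X n) (mmap X i n ())
                       (omap Y i) (omap Y n) (mmap Y i n ()) (t i))"

definition kernel_functor ::
  "('o, 'm, 'z) acat_scheme
    \<Rightarrow> (('o, 'm) freyd_obj \<Rightarrow> ('o, 'm) freyd_obj \<Rightarrow> 'm freyd_mor \<Rightarrow> ('o, 'm) freyd_obj \<times> 'm freyd_mor)
    \<Rightarrow> nat
    \<Rightarrow> ((nat, unit, 'o, 'm) fun_data, nat \<Rightarrow> 'm,
        (nat, unit, ('o, 'm) freyd_obj, 'm freyd_mor) fun_data, nat \<Rightarrow> 'm freyd_mor) fun_data" where
  "kernel_functor C ker n =
     mk_functor (diagram_category (chain n) C)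
       (\<lambda>X. kernel_diagram (freyd C) ker n (embedded_diagram (chain n) C X))
       (\<lambda>X Y t. kernel_diagram_map (freyd C) ker n
                  (embedded_diagram (chain n) C X) (embedded_diagram (chain n) C Y)
                  (\<lambda>i. mmap (freyd_embedding C) (omap X i) (omap Y i) (t i)))"

definition stable_kernel_functor ::
  "('o, 'm, 'z) acat_scheme
    \<Rightarrow> (('o, 'm) freyd_obj \<Rightarrow> ('o, 'm) freyd_obj \<Rightarrow> 'm freyd_mor \<Rightarrow> ('o, 'm) freyd_obj \<times> 'm freyd_mor)
    \<Rightarrow> nat
    \<Rightarrow> ((nat, unit, 'o, 'm) fun_data, (nat \<Rightarrow> 'm) set,
        (nat, unit, ('o, 'm) freyd_obj, 'm freyd_mor) fun_data, (nat \<Rightarrow> 'm freyd_mor) set) fun_data"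
  where
  "stable_kernel_functor C ker n =
     induced_functor
       (diagram_category (chain n) C) (split_diagrams C n)
       (diagram_category (chain (n - 1)) (freyd C))
       (embedded_diagram (chain (n - 1)) C ` split_diagrams C (n - 1))
       (kernel_functor C ker n)"

end

theory Submission
  imports Defs
begin

text \<open>
  An object \<open>(a, b, f)\<close> of the Freyd category behaves like an image of \<open>f\<close>, because a commutative
  square is determined modulo zero morphisms by its diagonal (\<open>fr_eq_iff\<close>). So every object of
  the Freyd category is a quotient of an object of \<open>C\<close>, and it is the kernel of a morphism of \<open>C\<close>,
  since \<open>f\<close> is a weak kernel (\<open>freyd_image\<close>). Objects of \<open>C\<close> are injective, since the morphisms
  of \<open>C\<close> are weak cokernels (\<open>extension\<close>). The proof rests on these three facts, and on the
  existence of kernels (\<open>freyd_has_kernel\<close>).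

  The functor \<open>K\<close> is studied before passing to the quotients. A morphism \<open>KX \<rightarrow> KY\<close> is extended
  to \<open>X \<rightarrow> Y\<close> one object at a time by injectivity, using that \<open>X\<^sub>i / KX\<^sub>i \<rightarrow> X\<^sub>i\<^sub>+\<^sub>1 / KX\<^sub>i\<^sub>+\<^sub>1\<close> is
  monomorphic, as both are subobjects of \<open>X\<^sub>n\<close>; so \<open>K\<close> is full (\<open>kernel_system_full\<close>). A given
  diagram is embedded step by step into one with values in \<open>C\<close> that satisfies this condition;
  so \<open>K\<close> is dense (\<open>kernel_system_dense\<close>).

  A morphism \<open>f\<close> of \<open>C\<close> is split in the Freyd category iff \<open>f \<circ> g \<circ> f = f\<close> for some \<open>g\<close>
  (\<open>split_freyd_iff\<close>). It follows that \<open>K\<close> maps a split diagram to a retract of a split diagram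
  with values in \<open>C\<close> (\<open>split_kernel_retract\<close>). Only a retract can be expected, as idempotents of
  \<open>C\<close> need not split in \<open>C\<close>, but ideals do not see the difference.

  It remains to show that \<open>t : X \<rightarrow> Y\<close> factors over a split diagram if \<open>K t\<close> does
  (\<open>KF_reflect\<close>). If \<open>K t = 0\<close>, then each \<open>t\<^sub>i\<close> factors over \<open>X\<^sub>i \<rightarrow> X\<^sub>n\<close>, and \<open>t\<close> is a sum of
  morphisms factoring over diagrams \<open>0 \<rightarrow> \<dots> \<rightarrow> 0 \<rightarrow> Y\<^sub>j = \<dots> = Y\<^sub>j\<close> (\<open>kernel_killing_factors\<close>). If
  \<open>K t\<close> factors over \<open>Z\<close>, prolong \<open>Z\<close> by a zero map. The result is a split diagram with kernel \<open>Z\<close>,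
  so by fullness the factorisation lifts to a morphism \<open>X \<rightarrow> Y\<close> over a split diagram, and the
  difference of \<open>t\<close> and this morphism is sent to zero by \<open>K\<close>. By \<open>induced_equivalence\<close>, these
  properties of \<open>K\<close> make the induced functor an equivalence.
\<close>

section \<open>Preadditive categories\<close>

text \<open>
  Hom sets may be nonempty for arguments that are not objects. With a single premise per
  morphism that includes its source and target, the laws of a category become conditional
  rewrite rules whose premises contain no further variables.
\<close>

definition arr :: "('o, 'm, 'z) cat_scheme \<Rightarrow> 'o \<Rightarrow> 'o \<Rightarrow> 'm \<Rightarrow> bool" where
  "arr C a b f \<longleftrightarrow> a \<in> Obj C \<and> b \<in> Obj C \<and> f \<in> Hom C a b"

lemma arrI: "\<lbrakk>f \<in> Hom C a b; a \<in> Obj C; b \<in> Obj C\<rbrakk> \<Longrightarrow> arr C a b f"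
  by (simp add: arr_def)

lemma arrD: "arr C a b f \<Longrightarrow> a \<in> Obj C" "arr C a b f \<Longrightarrow> b \<in> Obj C" "arr C a b f \<Longrightarrow> f \<in> Hom C a b"
  by (simp_all add: arr_def)

context category
begin

lemma arr_Id [simp]: "a \<in> Obj C \<Longrightarrow> arr C a a (Id C a)"
  by (simp add: arr_def Id_in_Hom)

lemma arr_Comp [simp]: "\<lbrakk>arr C a b f; arr C b c g\<rbrakk> \<Longrightarrow> arr C a c (Comp C a b c g f)"
  by (simp add: arr_def Comp_in_Hom)

lemma Comp_Id [simp]:
  "arr C a b f \<Longrightarrow> Comp C a a b f (Id C a) = f"
  "arr C a b f \<Longrightarrow> Comp C a b b (Id C b) f = f"
  by (simp_all add: arr_def Comp_Id_right Comp_Id_left)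

lemma assoc:
  "\<lbrakk>arr C a b f; arr C b c g; arr C c d h\<rbrakk>
    \<Longrightarrow> Comp C a b d (Comp C b c d h g) f = Comp C a c d h (Comp C a b c g f)"
  by (simp add: arr_def Comp_assoc)

text \<open>
  An equation \<open>h \<circ> g = k\<close> turned into a rewrite rule that also applies inside a composite
  bracketed to the right.
\<close>

lemma reassoc:
  "\<lbrakk>Comp C b c d h g = k; arr C b c g; arr C c d h; arr C a b f\<rbrakk>
    \<Longrightarrow> Comp C a c d h (Comp C a b c g f) = Comp C a b d k f"
  by (metis assoc)

lemma isoE:
  assumes "is_iso C a b f" "a \<in> Obj C" "b \<in> Obj C"
  obtains g where "arr C a b f" "arr C b a g" "Comp C a b a g f = Id C a" "Comp C b a b f g = Id C b"
  using assms by (auto simp: is_iso_def arr_def)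

lemma isoI:
  assumes "arr C a b f" "arr C b a g" "Comp C a b a g f = Id C a" "Comp C b a b f g = Id C b"
  shows "is_iso C a b f"
  using assms by (auto simp: is_iso_def arr_def)

lemma isomorphic_refl: "a \<in> Obj C \<Longrightarrow> isomorphic C a a"
  unfolding isomorphic_def by (rule exI[of _ "Id C a"], rule isoI[of _ _ _ "Id C a"]) simp_all

end

text \<open>
  Diagram, morphism and quotient categories are all formed from preadditive data alone;
  direct sums enter only through the closure property that turns the morphisms factoring over
  a given set of objects into an ideal.
\<close>

locale preadditive = category C for C :: "('o, 'm, 'z) acat_scheme" +
  assumes hom_group: "\<lbrakk>a \<in> Obj C; b \<in> Obj C\<rbrakk> \<Longrightarrow> comm_group (hom_group C a b)"
    and Comp_Plus_left: "\<lbrakk>a \<in> Obj C; b \<in> Obj C; c \<in> Obj C;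
        f \<in> Hom C a b; g \<in> Hom C b c; h \<in> Hom C b c\<rbrakk>
      \<Longrightarrow> Comp C a b c (Plus C b c g h) f = Plus C a c (Comp C a b c g f) (Comp C a b c h f)"
    and Comp_Plus_right: "\<lbrakk>a \<in> Obj C; b \<in> Obj C; c \<in> Obj C;
        f \<in> Hom C a b; g \<in> Hom C a b; h \<in> Hom C b c\<rbrakk>
      \<Longrightarrow> Comp C a b c h (Plus C a b f g) = Plus C a c (Comp C a b c h f) (Comp C a b c h g)"

sublocale additive_category \<subseteq> preadditive C
  by (intro preadditive.intro preadditive_axioms.intro category_axioms hom_group
      Comp_Plus_left Comp_Plus_right)

definition Neg :: "('o, 'm, 'z) acat_scheme \<Rightarrow> 'o \<Rightarrow> 'o \<Rightarrow> 'm \<Rightarrow> 'm" where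
  "Neg C a b f = m_inv (hom_group C a b) f"

lemma hom_group_simps [simp]:
  "carrier (hom_group C a b) = Hom C a b"
  "monoid.mult (hom_group C a b) = Plus C a b"
  "one (hom_group C a b) = Null C a b"
  by (simp_all add: hom_group_def)

lemma hom_groupI:
  assumes "\<And>f g. \<lbrakk>f \<in> Hom C a b; g \<in> Hom C a b\<rbrakk> \<Longrightarrow> Plus C a b f g \<in> Hom C a b"
    and "\<And>f g h. \<lbrakk>f \<in> Hom C a b; g \<in> Hom C a b; h \<in> Hom C a b\<rbrakk> \<Longrightarrow>
      Plus C a b (Plus C a b f g) h = Plus C a b f (Plus C a b g h)"
    and "\<And>f g. \<lbrakk>f \<in> Hom C a b; g \<in> Hom C a b\<rbrakk> \<Longrightarrow> Plus C a b f g = Plus C a b g f"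
    and "Null C a b \<in> Hom C a b"
    and "\<And>f. f \<in> Hom C a b \<Longrightarrow> Plus C a b (Null C a b) f = f"
    and "\<And>f. f \<in> Hom C a b \<Longrightarrow> \<exists>g\<in>Hom C a b. Plus C a b g f = Null C a b"
  shows "comm_group (hom_group C a b)"
  by (rule comm_groupI) (use assms in auto)

context preadditive
begin

lemma arr_Plus [simp]: "\<lbrakk>arr C a b f; arr C a b g\<rbrakk> \<Longrightarrow> arr C a b (Plus C a b f g)"
  using hom_group[of a b] comm_group.axioms(1) comm_monoid.axioms(1) monoid.m_closed
  by (fastforce simp: arr_def)

lemma arr_Null [simp]: "\<lbrakk>a \<in> Obj C; b \<in> Obj C\<rbrakk> \<Longrightarrow> arr C a b (Null C a b)"
  using hom_group[of a b] comm_group.axioms(1) comm_monoid.axioms(1) monoid.one_closed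
  by (fastforce simp: arr_def)

lemma hom_group_group: "\<lbrakk>a \<in> Obj C; b \<in> Obj C\<rbrakk> \<Longrightarrow> Group.group (hom_group C a b)"
  by (simp add: comm_group.axioms(2) hom_group)

lemma arr_Neg [simp]: "arr C a b f \<Longrightarrow> arr C a b (Neg C a b f)"
  using group.inv_closed[OF hom_group_group, of a b f] by (simp add: arr_def Neg_def)

lemma Plus_assoc:
  "\<lbrakk>arr C a b f; arr C a b g; arr C a b h\<rbrakk>
    \<Longrightarrow> Plus C a b (Plus C a b f g) h = Plus C a b f (Plus C a b g h)"
  using monoid.m_assoc[OF group.is_monoid[OF hom_group_group], of a b f g h] by (simp add: arr_def)

lemma Plus_comm: "\<lbrakk>arr C a b f; arr C a b g\<rbrakk> \<Longrightarrow> Plus C a b f g = Plus C a b g f"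
  using comm_monoid.m_comm[OF comm_group.axioms(1)[OF hom_group], of a b f g] by (simp add: arr_def)

lemma Plus_lcomm:
  "\<lbrakk>arr C a b f; arr C a b g; arr C a b h\<rbrakk>
    \<Longrightarrow> Plus C a b f (Plus C a b g h) = Plus C a b g (Plus C a b f h)"
  by (metis Plus_assoc Plus_comm)

lemmas Plus_ac = Plus_assoc Plus_comm Plus_lcomm

lemma Plus_Null [simp]:
  assumes "arr C a b f"
  shows "Plus C a b (Null C a b) f = f" "Plus C a b f (Null C a b) = f"
  using monoid.l_one[OF group.is_monoid[OF hom_group_group], of a b f]
    monoid.r_one[OF group.is_monoid[OF hom_group_group], of a b f] assms by (simp_all add: arr_def)

lemma Plus_Neg [simp]:
  assumes "arr C a b f"
  shows "Plus C a b (Neg C a b f) f = Null C a b" "Plus C a b f (Neg C a b f) = Null C a b"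
  using group.l_inv[OF hom_group_group, of a b f] group.r_inv[OF hom_group_group, of a b f] assms
  by (simp_all add: arr_def Neg_def)

lemma Plus_cancel:
  assumes "arr C a b f" "arr C a b g" "arr C a b h"
  shows "Plus C a b f g = Plus C a b f h \<longleftrightarrow> g = h"
  using assms by (metis Plus_Neg(1) Plus_Null(1) Plus_assoc arr_Neg)

lemma Plus_Neg_assoc [simp]:
  assumes "arr C a b f" "arr C a b g"
  shows "Plus C a b (Neg C a b f) (Plus C a b f g) = g"
  using assms by (simp flip: Plus_assoc)

lemma Neg_unique:
  assumes "Plus C a b f g = Null C a b" "arr C a b f" "arr C a b g"
  shows "g = Neg C a b f"
  using assms by (metis Plus_Neg(2) Plus_cancel arr_Neg)

lemma Neg_eq_iff:
  assumes "arr C a b f" "arr C a b g"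
  shows "Plus C a b f (Neg C a b g) = Null C a b \<longleftrightarrow> f = g"
  using assms by (metis Neg_unique Plus_Neg(1) Plus_Neg(2) Plus_comm arr_Neg)

lemma Comp_Plus [simp]:
  "\<lbrakk>arr C a b f; arr C b c g; arr C b c h\<rbrakk>
    \<Longrightarrow> Comp C a b c (Plus C b c g h) f = Plus C a c (Comp C a b c g f) (Comp C a b c h f)"
  "\<lbrakk>arr C a b f; arr C a b f'; arr C b c g\<rbrakk>
    \<Longrightarrow> Comp C a b c g (Plus C a b f f') = Plus C a c (Comp C a b c g f) (Comp C a b c g f')"
  by (simp_all add: arr_def Comp_Plus_left Comp_Plus_right)

lemma Plus_self_Null: "\<lbrakk>Plus C a b f f = f; arr C a b f\<rbrakk> \<Longrightarrow> f = Null C a b"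
  by (metis Plus_Null(2) Plus_cancel arr_Null arr_def)

lemma Comp_Null [simp]:
  "\<lbrakk>arr C a b f; c \<in> Obj C\<rbrakk> \<Longrightarrow> Comp C a b c (Null C b c) f = Null C a c"
  "\<lbrakk>arr C b c g; a \<in> Obj C\<rbrakk> \<Longrightarrow> Comp C a b c g (Null C a b) = Null C a c"
proof -
  assume f: "arr C a b f" "c \<in> Obj C"
  then have b: "b \<in> Obj C" by (simp add: arr_def)
  show "Comp C a b c (Null C b c) f = Null C a c"
    using Comp_Plus(1)[OF f(1), of c "Null C b c" "Null C b c"] f b
    by (intro Plus_self_Null) simp_all
next
  assume g: "arr C b c g" "a \<in> Obj C"
  then have b: "b \<in> Obj C" by (simp add: arr_def)
  show "Comp C a b c g (Null C a b) = Null C a c"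
    using Comp_Plus(2)[OF _ _ g(1), of a "Null C a b" "Null C a b"] g b
    by (intro Plus_self_Null) simp_all
qed

lemma Comp_Neg [simp]:
  assumes "arr C a b f" "arr C b c g"
  shows "Comp C a b c (Neg C b c g) f = Neg C a c (Comp C a b c g f)"
    "Comp C a b c g (Neg C a b f) = Neg C a c (Comp C a b c g f)"
proof -
  have o: "a \<in> Obj C" "b \<in> Obj C" "c \<in> Obj C" using assms by (auto simp: arr_def)
  show "Comp C a b c (Neg C b c g) f = Neg C a c (Comp C a b c g f)"
    by (rule Neg_unique) (use assms o in \<open>simp_all flip: Comp_Plus\<close>)
  show "Comp C a b c g (Neg C a b f) = Neg C a c (Comp C a b c g f)"
    by (rule Neg_unique) (use assms o in \<open>simp_all flip: Comp_Plus\<close>)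
qed

lemma Neg_Null [simp]: "\<lbrakk>a \<in> Obj C; b \<in> Obj C\<rbrakk> \<Longrightarrow> Neg C a b (Null C a b) = Null C a b"
  by (metis Neg_unique Plus_Null(1) arr_Null)

lemma Neg_Neg [simp]: "arr C a b f \<Longrightarrow> Neg C a b (Neg C a b f) = f"
  by (metis Neg_unique Plus_Neg(1) arr_Neg)

end

lemma is_direct_sumD:
  assumes "is_direct_sum C a b s i1 i2 p1 p2"
  shows "a \<in> Obj C" "b \<in> Obj C" "s \<in> Obj C"
    "arr C a s i1" "arr C b s i2" "arr C s a p1" "arr C s b p2"
    "Comp C a s a p1 i1 = Id C a" "Comp C b s b p2 i2 = Id C b"
    "Comp C a s b p2 i1 = Null C a b" "Comp C b s a p1 i2 = Null C b a"
    "Plus C s s (Comp C s a s i1 p1) (Comp C s b s i2 p2) = Id C s"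
  using assms by (simp_all add: is_direct_sum_def arr_def)

lemma is_direct_sumI:
  assumes "arr C a s i1" "arr C b s i2" "arr C s a p1" "arr C s b p2"
    "Comp C a s a p1 i1 = Id C a" "Comp C b s b p2 i2 = Id C b"
    "Comp C a s b p2 i1 = Null C a b" "Comp C b s a p1 i2 = Null C b a"
    "Plus C s s (Comp C s a s i1 p1) (Comp C s b s i2 p2) = Id C s"
  shows "is_direct_sum C a b s i1 i2 p1 p2"
  using assms by (simp add: is_direct_sum_def arr_def)

section \<open>Functors\<close>

notation omap (\<open>_$_\<close> [1000, 1000] 1000)

lemma mk_functor_simps [simp]:
  "a \<in> Obj A \<Longrightarrow> (mk_functor A F F')$a = F a"
  "arr A a b f \<Longrightarrow> mmap (mk_functor A F F') a b f = F' a b f"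
  "\<lbrakk>a \<in> Obj A; b \<in> Obj A; f \<in> Hom A a b\<rbrakk> \<Longrightarrow> mmap (mk_functor A F F') a b f = F' a b f"
  by (simp_all add: mk_functor_def arr_def)

lemma mk_functor_cong:
  assumes "\<And>a. a \<in> Obj A \<Longrightarrow> F a = G a" "\<And>a b f. arr A a b f \<Longrightarrow> F' a b f = G' a b f"
  shows "mk_functor A F F' = mk_functor A G G'"
  using assms by (auto simp: mk_functor_def arr_def fun_eq_iff restrict_def)

lemma mk_functor_idem [simp]:
  "mk_functor A (omap (mk_functor A F F')) (mmap (mk_functor A F F')) = mk_functor A F F'"
  by (rule mk_functor_cong) simp_all

lemma is_functorD:
  assumes "is_functor A B F"
  shows "category A" "category B" "F = mk_functor A (omap F) (mmap F)"
    "a \<in> Obj A \<Longrightarrow> F$a \<in> Obj B"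
    "arr A a b f \<Longrightarrow> arr B F$a F$b (mmap F a b f)"
    "a \<in> Obj A \<Longrightarrow> mmap F a a (Id A a) = Id B F$a"
    "\<lbrakk>arr A a b f; arr A b c g\<rbrakk> \<Longrightarrow> mmap F a c (Comp A a b c g f)
       = Comp B F$a F$b F$c (mmap F b c g) (mmap F a b f)"
  using assms unfolding is_functor_def arr_def by blast+

lemma is_functorI:
  assumes "category A" "category B" "F = mk_functor A (omap F) (mmap F)"
    "\<And>a. a \<in> Obj A \<Longrightarrow> F$a \<in> Obj B"
    "\<And>a b f. arr A a b f \<Longrightarrow> arr B F$a F$b (mmap F a b f)"
    "\<And>a. a \<in> Obj A \<Longrightarrow> mmap F a a (Id A a) = Id B F$a"
    "\<And>a b c f g. \<lbrakk>arr A a b f; arr A b c g\<rbrakk> \<Longrightarrow> mmap F a c (Comp A a b c g f)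
       = Comp B F$a F$b F$c (mmap F b c g) (mmap F a b f)"
  shows "is_functor A B F"
  unfolding is_functor_def using assms unfolding arr_def by blast

lemma is_functor_mkI:
  assumes "category A" "category B"
    "\<And>a. a \<in> Obj A \<Longrightarrow> F a \<in> Obj B"
    "\<And>a b f. arr A a b f \<Longrightarrow> arr B (F a) (F b) (F' a b f)"
    "\<And>a. a \<in> Obj A \<Longrightarrow> F' a a (Id A a) = Id B (F a)"
    "\<And>a b c f g. \<lbrakk>arr A a b f; arr A b c g\<rbrakk> \<Longrightarrow> F' a c (Comp A a b c g f)
       = Comp B (F a) (F b) (F c) (F' b c g) (F' a b f)"
  shows "is_functor A B (mk_functor A F F')"
proof -
  interpret A: category A by fact
  note o = arrD(1,2)
  show ?thesis
    by (rule is_functorI) (use assms in \<open>auto simp: o\<close>)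
qed

lemma functor_eqI:
  assumes "is_functor A B F" "is_functor A B G"
    "\<And>a. a \<in> Obj A \<Longrightarrow> F$a = G$a" "\<And>a b f. arr A a b f \<Longrightarrow> mmap F a b f = mmap G a b f"
  shows "F = G"
  by (subst is_functorD(3)[OF assms(1)], subst is_functorD(3)[OF assms(2)])
    (rule mk_functor_cong; use assms in simp)

lemma id_functor_simps [simp]:
  "a \<in> Obj A \<Longrightarrow> (id_functor A)$a = a"
  "arr A a b f \<Longrightarrow> mmap (id_functor A) a b f = f"
  by (simp_all add: id_functor_def)

lemma is_functor_id: "category A \<Longrightarrow> is_functor A A (id_functor A)"
  unfolding id_functor_def by (rule is_functor_mkI) simp_all

lemma comp_functor_simps [simp]:
  "a \<in> Obj A \<Longrightarrow> (comp_functor A G F)$a = G$F$a"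
  "arr A a b f \<Longrightarrow> mmap (comp_functor A G F) a b f = mmap G F$a F$b (mmap F a b f)"
  by (simp_all add: comp_functor_def)

lemma is_functor_comp:
  assumes F: "is_functor A B F" and G: "is_functor B D G"
  shows "is_functor A D (comp_functor A G F)"
  unfolding comp_functor_def
  by (rule is_functor_mkI) (simp_all add: is_functorD(1,2,4-7)[OF F] is_functorD(1,2,4-7)[OF G])

text \<open>
  A quasi-inverse of a fully faithful and dense functor \<open>F\<close> is obtained by choosing for each
  \<open>b\<close> an object \<open>G b\<close> with an isomorphism \<open>e b : F (G b) \<rightarrow> b\<close>, and by transporting morphisms
  along these isomorphisms.
\<close>

theorem is_equivalenceI:
  assumes F: "is_functor A B F"
    and full: "\<And>x y g. \<lbrakk>x \<in> Obj A; y \<in> Obj A; arr B F$x F$y g\<rbrakk>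
      \<Longrightarrow> \<exists>f. arr A x y f \<and> mmap F x y f = g"
    and faithful: "\<And>x y f g. \<lbrakk>arr A x y f; arr A x y g; mmap F x y f = mmap F x y g\<rbrakk> \<Longrightarrow> f = g"
    and dense: "\<And>b. b \<in> Obj B \<Longrightarrow> \<exists>a\<in>Obj A. isomorphic B F$a b"
  shows "is_equivalence A B F"
proof -
  interpret A: category A by (rule is_functorD[OF F])
  interpret B: category B by (rule is_functorD[OF F])
  note [simp] = is_functorD(4-7)[OF F]
  have "\<exists>p. fst p \<in> Obj A \<and> arr B F$(fst p) b (fst (snd p))
      \<and> arr B b F$(fst p) (snd (snd p))
      \<and> Comp B F$(fst p) b F$(fst p) (snd (snd p)) (fst (snd p)) = Id B F$(fst p)
      \<and> Comp B b F$(fst p) b (fst (snd p)) (snd (snd p)) = Id B b" if b: "b \<in> Obj B" for b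
  proof -
    obtain a f where "a \<in> Obj A" "is_iso B F$a b f"
      using dense[OF b] by (auto simp: isomorphic_def)
    moreover from this obtain g where "arr B F$a b f" "arr B b F$a g"
      "Comp B F$a b F$a g f = Id B F$a" "Comp B b F$a b f g = Id B b"
      using b by (auto elim!: B.isoE)
    ultimately show ?thesis by (intro exI[of _ "(a, f, g)"]) auto
  qed
  then obtain P where P: "\<And>b. b \<in> Obj B \<Longrightarrow> fst (P b) \<in> Obj A \<and> arr B F$(fst (P b)) b (fst (snd (P b)))
      \<and> arr B b F$(fst (P b)) (snd (snd (P b)))
      \<and> Comp B F$(fst (P b)) b F$(fst (P b)) (snd (snd (P b))) (fst (snd (P b))) = Id B F$(fst (P b))
      \<and> Comp B b F$(fst (P b)) b (fst (snd (P b))) (snd (snd (P b))) = Id B b"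
    by metis
  define G where "G b = fst (P b)" for b
  define e where "e b = fst (snd (P b))" for b
  define d where "d b = snd (snd (P b))" for b
  have G [simp]: "G b \<in> Obj A" and e [simp]: "arr B F$(G b) b (e b)"
    and d [simp]: "arr B b F$(G b) (d b)"
    and de: "Comp B F$(G b) b F$(G b) (d b) (e b) = Id B F$(G b)"
    and ed: "Comp B b F$(G b) b (e b) (d b) = Id B b" if "b \<in> Obj B" for b
    using P[OF that] by (auto simp: G_def e_def d_def)
  define pre where "pre x y g = (SOME f. arr A x y f \<and> mmap F x y f = g)" for x y g
  have pre: "arr A x y (pre x y g)" "mmap F x y (pre x y g) = g"
    if "x \<in> Obj A" "y \<in> Obj A" "arr B F$x F$y g" for x y g
    using someI_ex[OF full[OF that]] unfolding pre_def by auto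
  have preI: "pre x y g = f" if "arr A x y f" "mmap F x y f = g" for x y f g
  proof -
    have o: "x \<in> Obj A" "y \<in> Obj A" "arr B F$x F$y g"
      using that by (auto dest: arrD)
    show ?thesis by (rule faithful[OF pre(1)[OF o] that(1)]) (simp add: pre(2)[OF o] that(2))
  qed
  define tr where "tr b c g = Comp B F$(G b) c F$(G c) (d c) (Comp B F$(G b) b c g (e b))"
    for b c g
  have tr [simp]: "arr B F$(G b) F$(G c) (tr b c g)" if "arr B b c g" for b c g
    using that arrD(1,2)[OF that] by (simp add: tr_def)
  define GF where "GF = mk_functor B G (\<lambda>b c g. pre (G b) (G c) (tr b c g))"
  have preG: "arr A (G b) (G c) (pre (G b) (G c) (tr b c g))"
    "mmap F (G b) (G c) (pre (G b) (G c) (tr b c g)) = tr b c g" if "arr B b c g" for b c g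
    using that arrD(1,2)[OF that] pre by simp_all
  have GF: "is_functor B A GF" unfolding GF_def
  proof (rule is_functor_mkI)
    fix b assume b: "b \<in> Obj B"
    show "pre (G b) (G b) (tr b b (Id B b)) = Id A (G b)"
      by (rule preI) (use b in \<open>simp_all add: tr_def de\<close>)
  next
    fix b c k f g assume fg: "arr B b c f" "arr B c k g"
    note o = arrD(1,2)[OF fg(1)] arrD(1,2)[OF fg(2)]
    show "pre (G b) (G k) (tr b k (Comp B b c k g f)) = Comp A (G b) (G c) (G k)
        (pre (G c) (G k) (tr c k g)) (pre (G b) (G c) (tr b c f))"
    proof (rule preI)
      show "mmap F (G b) (G k) (Comp A (G b) (G c) (G k)
        (pre (G c) (G k) (tr c k g)) (pre (G b) (G c) (tr b c f))) = tr b k (Comp B b c k g f)"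
        using fg o preG[OF fg(1)] preG[OF fg(2)]
        by (simp add: tr_def B.assoc B.reassoc[OF ed])
    qed (use fg o preG in simp)
  qed (use preG in \<open>simp_all add: A.category_axioms B.category_axioms\<close>)
  have "naturally_isomorphic A A (comp_functor A GF F) (id_functor A)"
    unfolding naturally_isomorphic_def
  proof (intro conjI exI ballI)
    let ?t = "\<lambda>a. pre (G F$a) a (e F$a)"
    have t: "arr A (G F$a) a (?t a)" "mmap F (G F$a) a (?t a) = e F$a"
      if "a \<in> Obj A" for a using that pre by simp_all
    show "is_functor A A (comp_functor A GF F)" by (rule is_functor_comp[OF F GF])
    show "is_functor A A (id_functor A)" by (rule is_functor_id) (fact A.category_axioms)
    fix a assume a: "a \<in> Obj A"
    let ?s = "pre a (G F$a) (d F$a)"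
    have s: "arr A a (G F$a) ?s" "mmap F a (G F$a) ?s = d F$a"
      using a pre by simp_all
    have 1: "Comp A (G F$a) a (G F$a) ?s (?t a) = Id A (G F$a)"
      by (rule faithful[of "G F$a" "G F$a"]) (use s t a in \<open>simp_all add: de\<close>)
    have 2: "Comp A a (G F$a) a (?t a) ?s = Id A a"
      by (rule faithful[of a a]) (use s t a in \<open>simp_all add: ed\<close>)
    show "is_iso A (comp_functor A GF F)$a (id_functor A)$a (?t a)"
      using A.isoI[OF t(1)[OF a] s(1) 1 2] a by (simp add: GF_def)
    fix b f assume b: "b \<in> Obj A" and f: "f \<in> Hom A a b"
    have f: "arr A a b f" using a b f by (simp add: arr_def)
    have "Comp A (G F$a) a b f (?t a) =
        Comp A (G F$a) (G F$b) b (?t b) (pre (G F$a) (G F$b)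
          (tr F$a F$b (mmap F a b f)))"
      by (rule faithful[of "G F$a" b])
        (use a b f t preG[of "F$a" "F$b"] in
          \<open>simp_all add: tr_def B.reassoc[OF ed]\<close>)
    then show "Comp A (comp_functor A GF F)$a (id_functor A)$a (id_functor A)$b
        (mmap (id_functor A) a b f) (?t a)
      = Comp A (comp_functor A GF F)$a (comp_functor A GF F)$b (id_functor A)$b
        (?t b) (mmap (comp_functor A GF F) a b f)"
      using a b f by (simp add: GF_def)
  qed
  moreover have "naturally_isomorphic B B (comp_functor B F GF) (id_functor B)"
    unfolding naturally_isomorphic_def
  proof (intro conjI exI ballI)
    show "is_functor B B (comp_functor B F GF)" by (rule is_functor_comp[OF GF F])
    show "is_functor B B (id_functor B)" by (rule is_functor_id) (fact B.category_axioms)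
    fix a assume a: "a \<in> Obj B"
    show "is_iso B (comp_functor B F GF)$a (id_functor B)$a (e a)"
      using B.isoI[OF e d de ed] a by (simp add: GF_def)
    fix b f assume b: "b \<in> Obj B" and f: "f \<in> Hom B a b"
    have f: "arr B a b f" using a b f by (simp add: arr_def)
    show "Comp B (comp_functor B F GF)$a (id_functor B)$a (id_functor B)$b
        (mmap (id_functor B) a b f) (e a)
      = Comp B (comp_functor B F GF)$a (comp_functor B F GF)$b (id_functor B)$b
        (e b) (mmap (comp_functor B F GF) a b f)"
      using a b f preG[OF f] by (simp add: GF_def tr_def B.reassoc[OF ed])
  qed
  ultimately show ?thesis using F GF by (auto simp: is_equivalence_def)
qed

section \<open>Quotients by the ideal of morphisms factoring over given objects\<close>

lemma factoringI:
  "\<lbrakk>b \<in> B; arr A x b g; arr A b y h\<rbrakk> \<Longrightarrow> Comp A x b y h g \<in> factoring A B x y"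
  by (auto simp: factoring_def arr_def)

lemma factoringE:
  assumes "f \<in> factoring A B x y" "B \<subseteq> Obj A" "x \<in> Obj A" "y \<in> Obj A"
  obtains b g h where "b \<in> B" "b \<in> Obj A" "arr A x b g" "arr A b y h" "f = Comp A x b y h g"
  using assms by (auto simp: factoring_def arr_def)

text \<open>
  Morphisms factoring over \<open>B\<close> are always closed under composition with arbitrary morphisms; they
  are closed under addition because \<open>B\<close> contains direct sums of its elements.
\<close>

locale factoring_ideal = preadditive A for A :: "('o, 'm, 'z) acat_scheme" +
  fixes B :: "'o set"
  assumes B_Obj: "B \<subseteq> Obj A"
    and B_nonempty: "B \<noteq> {}"
    and B_sum: "\<lbrakk>b \<in> B; b' \<in> B\<rbrakk> \<Longrightarrow> \<exists>s\<in>B. \<exists>i1 i2 p1 p2. is_direct_sum A b b' s i1 i2 p1 p2"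
begin

lemma factoring_arr:
  assumes "f \<in> factoring A B x y" "x \<in> Obj A" "y \<in> Obj A"
  shows "arr A x y f"
  using assms by (elim factoringE[OF _ B_Obj]) simp_all

lemma factoring_Comp_left:
  assumes "f \<in> factoring A B x y" "x \<in> Obj A" "arr A y z g"
  shows "Comp A x y z g f \<in> factoring A B x z"
proof -
  obtain b u h where "b \<in> B" "arr A x b u" "arr A b y h" "f = Comp A x b y h u"
    using assms by (elim factoringE[OF _ B_Obj]) (auto dest: arrD)
  then show ?thesis using assms factoringI[of b B A x u z "Comp A b y z g h"]
    by (simp add: assoc)
qed

lemma factoring_Comp_right:
  assumes "f \<in> factoring A B x y" "arr A w x g" "y \<in> Obj A"
  shows "Comp A w x y f g \<in> factoring A B w y"
proof -
  obtain b u h where "b \<in> B" "arr A x b u" "arr A b y h" "f = Comp A x b y h u"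
    using assms by (elim factoringE[OF _ B_Obj]) (auto dest: arrD)
  then show ?thesis using assms factoringI[of b B A w "Comp A w x b u g" y h]
    by (simp add: assoc)
qed

lemma factoring_Null:
  assumes "x \<in> Obj A" "y \<in> Obj A"
  shows "Null A x y \<in> factoring A B x y"
proof -
  obtain b where "b \<in> B" "b \<in> Obj A" using B_nonempty B_Obj by auto
  then show ?thesis using factoringI[of b B A x "Null A x b" y "Null A b y"] assms by simp
qed

text \<open>
  If \<open>f\<close> and \<open>f'\<close> factor over \<open>b\<close> and \<open>b'\<close>, then \<open>f + f'\<close> factors over their direct sum, as a
  row times a column.
\<close>

lemma factoring_Plus:
  assumes "f \<in> factoring A B x y" "f' \<in> factoring A B x y" "x \<in> Obj A" "y \<in> Obj A"
  shows "Plus A x y f f' \<in> factoring A B x y"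
proof -
  obtain b g h where b: "b \<in> B" "arr A x b g" "arr A b y h" "f = Comp A x b y h g"
    using assms by (elim factoringE[OF _ B_Obj])
  obtain b' g' h' where b': "b' \<in> B" "arr A x b' g'" "arr A b' y h'" "f' = Comp A x b' y h' g'"
    using assms(2,3,4) by (elim factoringE[OF _ B_Obj])
  obtain s i1 i2 p1 p2 where s: "s \<in> B" and ds: "is_direct_sum A b b' s i1 i2 p1 p2"
    using B_sum[OF b(1) b'(1)] by blast
  note d [simp] = is_direct_sumD[OF ds]
  have "Comp A x s y (Plus A s y (Comp A s b y h p1) (Comp A s b' y h' p2))
      (Plus A x s (Comp A x b s i1 g) (Comp A x b' s i2 g')) = Plus A x y f f'"
    using b b' assms by (simp add: assoc reassoc[OF d(8)] reassoc[OF d(9)] reassoc[OF d(10)] reassoc[OF d(11)])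
  then show ?thesis
    using factoringI[OF s, of A x "Plus A x s (Comp A x b s i1 g) (Comp A x b' s i2 g')"
        y "Plus A s y (Comp A s b y h p1) (Comp A s b' y h' p2)"] b b' by simp
qed

lemma factoring_Neg:
  assumes "f \<in> factoring A B x y" "x \<in> Obj A" "y \<in> Obj A"
  shows "Neg A x y f \<in> factoring A B x y"
  using factoring_Comp_left[OF assms(1,2), of y "Neg A y y (Id A y)"] factoring_arr[OF assms] assms(3)
  by simp

lemma factoring_normal:
  assumes "x \<in> Obj A" "y \<in> Obj A"
  shows "normal (factoring A B x y) (hom_group A x y)"
proof -
  interpret G: comm_group "hom_group A x y" by (rule hom_group) fact+
  have "subgroup (factoring A B x y) (hom_group A x y)"
  proof (rule G.subgroupI)
    show "factoring A B x y \<subseteq> carrier (hom_group A x y)"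
      using factoring_arr assms by (auto simp: arr_def)
    show "factoring A B x y \<noteq> {}" using factoring_Null assms by blast
  qed (use factoring_Plus factoring_Neg assms in \<open>auto simp flip: Neg_def\<close>)
  then show ?thesis by (rule G.subgroup_imp_normal)
qed

abbreviation "Q \<equiv> quotient_category A B"
abbreviation "cls \<equiv> mor_class A B"

lemma Obj_quotient [simp]: "Obj Q = Obj A"
  by (simp add: quotient_category_def)

lemma Hom_quotient:
  "\<lbrakk>x \<in> Obj A; y \<in> Obj A\<rbrakk> \<Longrightarrow> Hom Q x y = cls x y ` Hom A x y"
  by (auto simp: quotient_category_def FactGroup_def RCOSETS_def mor_class_def)

lemma mem_cls_iff: "g \<in> cls x y f \<longleftrightarrow> (\<exists>h\<in>factoring A B x y. g = Plus A x y h f)"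
  by (auto simp: mor_class_def r_coset_def)

lemma cls_self: "arr A x y f \<Longrightarrow> f \<in> cls x y f"
  using factoring_Null Plus_Null unfolding mem_cls_iff by (metis arrD(1,2))

lemma arr_cls [simp]: "arr A x y f \<Longrightarrow> arr Q x y (cls x y f)"
  by (auto simp: arr_def Hom_quotient)

lemma arr_quotientE:
  assumes "arr Q x y F"
  obtains f where "arr A x y f" "F = cls x y f"
  using assms by (auto simp: arr_def Hom_quotient)

lemma cls_eq_iff:
  assumes "arr A x y f" "arr A x y g"
  shows "cls x y f = cls x y g \<longleftrightarrow> (\<exists>h\<in>factoring A B x y. f = Plus A x y h g)"
proof
  assume "cls x y f = cls x y g"
  then have "f \<in> cls x y g" using cls_self assms by blast
  then show "\<exists>h\<in>factoring A B x y. f = Plus A x y h g" by (simp add: mem_cls_iff)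
next
  have o: "x \<in> Obj A" "y \<in> Obj A" using assms by (auto dest: arrD)
  assume "\<exists>h\<in>factoring A B x y. f = Plus A x y h g"
  then have "f \<in> factoring A B x y #>\<^bsub>hom_group A x y\<^esub> g" by (auto simp: r_coset_def)
  then show "cls x y f = cls x y g"
    unfolding mor_class_def
    using group.repr_independence[OF hom_group_group, of x y f "factoring A B x y" g] o assms(2)
      normal_imp_subgroup[OF factoring_normal] by (simp add: arr_def)
qed

lemma cls_eq_Null_iff:
  assumes "arr A x y f"
  shows "cls x y f = cls x y (Null A x y) \<longleftrightarrow> f \<in> factoring A B x y"
proof -
  have o: "x \<in> Obj A" "y \<in> Obj A" using assms by (auto dest: arrD)
  have "f \<in> factoring A B x y \<longleftrightarrow> (\<exists>h\<in>factoring A B x y. f = Plus A x y h (Null A x y))"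
    using Plus_Null(2) factoring_arr o by metis
  then show ?thesis using assms o by (simp add: cls_eq_iff)
qed

lemma Id_quotient [simp]: "Id Q x = cls x x (Id A x)"
  by (simp add: quotient_category_def)

text \<open>
  All representatives give the same class because the morphisms factoring over \<open>B\<close> are closed
  under composition with arbitrary morphisms.
\<close>

lemma Comp_quotient [simp]:
  assumes f: "arr A x y f" and g: "arr A y z g"
  shows "Comp Q x y z (cls y z g) (cls x y f) = cls x z (Comp A x y z g f)"
proof -
  have o: "x \<in> Obj A" "y \<in> Obj A" "z \<in> Obj A" using assms by (auto dest: arrD)
  have "cls x z (Comp A x y z g' f') = cls x z (Comp A x y z g f)"
    if g': "g' \<in> cls y z g" and f': "f' \<in> cls x y f" for g' f'
  proof -
    obtain h k where h: "h \<in> factoring A B y z" "g' = Plus A y z h g"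
      and k: "k \<in> factoring A B x y" "f' = Plus A x y k f"
      using g' f' by (auto simp: mem_cls_iff)
    note a = factoring_arr[OF h(1) o(2,3)] factoring_arr[OF k(1) o(1,2)]
    have "Comp A x y z h k \<in> factoring A B x z" "Comp A x y z h f \<in> factoring A B x z"
      "Comp A x y z g k \<in> factoring A B x z"
      using h k f g a o factoring_Comp_left factoring_Comp_right by metis+
    then have "Plus A x z (Comp A x y z h k) (Plus A x z (Comp A x y z h f) (Comp A x y z g k))
        \<in> factoring A B x z"
      using factoring_Plus o by metis
    moreover have "Comp A x y z g' f' =
      Plus A x z (Plus A x z (Comp A x y z h k) (Plus A x z (Comp A x y z h f) (Comp A x y z g k)))
        (Comp A x y z g f)"
      using a f g h k by (simp add: Plus_ac)
    ultimately show ?thesis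
      using a f g h k by (subst cls_eq_iff) auto
  qed
  moreover have "g \<in> cls y z g" "f \<in> cls x y f" using cls_self f g by auto
  ultimately have "(\<Union>g'\<in>cls y z g. \<Union>f'\<in>cls x y f. cls x z (Comp A x y z g' f')) = cls x z (Comp A x y z g f)"
    by blast
  then show ?thesis by (simp add: quotient_category_def)
qed

lemma Plus_quotient [simp]:
  assumes f: "arr A x y f" and g: "arr A x y g"
  shows "Plus Q x y (cls x y f) (cls x y g) = cls x y (Plus A x y f g)"
  using normal.rcos_sum[OF factoring_normal, of x y f g] assms
  by (simp add: quotient_category_def mor_class_def arr_def)

lemma Null_quotient:
  assumes "x \<in> Obj A" "y \<in> Obj A"
  shows "Null Q x y = cls x y (Null A x y)"
proof -
  have "factoring A B x y #>\<^bsub>hom_group A x y\<^esub> \<one>\<^bsub>hom_group A x y\<^esub> = factoring A B x y"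
    by (rule Coset.group.coset_mult_one[OF hom_group_group])
      (use assms subgroup.subset[OF normal_imp_subgroup[OF factoring_normal]] in auto)
  then show ?thesis
    by (simp add: quotient_category_def mor_class_def)
qed

lemma factoring_Null_quotient:
  assumes "arr A x y f"
  shows "cls x y f = Null Q x y \<longleftrightarrow> f \<in> factoring A B x y"
  using assms cls_eq_Null_iff by (simp add: Null_quotient arrD)

lemma hom_group_quotient:
  assumes "x \<in> Obj A" "y \<in> Obj A"
  shows "comm_group (hom_group Q x y)"
proof -
  have "hom_group Q x y = hom_group A x y Mod factoring A B x y"
    by (simp add: hom_group_def[of Q] quotient_category_def FactGroup_def)
  then show ?thesis
    using comm_group.abelian_FactGroup[OF hom_group, of x y] assms
      normal_imp_subgroup[OF factoring_normal] by simp
qed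

theorem preadditive_quotient: "preadditive Q"
proof -
  have E: "\<exists>f'. arr A x y f' \<and> f = cls x y f'" if "f \<in> Hom Q x y" "x \<in> Obj Q" "y \<in> Obj Q" for x y f
    using arr_quotientE[OF arrI[OF that]] by blast
  note A = arrD(3)[OF arr_cls]
  show ?thesis
  proof (intro preadditive.intro category.intro preadditive_axioms.intro, goal_cases)
    case (1 a)
    then show ?case using A[OF arr_Id] by simp
  next
    case (2 a b c f g)
    then show ?case using E[of f a b] E[of g b c] by (auto intro: arrD)
  next
    case (3 a b f)
    then show ?case using E[of f a b] by auto
  next
    case (4 a b f)
    then show ?case using E[of f a b] by auto
  next
    case (5 a b c d f g h)
    then show ?case using E[of f a b] E[of g b c] E[of h c d] by (auto simp: assoc)
  next
    case (6 a b)
    then show ?case using hom_group_quotient by simp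
  next
    case (7 a b c f g h)
    then show ?case using E[of f a b] E[of g b c] E[of h b c] by auto
  next
    case (8 a b c f g h)
    then show ?case using E[of f a b] E[of g a b] E[of h b c] by auto
  qed
qed

end

section \<open>Additive functors and induced functors\<close>

definition additive :: "('o1, 'm1, 'y) acat_scheme \<Rightarrow> ('o2, 'm2, 'z) acat_scheme
    \<Rightarrow> ('o1, 'm1, 'o2, 'm2) fun_data \<Rightarrow> bool" where
  "additive A A' F \<longleftrightarrow> (\<forall>a b f g. arr A a b f \<longrightarrow> arr A a b g \<longrightarrow>
     mmap F a b (Plus A a b f g) = Plus A' F$a F$b (mmap F a b f) (mmap F a b g))"

lemma additive_Null:
  assumes "is_functor A A' F" "additive A A' F" "preadditive A" "preadditive A'" "a \<in> Obj A" "b \<in> Obj A"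
  shows "mmap F a b (Null A a b) = Null A' F$a F$b"
proof -
  interpret A: preadditive A by fact
  interpret A': preadditive A' by fact
  have n: "arr A a b (Null A a b)" using assms by simp
  then have "Plus A' F$a F$b (mmap F a b (Null A a b)) (mmap F a b (Null A a b))
      = mmap F a b (Null A a b)"
    using assms(2) unfolding additive_def by (metis A.Plus_Null(1))
  then show ?thesis using is_functorD(5)[OF assms(1) n] by (rule A'.Plus_self_Null)
qed

lemma additive_Neg:
  assumes "is_functor A A' F" "additive A A' F" "preadditive A" "preadditive A'" "arr A a b f"
  shows "mmap F a b (Neg A a b f) = Neg A' F$a F$b (mmap F a b f)"
proof -
  interpret A: preadditive A by fact
  interpret A': preadditive A' by fact
  have n: "arr A a b (Neg A a b f)" using assms by simp
  have "Plus A' F$a F$b (mmap F a b f) (mmap F a b (Neg A a b f)) = Null A' F$a F$b"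
    using assms(2,5) n additive_Null[OF assms(1-4)] unfolding additive_def
    by (metis A.Plus_Neg(2) arrD(1) arrD(2))
  then show ?thesis using is_functorD(5)[OF assms(1)] n assms(5) by (intro A'.Neg_unique)
qed

lemma additive_direct_sum:
  assumes F: "is_functor A A' F" "additive A A' F" "preadditive A" "preadditive A'"
    and ds: "is_direct_sum A a b s i1 i2 p1 p2"
  shows "is_direct_sum A' F$a F$b F$s
    (mmap F a s i1) (mmap F b s i2) (mmap F s a p1) (mmap F s b p2)"
proof -
  interpret A: preadditive A by fact
  interpret A': preadditive A' by fact
  note d = is_direct_sumD[OF ds]
  note f = is_functorD(5)[OF F(1)] is_functorD(6)[OF F(1)] is_functorD(7)[OF F(1), symmetric]
  show ?thesis
  proof (rule is_direct_sumI)
    have "mmap F s s (Plus A s s (Comp A s a s i1 p1) (Comp A s b s i2 p2)) = Id A' F$s"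
      using d f(2) by simp
    moreover have "mmap F s s (Plus A s s (Comp A s a s i1 p1) (Comp A s b s i2 p2)) =
      Plus A' F$s F$s (mmap F s s (Comp A s a s i1 p1)) (mmap F s s (Comp A s b s i2 p2))"
      using F(2) d unfolding additive_def by (meson A.arr_Comp)
    ultimately show "Plus A' F$s F$s
       (Comp A' F$s F$a F$s (mmap F a s i1) (mmap F s a p1))
       (Comp A' F$s F$b F$s (mmap F b s i2) (mmap F s b p2)) = Id A' F$s"
      using d by (simp add: f)
  qed (use d in \<open>simp_all add: f additive_Null[OF F]\<close>)
qed

text \<open>
  An additive functor that maps the ideal of \<open>B\<close> into the ideal of \<open>B'\<close> acts on residue classes.
  The induced functor is faithful iff the functor reflects the ideal; it inherits fullness
  and density.
\<close>

theorem induced_equivalence: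
  assumes F: "is_functor A A' F" and add: "additive A A' F"
    and B: "factoring_ideal A B" and B': "factoring_ideal A' B'"
    and ideal: "\<And>x y f. \<lbrakk>arr A x y f; f \<in> factoring A B x y\<rbrakk>
      \<Longrightarrow> mmap F x y f \<in> factoring A' B' F$x F$y"
    and reflect: "\<And>x y f. \<lbrakk>arr A x y f; mmap F x y f \<in> factoring A' B' F$x F$y\<rbrakk>
      \<Longrightarrow> f \<in> factoring A B x y"
    and full: "\<And>x y g. \<lbrakk>x \<in> Obj A; y \<in> Obj A; arr A' F$x F$y g\<rbrakk>
      \<Longrightarrow> \<exists>f. arr A x y f \<and> mmap F x y f = g"
    and dense: "\<And>b. b \<in> Obj A' \<Longrightarrow> \<exists>a\<in>Obj A. isomorphic A' F$a b"
  shows "is_equivalence (quotient_category A B) (quotient_category A' B') (induced_functor A B A' B' F)"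
proof -
  interpret A: factoring_ideal A B by fact
  interpret A': factoring_ideal A' B' by fact
  interpret Q: preadditive A.Q by (rule A.preadditive_quotient)
  interpret Q': preadditive A'.Q by (rule A'.preadditive_quotient)
  note [simp] = is_functorD(4-7)[OF F]
  let ?I = "induced_functor A B A' B' F"
  note neg = additive_Neg[OF F add A.preadditive_axioms A'.preadditive_axioms]
  have plus: "mmap F a b (Plus A a b f g) = Plus A' F$a F$b (mmap F a b f) (mmap F a b g)"
    if "arr A a b f" "arr A a b g" for a b f g using add that by (simp add: additive_def)
  have cls: "(\<Union>f\<in>A.cls x y f. A'.cls F$x F$y (mmap F x y f))
      = A'.cls F$x F$y (mmap F x y f)" if f: "arr A x y f" for x y f
  proof -
    have "A'.cls F$x F$y (mmap F x y f') = A'.cls F$x F$y (mmap F x y f)"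
      if "f' \<in> A.cls x y f" for f'
    proof -
      obtain h where h: "h \<in> factoring A B x y" "f' = Plus A x y h f"
        using \<open>f' \<in> A.cls x y f\<close> by (auto simp: A.mem_cls_iff)
      then have "arr A x y h" using A.factoring_arr f by (meson arrD)
      then show ?thesis using h f ideal plus by (subst A'.cls_eq_iff) auto
    qed
    then show ?thesis using A.cls_self[OF f] by blast
  qed
  have I: "?I$x = F$x" if "x \<in> Obj A" for x
    using that by (simp add: induced_functor_def)
  have Im: "mmap ?I x y (A.cls x y f) = A'.cls F$x F$y (mmap F x y f)"
    if "arr A x y f" for x y f
    using that A.arr_cls[OF that] cls[OF that] by (simp add: induced_functor_def)
  have fI: "is_functor A.Q A'.Q ?I"
  proof (rule is_functorI)
    show "?I = mk_functor A.Q (omap ?I) (mmap ?I)" by (simp add: induced_functor_def)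
    show "?I$a \<in> Obj A'.Q" if "a \<in> Obj A.Q" for a using that by (simp add: I)
    show "arr A'.Q ?I$a ?I$b (mmap ?I a b f)" if f: "arr A.Q a b f" for a b f
      using f arrD(1,2)[OF f] by (elim A.arr_quotientE) (auto simp: I Im)
    show "mmap ?I a a (Id A.Q a) = Id A'.Q ?I$a" if "a \<in> Obj A.Q" for a
      using that by (simp add: I Im)
    show "mmap ?I a c (Comp A.Q a b c g f) =
        Comp A'.Q ?I$a ?I$b ?I$c (mmap ?I b c g) (mmap ?I a b f)"
      if f: "arr A.Q a b f" and g: "arr A.Q b c g" for a b c f g
      using f g by (elim A.arr_quotientE) (auto simp: I Im arrD)
  qed (fact Q.category_axioms Q'.category_axioms)+
  show ?thesis
  proof (rule is_equivalenceI[OF fI])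
    fix x y g assume "x \<in> Obj A.Q" "y \<in> Obj A.Q" and g: "arr A'.Q ?I$x ?I$y g"
    then have o: "x \<in> Obj A" "y \<in> Obj A" by auto
    obtain g' where "arr A' F$x F$y g'" "g = A'.cls F$x F$y g'"
      using g o by (auto simp: I elim: A'.arr_quotientE)
    moreover from this obtain f where "arr A x y f" "mmap F x y f = g'" using full o by blast
    ultimately show "\<exists>f. arr A.Q x y f \<and> mmap ?I x y f = g"
      by (intro exI[of _ "A.cls x y f"]) (simp add: Im)
  next
    fix x y f g assume f: "arr A.Q x y f" and g: "arr A.Q x y g" and eq: "mmap ?I x y f = mmap ?I x y g"
    obtain f' where f': "arr A x y f'" "f = A.cls x y f'" using f by (elim A.arr_quotientE)
    obtain g' where g': "arr A x y g'" "g = A.cls x y g'" using g by (elim A.arr_quotientE)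
    obtain h where h: "h \<in> factoring A' B' F$x F$y"
      "mmap F x y f' = Plus A' F$x F$y h (mmap F x y g')"
      using eq f' g' by (auto simp: Im A'.cls_eq_iff)
    let ?d = "Plus A x y f' (Neg A x y g')"
    have ha: "arr A' F$x F$y h"
      using A'.factoring_arr[OF h(1)] f' arrD[OF f'(1)] by simp
    have "mmap F x y ?d = h" using f' g' h(2) ha by (simp add: plus neg A'.Plus_assoc)
    then have "?d \<in> factoring A B x y" using h f' g' by (intro reflect) simp_all
    moreover have "f' = Plus A x y ?d g'" using f' g' by (simp add: A.Plus_assoc)
    ultimately show "f = g" using f' g' by (simp add: A.cls_eq_iff) blast
  next
    fix b assume b: "b \<in> Obj A'.Q"
    then obtain a where a: "a \<in> Obj A" "isomorphic A' F$a b" using dense by auto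
    then obtain f where f: "is_iso A' F$a b f" by (auto simp: isomorphic_def)
    obtain g where g: "arr A' F$a b f" "arr A' b F$a g"
      "Comp A' F$a b F$a g f = Id A' F$a" "Comp A' b F$a b f g = Id A' b"
      using f a b by (auto elim!: A'.isoE)
    have "is_iso A'.Q F$a b (A'.cls F$a b f)"
      by (rule Q'.isoI[of _ _ _ "A'.cls b F$a g"]) (use g in simp_all)
    then show "\<exists>a\<in>Obj A.Q. isomorphic A'.Q ?I$a b"
      using a by (auto simp: isomorphic_def I intro!: bexI[of _ a])
  qed
qed

section \<open>Diagrams\<close>

lemma diagram_category_simps:
  "Obj (diagram_category D A) = {X. is_functor D A X}"
  "Id (diagram_category D A) X = (\<lambda>d\<in>Obj D. Id A X$d)"
  "Comp (diagram_category D A) X Y Z s t = (\<lambda>d\<in>Obj D. Comp A X$d Y$d Z$d (s d) (t d))"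
  "Plus (diagram_category D A) X Y s t = (\<lambda>d\<in>Obj D. Plus A X$d Y$d (s d) (t d))"
  "Null (diagram_category D A) X Y = (\<lambda>d\<in>Obj D. Null A X$d Y$d)"
  by (simp_all add: diagram_category_def)

lemma arr_diagramI:
  assumes "is_functor D A X" "is_functor D A Y" "t \<in> extensional (Obj D)"
    "\<And>d. d \<in> Obj D \<Longrightarrow> arr A X$d Y$d (t d)"
    "\<And>d d' e. arr D d d' e \<Longrightarrow> Comp A X$d Y$d Y$d' (mmap Y d d' e) (t d)
      = Comp A X$d X$d' Y$d' (t d') (mmap X d d' e)"
  shows "arr (diagram_category D A) X Y t"
  using assms by (auto simp: arr_def diagram_category_def PiE_def)

lemma arr_diagramD:
  assumes "arr (diagram_category D A) X Y t"
  shows "is_functor D A X" "is_functor D A Y" "t \<in> extensional (Obj D)"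
    "d \<in> Obj D \<Longrightarrow> arr A X$d Y$d (t d)"
    "arr D d d' e \<Longrightarrow> Comp A X$d Y$d Y$d' (mmap Y d d' e) (t d)
      = Comp A X$d X$d' Y$d' (t d') (mmap X d d' e)"
  using assms by (auto simp: arr_def diagram_category_def PiE_def Pi_def dest: is_functorD(4))

lemma diagram_eqI:
  assumes "arr (diagram_category D A) X Y s" "arr (diagram_category D A) X Y t"
    "\<And>d. d \<in> Obj D \<Longrightarrow> s d = t d"
  shows "s = t"
  using arr_diagramD(3)[OF assms(1)] arr_diagramD(3)[OF assms(2)] assms(3) by (rule extensionalityI)

theorem preadditive_diagram:
  assumes "category D" "preadditive A"
  shows "preadditive (diagram_category D A)"
proof -
  interpret D: category D by fact
  interpret A: preadditive A by fact
  let ?E = "diagram_category D A"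
  note s = diagram_category_simps
  have Id: "arr ?E X X (Id ?E X)" if "is_functor D A X" for X
    by (rule arr_diagramI) (use that in \<open>auto simp: s is_functorD(4,5) dest: arrD\<close>)
  have Comp: "arr ?E X Z (Comp ?E X Y Z g f)" if f: "arr ?E X Y f" and g: "arr ?E Y Z g" for X Y Z f g
  proof (rule arr_diagramI)
    note f' = arr_diagramD[OF f] and g' = arr_diagramD[OF g]
    show "is_functor D A X" "is_functor D A Z" by (fact f' g')+
    fix d d' e assume e: "arr D d d' e"
    note [simp] = arrD(1,2)[OF e] f'(4) g'(4) is_functorD(5)[OF f'(1) e] is_functorD(5)[OF f'(2) e]
      is_functorD(5)[OF g'(2) e]
    show "Comp A X$d Z$d Z$d' (mmap Z d d' e) (Comp ?E X Y Z g f d) =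
       Comp A X$d X$d' Z$d' (Comp ?E X Y Z g f d') (mmap X d d' e)"
      by (simp add: s A.assoc f'(5)[OF e, symmetric] A.reassoc[OF g'(5)[OF e]])
  qed (use arr_diagramD(4)[OF f] arr_diagramD(4)[OF g] in \<open>auto simp: s\<close>)
  have Plus: "arr ?E X Y (Plus ?E X Y f g)" if f: "arr ?E X Y f" and g: "arr ?E X Y g" for X Y f g
  proof (rule arr_diagramI)
    note f' = arr_diagramD[OF f] and g' = arr_diagramD[OF g]
    show "is_functor D A X" "is_functor D A Y" by (fact f' g')+
    fix d d' e assume e: "arr D d d' e"
    note [simp] = arrD(1,2)[OF e] f'(4) g'(4) is_functorD(5)[OF f'(1) e] is_functorD(5)[OF f'(2) e]
    show "Comp A X$d Y$d Y$d' (mmap Y d d' e) (Plus ?E X Y f g d) =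
       Comp A X$d X$d' Y$d' (Plus ?E X Y f g d') (mmap X d d' e)"
      by (simp add: s f'(5)[OF e] g'(5)[OF e])
  qed (use arr_diagramD(4)[OF f] arr_diagramD(4)[OF g] in \<open>auto simp: s\<close>)
  have Null: "arr ?E X Y (Null ?E X Y)" if f: "is_functor D A X" and g: "is_functor D A Y" for X Y
    by (rule arr_diagramI) (use that in \<open>auto simp: s is_functorD(4,5) dest: arrD\<close>)
  have Neg: "arr ?E X Y (\<lambda>d\<in>Obj D. Neg A X$d Y$d (f d))" if f: "arr ?E X Y f" for X Y f
  proof (rule arr_diagramI)
    note f' = arr_diagramD[OF f]
    show "is_functor D A X" "is_functor D A Y" by (fact f')+
    fix d d' e assume e: "arr D d d' e"
    note [simp] = arrD(1,2)[OF e] f'(4) is_functorD(5)[OF f'(1) e] is_functorD(5)[OF f'(2) e]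
    show "Comp A X$d Y$d Y$d' (mmap Y d d' e)
         ((\<lambda>d\<in>Obj D. Neg A X$d Y$d (f d)) d) =
       Comp A X$d X$d' Y$d'
         ((\<lambda>d\<in>Obj D. Neg A X$d Y$d (f d)) d') (mmap X d d' e)"
      by (simp add: f'(5)[OF e])
  qed (use arr_diagramD(4)[OF f] in auto)
  have o: "is_functor D A X" if "X \<in> Obj ?E" for X using that by (simp add: s)
  have cat: "category ?E"
  proof (rule category.intro)
    fix X Y f assume "X \<in> Obj ?E" "Y \<in> Obj ?E" "f \<in> Hom ?E X Y"
    then have f: "arr ?E X Y f" by (simp add: arr_def)
    note f' = arr_diagramD[OF f]
    show "Comp ?E X X Y f (Id ?E X) = f"
      by (rule diagram_eqI[OF Comp[OF Id f] f]) (use f' in \<open>auto simp: s\<close>)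
    show "Comp ?E X Y Y (Id ?E Y) f = f"
      by (rule diagram_eqI[OF Comp[OF f Id] f]) (use f' in \<open>auto simp: s\<close>)
  next
    fix X Y Z W f g h assume *: "X \<in> Obj ?E" "Y \<in> Obj ?E" "Z \<in> Obj ?E" "W \<in> Obj ?E"
      "f \<in> Hom ?E X Y" "g \<in> Hom ?E Y Z" "h \<in> Hom ?E Z W"
    then have f: "arr ?E X Y f" and g: "arr ?E Y Z g" and h: "arr ?E Z W h" by (simp_all add: arr_def)
    show "Comp ?E X Z W h (Comp ?E X Y Z g f) = Comp ?E X Y W (Comp ?E Y Z W h g) f"
      by (rule diagram_eqI[OF Comp[OF Comp[OF f g] h] Comp[OF f Comp[OF g h]]])
        (use arr_diagramD(4)[OF f] arr_diagramD(4)[OF g] arr_diagramD(4)[OF h] in \<open>auto simp: s A.assoc\<close>)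
  qed (use Id Comp o in \<open>auto simp: arr_def\<close>)
  show ?thesis
  proof (rule preadditive.intro[OF cat], rule preadditive_axioms.intro)
    fix X Y assume XY: "X \<in> Obj ?E" "Y \<in> Obj ?E"
    show "comm_group (hom_group ?E X Y)"
    proof (rule hom_groupI)
      fix f assume "f \<in> Hom ?E X Y"
      then have f: "arr ?E X Y f" using XY by (simp add: arr_def)
      note f' = arr_diagramD[OF f]
      show "Plus ?E X Y (Null ?E X Y) f = f"
        by (rule diagram_eqI[OF Plus[OF Null f] f]) (use XY f' in \<open>auto simp: s\<close>)
      have "Plus ?E X Y (\<lambda>d\<in>Obj D. Neg A X$d Y$d (f d)) f = Null ?E X Y"
        by (rule diagram_eqI[OF Plus[OF Neg[OF f] f] Null]) (use XY f' in \<open>auto simp: s\<close>)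
      then show "\<exists>g\<in>Hom ?E X Y. Plus ?E X Y g f = Null ?E X Y" using Neg[OF f] by (auto simp: arr_def)
      fix g assume "g \<in> Hom ?E X Y"
      then have g: "arr ?E X Y g" using XY by (simp add: arr_def)
      note g' = arr_diagramD[OF g]
      show "Plus ?E X Y f g \<in> Hom ?E X Y" using Plus[OF f g] by (simp add: arr_def)
      show "Plus ?E X Y f g = Plus ?E X Y g f"
        by (rule diagram_eqI[OF Plus[OF f g] Plus[OF g f]]) (use f' g' in \<open>auto simp: s A.Plus_comm\<close>)
      fix h assume "h \<in> Hom ?E X Y"
      then have h: "arr ?E X Y h" using XY by (simp add: arr_def)
      note h' = arr_diagramD[OF h]
      show "Plus ?E X Y (Plus ?E X Y f g) h = Plus ?E X Y f (Plus ?E X Y g h)"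
        by (rule diagram_eqI[OF Plus[OF Plus[OF f g] h] Plus[OF f Plus[OF g h]]])
          (use f' g' h' in \<open>auto simp: s A.Plus_assoc\<close>)
    next
      show "Null ?E X Y \<in> Hom ?E X Y" using Null XY by (simp add: arr_def s)
    qed
    fix Z assume Z: "Z \<in> Obj ?E"
    {
      fix f g h assume "f \<in> Hom ?E X Y" "g \<in> Hom ?E Y Z" "h \<in> Hom ?E Y Z"
      then have f: "arr ?E X Y f" and g: "arr ?E Y Z g" and h: "arr ?E Y Z h"
        using XY Z by (simp_all add: arr_def)
      show "Comp ?E X Y Z (Plus ?E Y Z g h) f = Plus ?E X Z (Comp ?E X Y Z g f) (Comp ?E X Y Z h f)"
        by (rule diagram_eqI[OF Comp[OF f Plus[OF g h]] Plus[OF Comp[OF f g] Comp[OF f h]]])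
          (use arr_diagramD(4)[OF f] arr_diagramD(4)[OF g] arr_diagramD(4)[OF h] in \<open>auto simp: s\<close>)
    next
      fix f g h assume "f \<in> Hom ?E X Y" "g \<in> Hom ?E X Y" "h \<in> Hom ?E Y Z"
      then have f: "arr ?E X Y f" and g: "arr ?E X Y g" and h: "arr ?E Y Z h"
        using XY Z by (simp_all add: arr_def)
      show "Comp ?E X Y Z h (Plus ?E X Y f g) = Plus ?E X Z (Comp ?E X Y Z h f) (Comp ?E X Y Z h g)"
        by (rule diagram_eqI[OF Comp[OF Plus[OF f g] h] Plus[OF Comp[OF f h] Comp[OF g h]]])
          (use arr_diagramD(4)[OF f] arr_diagramD(4)[OF g] arr_diagramD(4)[OF h] in \<open>auto simp: s\<close>)
    }
  qed
qed

lemma diagram_Neg: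
  assumes "category D" "preadditive A" and t: "arr (diagram_category D A) X Y t" and d: "d \<in> Obj D"
  shows "Neg (diagram_category D A) X Y t d = Neg A X$d Y$d (t d)"
proof -
  interpret A: preadditive A by fact
  interpret E: preadditive "diagram_category D A" by (rule preadditive_diagram) fact+
  have n: "arr (diagram_category D A) X Y (Neg (diagram_category D A) X Y t)" using t by simp
  have "Plus (diagram_category D A) X Y t (Neg (diagram_category D A) X Y t) d = Null (diagram_category D A) X Y d"
    using t by simp
  then show ?thesis
    using arr_diagramD(4)[OF t d] arr_diagramD(4)[OF n d] d
    by (intro A.Neg_unique) (simp_all add: diagram_category_simps del: E.arr_Neg)
qed

definition postcomp :: "('d, 'e, 'x) cat_scheme \<Rightarrow> ('o1, 'm1, 'y) acat_scheme \<Rightarrow> ('o1, 'm1, 'o2, 'm2) fun_data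
    \<Rightarrow> (('d, 'e, 'o1, 'm1) fun_data, 'd \<Rightarrow> 'm1, ('d, 'e, 'o2, 'm2) fun_data, 'd \<Rightarrow> 'm2) fun_data" where
  "postcomp D A F = mk_functor (diagram_category D A) (\<lambda>X. comp_functor D F X)
     (\<lambda>X Y t. \<lambda>d\<in>Obj D. mmap F X$d Y$d (t d))"

lemma is_functor_postcomp:
  assumes "category D" "preadditive A" "preadditive A'" "is_functor A A' F"
  shows "is_functor (diagram_category D A) (diagram_category D A') (postcomp D A F)"
    (is "is_functor ?A ?A' _")
  unfolding postcomp_def
proof (rule is_functor_mkI)
  show "category ?A" "category ?A'" using preadditive_diagram assms preadditive_def by blast+
  note F = is_functorD(4-7)[OF assms(4)] is_functorD(7)[OF assms(4), symmetric]
  show "comp_functor D F X \<in> Obj ?A'" if "X \<in> Obj ?A" for X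
    using that is_functor_comp assms(4) by (auto simp: diagram_category_simps)
  show "(\<lambda>d\<in>Obj D. mmap F X$d X$d (Id ?A X d)) = Id ?A' (comp_functor D F X)"
    if "X \<in> Obj ?A" for X using that F is_functorD(4)[of D A X] by (auto simp: diagram_category_simps)
  show "arr ?A' (comp_functor D F X) (comp_functor D F Y) (\<lambda>d\<in>Obj D. mmap F X$d Y$d (t d))"
    if t: "arr ?A X Y t" for X Y t
  proof (rule arr_diagramI)
    note t' = arr_diagramD[OF t]
    show "is_functor D A' (comp_functor D F X)" "is_functor D A' (comp_functor D F Y)"
      using t' is_functor_comp assms(4) by blast+
    fix d d' e assume e: "arr D d d' e"
    note [simp] = arrD(1,2)[OF e] t'(4) is_functorD(5)[OF t'(1) e] is_functorD(5)[OF t'(2) e]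
    show "Comp A' (comp_functor D F X)$d (comp_functor D F Y)$d (comp_functor D F Y)$d'
          (mmap (comp_functor D F Y) d d' e) ((\<lambda>d\<in>Obj D. mmap F X$d Y$d (t d)) d) =
         Comp A' (comp_functor D F X)$d (comp_functor D F X)$d' (comp_functor D F Y)$d'
          ((\<lambda>d\<in>Obj D. mmap F X$d Y$d (t d)) d') (mmap (comp_functor D F X) d d' e)"
      using e by (simp add: F(5) t'(5)[OF e])
  qed (use arr_diagramD(4)[OF t] F in simp_all)
  show "(\<lambda>d\<in>Obj D. mmap F X$d Z$d (Comp ?A X Y Z s t d)) =
      Comp ?A' (comp_functor D F X) (comp_functor D F Y) (comp_functor D F Z)
       (\<lambda>d\<in>Obj D. mmap F Y$d Z$d (s d)) (\<lambda>d\<in>Obj D. mmap F X$d Y$d (t d))"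
    if t: "arr ?A X Y t" "arr ?A Y Z s" for X Y Z s t
    using arr_diagramD(4)[OF t(1)] arr_diagramD(4)[OF t(2)] F
    by (auto simp: diagram_category_simps fun_eq_iff restrict_def)
qed

lemma additive_postcomp:
  assumes "category D" "preadditive A" "additive A A' F"
  shows "additive (diagram_category D A) (diagram_category D A') (postcomp D A F)"
  unfolding additive_def
proof (intro allI impI)
  interpret E: preadditive "diagram_category D A" by (rule preadditive_diagram) fact+
  fix X Y s t assume st: "arr (diagram_category D A) X Y s" "arr (diagram_category D A) X Y t"
  then have "arr (diagram_category D A) X Y (Plus (diagram_category D A) X Y s t)" by simp
  then show "mmap (postcomp D A F) X Y (Plus (diagram_category D A) X Y s t) =
        Plus (diagram_category D A') (postcomp D A F)$X (postcomp D A F)$Y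
          (mmap (postcomp D A F) X Y s) (mmap (postcomp D A F) X Y t)"
    using st arrD(1,2)[OF st(1)] arr_diagramD(4)[OF st(1)] arr_diagramD(4)[OF st(2)] assms(3)
    by (auto simp: postcomp_def diagram_category_simps additive_def fun_eq_iff restrict_def)
qed

text \<open>
  Direct sums of diagrams are formed pointwise; the matrix of \<open>X e \<oplus> Y e\<close> is recorded since
  splitness of the sum is read off from it.
\<close>

lemma diagram_direct_sum:
  assumes D: "category D" and A: "additive_category A" and X: "is_functor D A X" and Y: "is_functor D A Y"
  obtains S i1 i2 p1 p2 where "is_direct_sum (diagram_category D A) X Y S i1 i2 p1 p2"
    and "\<And>d. d \<in> Obj D \<Longrightarrow> is_direct_sum A X$d Y$d S$d (i1 d) (i2 d) (p1 d) (p2 d)"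
    and "\<And>d d' e. arr D d d' e \<Longrightarrow> mmap S d d' e = Plus A S$d S$d'
      (Comp A S$d X$d' S$d' (i1 d') (Comp A S$d X$d X$d' (mmap X d d' e) (p1 d)))
      (Comp A S$d Y$d' S$d' (i2 d') (Comp A S$d Y$d Y$d' (mmap Y d d' e) (p2 d)))"
proof -
  interpret D: category D by fact
  interpret A: additive_category A by fact
  note X' = is_functorD(4-7)[OF X] and Y' = is_functorD(4-7)[OF Y]
  have "\<forall>d. \<exists>q. d \<in> Obj D \<longrightarrow> is_direct_sum A X$d Y$d (fst q) (fst (snd q)) (fst (snd (snd q)))
      (fst (snd (snd (snd q)))) (snd (snd (snd (snd q))))"
    using A.direct_sum X'(1) Y'(1) by (metis fst_conv snd_conv)
  then obtain q where q: "\<And>d. d \<in> Obj D \<Longrightarrow> is_direct_sum A X$d Y$d (fst (q d))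
      (fst (snd (q d))) (fst (snd (snd (q d)))) (fst (snd (snd (snd (q d))))) (snd (snd (snd (snd (q d)))))"
    by metis
  define s where "s d = fst (q d)" for d
  define i1 where "i1 = (\<lambda>d\<in>Obj D. fst (snd (q d)))"
  define i2 where "i2 = (\<lambda>d\<in>Obj D. fst (snd (snd (q d))))"
  define p1 where "p1 = (\<lambda>d\<in>Obj D. fst (snd (snd (snd (q d)))))"
  define p2 where "p2 = (\<lambda>d\<in>Obj D. snd (snd (snd (snd (q d)))))"
  have ds: "is_direct_sum A X$d Y$d (s d) (i1 d) (i2 d) (p1 d) (p2 d)" if "d \<in> Obj D" for d
    using q[OF that] that by (simp add: s_def i1_def i2_def p1_def p2_def)
  note d [simp] = is_direct_sumD[OF ds]
  define m where "m d d' e = Plus A (s d) (s d')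
      (Comp A (s d) X$d' (s d') (i1 d') (Comp A (s d) X$d X$d' (mmap X d d' e) (p1 d)))
      (Comp A (s d) Y$d' (s d') (i2 d') (Comp A (s d) Y$d Y$d' (mmap Y d d' e) (p2 d)))"
    for d d' e
  note r = A.reassoc[OF d(8)] A.reassoc[OF d(9)] A.reassoc[OF d(10)] A.reassoc[OF d(11)] A.assoc
  define S where "S = mk_functor D s m"
  have S: "is_functor D A S" unfolding S_def
  proof (rule is_functor_mkI)
    show "m a a (Id D a) = Id A (s a)" if "a \<in> Obj D" for a
      using that X' Y' by (simp add: m_def)
    show "m a c (Comp D a b c g f) = Comp A (s a) (s b) (s c) (m b c g) (m a b f)"
      if "arr D a b f" "arr D b c g" for a b c f g
      using that arrD(1,2)[OF that(1)] arrD(1,2)[OF that(2)] X' Y'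
      by (simp add: m_def r)
    show "arr A (s a) (s b) (m a b f)" if "arr D a b f" for a b f
      using that arrD(1,2)[OF that] X' Y' by (simp add: m_def)
  qed (simp_all add: D.category_axioms A.category_axioms)
  have Sm: "mmap S a b e = m a b e" if "arr D a b e" for a b e using that by (simp add: S_def)
  have So: "S$a = s a" if "a \<in> Obj D" for a using that by (simp add: S_def)
  let ?E = "diagram_category D A"
  interpret E: preadditive ?E by (rule preadditive_diagram[OF D A.preadditive_axioms])
  have ext: "i1 \<in> extensional (Obj D)" "i2 \<in> extensional (Obj D)"
    "p1 \<in> extensional (Obj D)" "p2 \<in> extensional (Obj D)"
    by (simp_all add: i1_def i2_def p1_def p2_def)
  have nat: "Comp A X$a (s a) (s b) (m a b e) (i1 a) = Comp A X$a X$b (s b) (i1 b) (mmap X a b e)"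
    "Comp A Y$a (s a) (s b) (m a b e) (i2 a) = Comp A Y$a Y$b (s b) (i2 b) (mmap Y a b e)"
    "Comp A (s a) X$a X$b (mmap X a b e) (p1 a) = Comp A (s a) (s b) X$b (p1 b) (m a b e)"
    "Comp A (s a) Y$a Y$b (mmap Y a b e) (p2 a) = Comp A (s a) (s b) Y$b (p2 b) (m a b e)"
    if "arr D a b e" for a b e
    using that arrD(1,2)[OF that] X' Y' by (simp_all add: m_def r)
  have i1: "arr ?E X S i1" and i2: "arr ?E Y S i2" and p1: "arr ?E S X p1" and p2: "arr ?E S Y p2"
    by (rule arr_diagramI; use X Y S ext nat in \<open>auto simp: So Sm arrD\<close>)+
  have "is_direct_sum ?E X Y S i1 i2 p1 p2"
    by (rule is_direct_sumI[OF i1 i2 p1 p2])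
      (auto simp: diagram_category_simps So fun_eq_iff restrict_def)
  then show thesis by (rule that) (use ds Sm So m_def in \<open>auto simp: arrD\<close>)
qed

section \<open>The category of morphisms\<close>

lemma Obj_arrow: "(a, b, f) \<in> Obj (arrow_category C) \<longleftrightarrow> arr C a b f"
  by (simp add: arrow_category_def arr_def)

lemma Obj_arrowE:
  assumes "x \<in> Obj (arrow_category C)"
  obtains a b f where "x = (a, b, f)" "arr C a b f"
  using assms by (auto simp: arrow_category_def arr_def)

lemma arr_arrow_iff: "arr (arrow_category C) (a, b, f) (a', b', f') (u, v) \<longleftrightarrow>
    arr C a b f \<and> arr C a' b' f' \<and> arr C a a' u \<and> arr C b b' v \<and>
    Comp C a a' b' f' u = Comp C a b b' v f"
  by (auto simp: arr_def arrow_category_def)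

lemma arrow_simps [simp]:
  "Id (arrow_category C) (a, b, f) = (Id C a, Id C b)"
  "Comp (arrow_category C) (a, b, f) (a', b', f') (a'', b'', f'') (u', v') (u, v)
    = (Comp C a a' a'' u' u, Comp C b b' b'' v' v)"
  "Plus (arrow_category C) (a, b, f) (a', b', f') (u, v) (u', v') = (Plus C a a' u u', Plus C b b' v v')"
  "Null (arrow_category C) (a, b, f) (a', b', f') = (Null C a a', Null C b b')"
  by (simp_all add: arrow_category_def)

lemma (in preadditive) preadditive_arrow: "preadditive (arrow_category C)"
proof -
  let ?A = "arrow_category C"
  have E: "\<exists>a b f a' b' f' u v. x = (a, b, f) \<and> y = (a', b', f') \<and> w = (u, v) \<and>
      arr C a b f \<and> arr C a' b' f' \<and> arr C a a' u \<and> arr C b b' v \<and>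
      Comp C a a' b' f' u = Comp C a b b' v f \<and> a \<in> Obj C \<and> b \<in> Obj C \<and> a' \<in> Obj C \<and> b' \<in> Obj C"
    if "w \<in> Hom ?A x y" "x \<in> Obj ?A" "y \<in> Obj ?A" for w x y
    using that by (auto simp: arrow_category_def arr_def)
  have I: "w \<in> Hom ?A x y" if "arr ?A x y w" for x y w using that by (simp add: arr_def)
  have Comp: "Comp C a a'' b'' f'' (Comp C a a' a'' u' u) = Comp C a b b'' (Comp C b b' b'' v' v) f"
    if "Comp C a a' b' f' u = Comp C a b b' v f" "Comp C a' a'' b'' f'' u' = Comp C a' b' b'' v' f'"
      "arr C a b f" "arr C a' b' f'" "arr C a'' b'' f''" "arr C a a' u" "arr C b b' v"
      "arr C a' a'' u'" "arr C b' b'' v'" for a b f a' b' f' a'' b'' f'' u v u' v'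
    using that by (simp add: assoc reassoc[OF that(2)])
  show ?thesis
  proof (intro preadditive.intro category.intro preadditive_axioms.intro hom_groupI, goal_cases)
    case (1 a)
    then show ?case by (elim Obj_arrowE) (auto intro!: I simp: arr_arrow_iff arrD)
  next
    case (2 a b c f g)
    obtain p q r p' q' r' u v where 1: "a = (p, q, r)" "b = (p', q', r')" "f = (u, v)"
      "arr C p q r" "arr C p' q' r'" "arr C p p' u" "arr C q q' v" "Comp C p p' q' r' u = Comp C p q q' v r"
      using E[OF 2(4,1,2)] by blast
    obtain p'' q'' r'' u' v' where 2: "c = (p'', q'', r'')" "g = (u', v')"
      "arr C p'' q'' r''" "arr C p' p'' u'" "arr C q' q'' v'" "Comp C p' p'' q'' r'' u' = Comp C p' q' q'' v' r'"
      using E[OF 2(5,2,3)] 1(2) by blast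
    show ?case
      by (rule I) (use 1 2 Comp[OF 1(8) 2(6)] in \<open>simp add: arr_arrow_iff\<close>)
  next
    case (3 a b f)
    then show ?case using E[OF 3(3,1,2)] by auto
  next
    case (4 a b f)
    then show ?case using E[OF 4(3,1,2)] by auto
  next
    case (5 a b c d f g h)
    then show ?case using E[OF 5(5,1,2)] E[OF 5(6,2,3)] E[OF 5(7,3,4)] by (auto simp: assoc)
  next
    case (6 x y f g)
    then show ?case using E[OF 6(3,1,2)] E[OF 6(4,1,2)] by (auto intro!: I simp: arr_arrow_iff)
  next
    case (7 x y f g h)
    then show ?case using E[OF 7(3,1,2)] E[OF 7(4,1,2)] E[OF 7(5,1,2)] by (auto simp: Plus_assoc)
  next
    case (8 x y f g)
    then show ?case using E[OF 8(3,1,2)] E[OF 8(4,1,2)] by (auto simp: Plus_comm)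
  next
    case (9 x y)
    then show ?case by (elim Obj_arrowE) (auto intro!: I simp: arr_arrow_iff arrD)
  next
    case (10 x y f)
    then show ?case using E[OF 10(3,1,2)] by auto
  next
    case (11 x y w)
    obtain a b f a' b' f' u v where *: "x = (a, b, f)" "y = (a', b', f')" "w = (u, v)"
      "arr C a b f" "arr C a' b' f'" "arr C a a' u" "arr C b b' v"
      "Comp C a a' b' f' u = Comp C a b b' v f" using E[OF 11(3,1,2)] by blast
    show ?case
      by (rule bexI[of _ "(Neg C a a' u, Neg C b b' v)"]) (use * in \<open>auto intro!: I simp: arr_arrow_iff\<close>)
  next
    case (12 a b c f g h)
    then show ?case using E[OF 12(4,1,2)] E[OF 12(5,2,3)] E[OF 12(6,2,3)] by auto
  next
    case (13 a b c f g h)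
    then show ?case using E[OF 13(4,1,2)] E[OF 13(5,1,2)] E[OF 13(6,2,3)] by auto
  qed
qed

section \<open>The Freyd category\<close>

lemma (in additive_category) zero_arrows_ideal: "factoring_ideal (arrow_category C) (zero_arrows C)"
proof -
  interpret A: preadditive "arrow_category C" by (rule preadditive_arrow)
  show ?thesis
  proof
    show "zero_arrows C \<subseteq> Obj (arrow_category C)" by (auto simp: zero_arrows_def)
    obtain z where "z \<in> Obj C" using zero_object by (auto simp: is_zero_object_def)
    then have "(z, z, Null C z z) \<in> zero_arrows C" by (simp add: zero_arrows_def Obj_arrow)
    then show "zero_arrows C \<noteq> {}" by blast
  next
    fix x x' assume "x \<in> zero_arrows C" "x' \<in> zero_arrows C"
    then obtain a b a' b' where x: "x = (a, b, Null C a b)" "x' = (a', b', Null C a' b')"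
      and o: "a \<in> Obj C" "b \<in> Obj C" "a' \<in> Obj C" "b' \<in> Obj C"
      by (auto simp: zero_arrows_def Obj_arrow arr_def)
    obtain s i1 i2 p1 p2 where s: "is_direct_sum C a a' s i1 i2 p1 p2" using direct_sum o by blast
    obtain t j1 j2 q1 q2 where t: "is_direct_sum C b b' t j1 j2 q1 q2" using direct_sum o by blast
    note [simp] = is_direct_sumD[OF s] is_direct_sumD[OF t] o
    have "is_direct_sum (arrow_category C) x x' (s, t, Null C s t) (i1, j1) (i2, j2) (p1, q1) (p2, q2)"
      by (rule is_direct_sumI) (auto simp: x arr_arrow_iff)
    moreover have "(s, t, Null C s t) \<in> zero_arrows C" by (simp add: zero_arrows_def Obj_arrow)
    ultimately show "\<exists>s\<in>zero_arrows C. \<exists>i1 i2 p1 p2. is_direct_sum (arrow_category C) x x' s i1 i2 p1 p2"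
      by blast
  qed
qed

sublocale additive_category \<subseteq> F: factoring_ideal "arrow_category C" "zero_arrows C"
  rewrites "quotient_category (arrow_category C) (zero_arrows C) = freyd C"
  by (rule zero_arrows_ideal) (simp add: freyd_def)

context additive_category
begin

sublocale E: preadditive "freyd C"
  by (rule F.preadditive_quotient)

abbreviation E where "E \<equiv> freyd C"

abbreviation fr where "fr \<equiv> mor_class (arrow_category C) (zero_arrows C)"

text \<open>
  The residue class \<open>fr x y (u, v)\<close> of a square is determined by the diagonal \<open>f' \<circ> u = v \<circ> f\<close>: if
  the diagonal is zero, then the square factors over the zero morphism \<open>a \<rightarrow> b'\<close>.
\<close>

lemma factoring_zero_arrows_iff:
  assumes "arr (arrow_category C) (a, b, f) (a', b', f') (u, v)"
  shows "(u, v) \<in> factoring (arrow_category C) (zero_arrows C) (a, b, f) (a', b', f')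
    \<longleftrightarrow> Comp C a a' b' f' u = Null C a b'"
proof
  note * = assms[unfolded arr_arrow_iff]
  assume "(u, v) \<in> factoring (arrow_category C) (zero_arrows C) (a, b, f) (a', b', f')"
  then obtain z g h where z: "z \<in> zero_arrows C" and g: "arr (arrow_category C) (a, b, f) z g"
    and h: "arr (arrow_category C) z (a', b', f') h"
    and uv: "(u, v) = Comp (arrow_category C) (a, b, f) z (a', b', f') h g"
    using * by (elim factoringE[OF _ F.B_Obj]) (auto simp: Obj_arrow)
  obtain p q where pq: "z = (p, q, Null C p q)" "p \<in> Obj C" "q \<in> Obj C"
    using z by (auto simp: zero_arrows_def Obj_arrow arr_def)
  obtain g1 g2 h1 h2 where gh: "g = (g1, g2)" "h = (h1, h2)" by fastforce
  have 1: "arr C a p g1" "arr C p a' h1" "u = Comp C a p a' h1 g1" "arr C a' b' f'"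
    using g h uv * by (simp_all add: pq gh arr_arrow_iff)
  then have "Comp C a a' b' f' u = Comp C a p b' (Comp C p a' b' f' h1) g1"
    by (simp add: assoc)
  also have "Comp C p a' b' f' h1 = Comp C p q b' h2 (Null C p q)"
    using h by (simp add: pq gh arr_arrow_iff)
  finally have "Comp C a a' b' f' u = Comp C a p b' (Comp C p q b' h2 (Null C p q)) g1" .
  then show "Comp C a a' b' f' u = Null C a b'" using 1 h pq arrD(2)[OF 1(4)] by (simp add: gh arr_arrow_iff)
next
  note * = assms[unfolded arr_arrow_iff]
  assume d: "Comp C a a' b' f' u = Null C a b'"
  have o: "a \<in> Obj C" "b' \<in> Obj C" using * by (auto dest: arrD)
  have "(a, b', Null C a b') \<in> zero_arrows C" using o by (simp add: zero_arrows_def Obj_arrow)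
  moreover have "arr (arrow_category C) (a, b, f) (a, b', Null C a b') (Id C a, v)"
    "arr (arrow_category C) (a, b', Null C a b') (a', b', f') (u, Id C b')"
    using * d o by (auto simp: arr_arrow_iff)
  ultimately show "(u, v) \<in> factoring (arrow_category C) (zero_arrows C) (a, b, f) (a', b', f')"
    using factoringI[of "(a, b', Null C a b')" "zero_arrows C" "arrow_category C" "(a, b, f)" "(Id C a, v)"
      "(a', b', f')" "(u, Id C b')"] * by simp
qed

lemma fr_Null_iff:
  assumes "arr (arrow_category C) (a, b, f) (a', b', f') (u, v)"
  shows "fr (a, b, f) (a', b', f') (u, v) = Null E (a, b, f) (a', b', f')
    \<longleftrightarrow> Comp C a a' b' f' u = Null C a b'"
  using F.factoring_Null_quotient[OF assms] factoring_zero_arrows_iff[OF assms] by simp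

lemma fr_eq_iff:
  assumes "arr (arrow_category C) (a, b, f) (a', b', f') (u, v)"
    "arr (arrow_category C) (a, b, f) (a', b', f') (u', v')"
  shows "fr (a, b, f) (a', b', f') (u, v) = fr (a, b, f) (a', b', f') (u', v')
    \<longleftrightarrow> Comp C a a' b' f' u = Comp C a a' b' f' u'"
proof -
  note * = assms[unfolded arr_arrow_iff]
  let ?x = "(a, b, f)" and ?y = "(a', b', f')"
  have o: "a \<in> Obj C" "b' \<in> Obj C" "a' \<in> Obj C" "b \<in> Obj C" using * by (auto dest: arrD)
  let ?d = "(Plus C a a' u (Neg C a a' u'), Plus C b b' v (Neg C b b' v'))"
  have d: "arr (arrow_category C) ?x ?y ?d" using * by (simp add: arr_arrow_iff)
  have "fr ?x ?y (u, v) = fr ?x ?y (u', v') \<longleftrightarrow> ?d \<in> factoring (arrow_category C) (zero_arrows C) ?x ?y"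
  proof -
    have "h = ?d \<longleftrightarrow> (u, v) = Plus (arrow_category C) ?x ?y h (u', v')"
      if "h \<in> factoring (arrow_category C) (zero_arrows C) ?x ?y" for h
    proof -
      have "arr (arrow_category C) ?x ?y h" using F.factoring_arr[OF that] * by (simp add: Obj_arrow)
      then obtain h1 h2 where "h = (h1, h2)" "arr C a a' h1" "arr C b b' h2"
        by (cases h) (auto simp: arr_arrow_iff)
      then show ?thesis using * by (auto simp: Plus_assoc)
    qed
    then show ?thesis unfolding F.cls_eq_iff[OF assms] by blast
  qed
  also have "\<dots> \<longleftrightarrow> Plus C a b' (Comp C a a' b' f' u) (Neg C a b' (Comp C a a' b' f' u')) = Null C a b'"
    using factoring_zero_arrows_iff[OF d] * by simp
  also have "\<dots> \<longleftrightarrow> Comp C a a' b' f' u = Comp C a a' b' f' u'"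
    using * by (intro Neg_eq_iff) auto
  finally show ?thesis .
qed

lemma arr_freydE:
  assumes "arr E (a, b, f) (a', b', f') w"
  obtains u v where "w = fr (a, b, f) (a', b', f') (u, v)" "arr (arrow_category C) (a, b, f) (a', b', f') (u, v)"
    "arr C a b f" "arr C a' b' f'" "arr C a a' u" "arr C b b' v" "Comp C a a' b' f' u = Comp C a b b' v f"
  using assms by (elim F.arr_quotientE) (auto simp: arr_arrow_iff)

lemma Obj_freyd: "(a, b, f) \<in> Obj E \<longleftrightarrow> arr C a b f"
  by (simp add: Obj_arrow)

abbreviation J where "J \<equiv> freyd_embedding C"

abbreviation J_at (\<open>_$$_\<close> [1000, 1000] 1000) where "X$$i \<equiv> J$(X$i)"

abbreviation Jmor where "Jmor X i j \<equiv> mmap J X$i X$j (mmap X i j ())"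

abbreviation emb where "emb m \<equiv> embedded_diagram (chain m) C"

abbreviation Diag where "Diag m \<equiv> diagram_category (chain m) C"

abbreviation EDiag where "EDiag m \<equiv> diagram_category (chain m) E"

lemma omap_J: "x \<in> Obj C \<Longrightarrow> J$x = (x, x, Id C x)"
  by (simp add: freyd_embedding_def quotient_functor_def Obj_arrow)

lemma mmap_J: "arr C x y f \<Longrightarrow> mmap J x y f = fr (x, x, Id C x) (y, y, Id C y) (f, f)"
  using arrD(1,2)[of C x y f]
  by (simp add: freyd_embedding_def quotient_functor_def Obj_arrow arr_arrow_iff)

lemma is_functor_J: "is_functor C E J"
proof -
  have 1: "is_functor C (arrow_category C) (mk_functor C (\<lambda>x. (x, x, Id C x)) (\<lambda>x y f. (f, f)))"
    by (rule is_functor_mkI)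
      (auto simp: category_axioms F.category_axioms Obj_arrow arr_arrow_iff arrD)
  have 2: "is_functor (arrow_category C) E (quotient_functor (arrow_category C) (zero_arrows C))"
    unfolding quotient_functor_def
    by (rule is_functor_mkI) (simp_all add: F.category_axioms E.category_axioms)
  show ?thesis unfolding freyd_embedding_def by (rule is_functor_comp[OF 1 2])
qed

lemmas J = is_functorD(4-7)[OF is_functor_J]

lemma additive_J: "additive C E J"
proof -
  have "mmap J a b (Plus C a b f g) = Plus E J$a J$b (mmap J a b f) (mmap J a b g)"
    if "arr C a b f" "arr C a b g" for a b f g
    using that arrD(1,2)[OF that(1)] by (simp add: mmap_J omap_J arr_arrow_iff)
  then show ?thesis by (simp add: additive_def)
qed

lemma J_Plus: "\<lbrakk>arr C a b f; arr C a b g\<rbrakk> \<Longrightarrow>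
    mmap J a b (Plus C a b f g) = Plus E J$a J$b (mmap J a b f) (mmap J a b g)"
  using additive_J by (simp add: additive_def)

lemma J_Null: "\<lbrakk>a \<in> Obj C; b \<in> Obj C\<rbrakk> \<Longrightarrow> mmap J a b (Null C a b) = Null E J$a J$b"
  by (rule additive_Null[OF is_functor_J additive_J preadditive_axioms E.preadditive_axioms])

text \<open>The embedding is fully faithful, as the square \<open>(f, f)\<close> has the diagonal \<open>f\<close>.\<close>

lemma J_full:
  assumes "arr E J$x J$y g" "x \<in> Obj C" "y \<in> Obj C"
  obtains f where "arr C x y f" "g = mmap J x y f"
  using assms(1) unfolding omap_J[OF assms(2)] omap_J[OF assms(3)]
  by (elim arr_freydE) (use that in \<open>auto simp: mmap_J\<close>)

lemma J_eq_iff: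
  assumes "arr C x y f" "arr C x y g"
  shows "mmap J x y f = mmap J x y g \<longleftrightarrow> f = g"
  using assms arrD(1,2)[OF assms(1)] by (simp add: mmap_J fr_eq_iff arr_arrow_iff)

lemma J_eq_Null_iff:
  assumes "arr C x y f"
  shows "mmap J x y f = Null E J$x J$y \<longleftrightarrow> f = Null C x y"
  using assms J_eq_iff[of x y f "Null C x y"] arrD(1,2)[OF assms] by (simp add: J_Null)

text \<open>
  The squares \<open>(1, f)\<close> and \<open>(f, 1)\<close> make \<open>(a, b, f)\<close> a quotient of \<open>a\<close> and a subobject of \<open>b\<close>:
  composition with them leaves diagonals unchanged, so they are epimorphic and monomorphic. A
  morphism to \<open>b\<close> that is killed by \<open>c\<close> has a diagonal killed by \<open>c\<close>; if \<open>f\<close> is a weak kernel of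
  \<open>c\<close>, this diagonal factors over \<open>f\<close> and yields a morphism to \<open>(a, b, f)\<close>.
\<close>

lemma freyd_image:
  assumes "arr C a b f"
  obtains p i where "arr E J$a (a, b, f) p" "arr E (a, b, f) J$b i"
    "Comp E J$a (a, b, f) J$b i p = mmap J a b f"
    "\<And>e g h. \<lbrakk>arr E (a, b, f) e g; arr E (a, b, f) e h;
      Comp E J$a (a, b, f) e g p = Comp E J$a (a, b, f) e h p\<rbrakk> \<Longrightarrow> g = h"
    "\<And>e g h. \<lbrakk>arr E e (a, b, f) g; arr E e (a, b, f) h;
      Comp E e (a, b, f) J$b i g = Comp E e (a, b, f) J$b i h\<rbrakk> \<Longrightarrow> g = h"
    "\<And>c d. \<lbrakk>arr C b d c; is_weak_kernel C b d c a f\<rbrakk> \<Longrightarrow>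
      is_kernel E J$b J$d (mmap J b d c) (a, b, f) i"
proof -
  note [simp] = assms arrD(1,2)[OF assms]
  let ?p = "fr J$a (a, b, f) (Id C a, f)"
  let ?i = "fr (a, b, f) J$b (f, Id C b)"
  have p: "arr (arrow_category C) J$a (a, b, f) (Id C a, f)"
    and i: "arr (arrow_category C) (a, b, f) J$b (f, Id C b)"
    by (simp_all add: omap_J arr_arrow_iff)
  have mono: "g = h" if g: "arr E e (a, b, f) g" and h: "arr E e (a, b, f) h"
    and eq: "Comp E e (a, b, f) J$b ?i g = Comp E e (a, b, f) J$b ?i h"
    for e g h
  proof -
    obtain a' b' f' where e: "e = (a', b', f')" by (cases e)
    show ?thesis using g h eq i unfolding e
      by (elim arr_freydE) (simp add: omap_J fr_eq_iff arr_arrow_iff)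
  qed
  show thesis
  proof (rule that[of ?p ?i])
    show "arr E J$a (a, b, f) ?p" "arr E (a, b, f) J$b ?i"
      using p i by simp_all
    show "Comp E J$a (a, b, f) J$b ?i ?p = mmap J a b f"
      using p i by (simp add: omap_J mmap_J)
    show "g = h" if g: "arr E (a, b, f) e g" and h: "arr E (a, b, f) e h"
      and eq: "Comp E J$a (a, b, f) e g ?p = Comp E J$a (a, b, f) e h ?p"
      for e g h
    proof -
      obtain a' b' f' where e: "e = (a', b', f')" by (cases e)
      show ?thesis using g h eq p unfolding e
        by (elim arr_freydE) (simp add: omap_J fr_eq_iff arr_arrow_iff)
    qed
    show "is_kernel E J$b J$d (mmap J b d c) (a, b, f) ?i"
      if c: "arr C b d c" and k: "is_weak_kernel C b d c a f" for c d
      unfolding is_kernel_def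
    proof (intro conjI ballI impI)
      note [simp] = c arrD(1,2)[OF c]
      have cf: "Comp C a b d c f = Null C a d"
        using k unfolding is_weak_kernel_def by (force simp: arr_def dest: bspec[of _ _ a] intro: Id_in_Hom)
      show e: "(a, b, f) \<in> Obj E" by (simp add: Obj_arrow)
      show "?i \<in> Hom E (a, b, f) J$b" using i by (simp add: arrD)
      show "Comp E (a, b, f) J$b J$d (mmap J b d c) ?i = Null E (a, b, f) J$d"
        using i cf by (simp add: omap_J mmap_J F.Null_quotient Obj_arrow arr_arrow_iff fr_eq_iff)
      fix s v assume s: "s \<in> Obj E" "v \<in> Hom E s J$b"
        and 0: "Comp E s J$b J$d (mmap J b d c) v = Null E s J$d"
      obtain a' b' f' where s': "s = (a', b', f')" by (cases s)
      have v: "arr E (a', b', f') (b, b, Id C b) v" using s s' by (simp add: arr_def omap_J Obj_arrow Id_in_Hom)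
      obtain u w where v': "v = fr (a', b', f') (b, b, Id C b) (u, w)"
        "arr (arrow_category C) (a', b', f') (b, b, Id C b) (u, w)" "arr C a' b' f'" "arr C a' b u" "arr C b' b w"
        "Comp C a' b b (Id C b) u = Comp C a' b' b w f'" using v by (elim arr_freydE)
      note [simp] = v'(3-5) arrD(1,2)[OF v'(3)]
      have cu: "arr (arrow_category C) (a', b', f') (d, d, Id C d) (Comp C a' b d c u, Comp C b' b d c w)"
        and cc: "arr (arrow_category C) (b, b, Id C b) (d, d, Id C d) (c, c)"
        using v'(6) by (simp_all add: arr_arrow_iff assoc)
      have "Comp C a' b d c u = Null C a' d"
        using 0 fr_Null_iff[OF cu] F.Comp_quotient[OF v'(2) cc] by (simp add: s' v'(1) omap_J mmap_J)
      then have "u \<in> (\<lambda>u. Comp C a' a b f u) ` Hom C a' a"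
        using k unfolding is_weak_kernel_def by (auto simp: arrD)
      then obtain u' where u': "arr C a' a u'" "u = Comp C a' a b f u'" by (auto simp: arr_def)
      have g: "arr (arrow_category C) (a', b', f') (a, b, f) (u', w)"
        using u' v'(6) by (simp add: arr_arrow_iff)
      show "\<exists>!g. g \<in> Hom E s (a, b, f) \<and> Comp E s (a, b, f) J$b ?i g = v"
      proof (rule ex1I[of _ "fr (a', b', f') (a, b, f) (u', w)"], intro conjI)
        show 1: "fr (a', b', f') (a, b, f) (u', w) \<in> Hom E s (a, b, f)"
          using g by (simp add: s' arrD)
        show 2: "Comp E s (a, b, f) J$b ?i (fr (a', b', f') (a, b, f) (u', w)) = v"
          using g i u'(1) by (simp add: s' v'(1) u'(2)[symmetric] omap_J)
        fix g' assume "g' \<in> Hom E s (a, b, f) \<and> Comp E s (a, b, f) J$b ?i g' = v"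
        then have g': "g' \<in> Hom E s (a, b, f)" "Comp E s (a, b, f) J$b ?i g' = v"
          by blast+
        show "g' = fr (a', b', f') (a, b, f) (u', w)"
          by (rule mono[OF arrI[OF g'(1) s(1) e] arrI[OF 1 s(1) e] trans[OF g'(2) 2[symmetric]]])
      qed
    qed
  qed (use mono in blast)
qed

end

section \<open>Kernels and injectivity in the Freyd category\<close>

context preadditive
begin

lemma kernelI:
  assumes "arr C x y f" "arr C k x i" "Comp C k x y f i = Null C k y"
    "\<And>s v. \<lbrakk>arr C s x v; Comp C s x y f v = Null C s y\<rbrakk> \<Longrightarrow> \<exists>u. arr C s k u \<and> Comp C s k x i u = v"
    "\<And>s u v. \<lbrakk>arr C s k u; arr C s k v; Comp C s k x i u = Comp C s k x i v\<rbrakk> \<Longrightarrow> u = v"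
  shows "is_kernel C x y f k i"
  unfolding is_kernel_def
proof (intro conjI ballI impI)
  fix s v assume s: "s \<in> Obj C" "v \<in> Hom C s x" and 0: "Comp C s x y f v = Null C s y"
  have v: "arr C s x v" using s assms(1) by (simp add: arr_def)
  obtain u where u: "arr C s k u" "Comp C s k x i u = v" using assms(4)[OF v 0] by blast
  show "\<exists>!u. u \<in> Hom C s k \<and> Comp C s k x i u = v"
  proof (rule ex1I[of _ u])
    fix u' assume u': "u' \<in> Hom C s k \<and> Comp C s k x i u' = v"
    then have "arr C s k u'" using u(1) by (simp add: arr_def)
    then show "u' = u" using assms(5) u u' by blast
  qed (use u arrD(3)[OF u(1)] in simp)
qed (use assms(2,3) in \<open>simp_all add: arr_def\<close>)

lemma kernelD:
  assumes k: "is_kernel C x y f k i" and f: "arr C x y f"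
  shows "k \<in> Obj C" "arr C k x i" "Comp C k x y f i = Null C k y"
    "\<lbrakk>arr C s x v; Comp C s x y f v = Null C s y\<rbrakk> \<Longrightarrow> \<exists>u. arr C s k u \<and> Comp C s k x i u = v"
    "\<lbrakk>arr C s k u; arr C s k u'; Comp C s k x i u = Comp C s k x i u'\<rbrakk> \<Longrightarrow> u = u'"
proof -
  show 1: "k \<in> Obj C" "arr C k x i" and 0: "Comp C k x y f i = Null C k y"
    using k f unfolding is_kernel_def arr_def by blast+
  show "\<exists>u. arr C s k u \<and> Comp C s k x i u = v" if "arr C s x v" "Comp C s x y f v = Null C s y"
    using k that 1 unfolding is_kernel_def arr_def by blast
  show "u = u'" if u: "arr C s k u" "arr C s k u'" and eq: "Comp C s k x i u = Comp C s k x i u'"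
  proof -
    have "s \<in> Obj C" and v: "Comp C s k x i u \<in> Hom C s x" using u 1 by (auto intro: arrD arr_Comp)
    moreover have "Comp C s x y f (Comp C s k x i u) = Null C s y"
      using u f 1 arrD(2)[OF f] by (simp add: reassoc[OF 0])
    ultimately have "\<exists>!w. w \<in> Hom C s k \<and> Comp C s k x i w = Comp C s k x i u"
      using k unfolding is_kernel_def by blast
    then show ?thesis using u eq unfolding arr_def by metis
  qed
qed

lemma weak_kernelD:
  assumes k: "is_weak_kernel C x y f k i" and f: "arr C x y f"
  shows "arr C k x i" "Comp C k x y f i = Null C k y"
    "\<lbrakk>arr C s x v; Comp C s x y f v = Null C s y\<rbrakk> \<Longrightarrow> \<exists>u. arr C s k u \<and> Comp C s k x i u = v"
proof -
  show 1: "arr C k x i" using k f unfolding is_weak_kernel_def arr_def by blast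
  have "Comp C k k x i (Id C k) \<in> {v \<in> Hom C k x. Comp C k x y f v = Null C k y}"
    using k 1 arrD(1)[OF 1] Id_in_Hom unfolding is_weak_kernel_def by blast
  then show "Comp C k x y f i = Null C k y" using 1 by simp
  show "\<exists>u. arr C s k u \<and> Comp C s k x i u = v" if "arr C s x v" "Comp C s x y f v = Null C s y"
  proof -
    have "v \<in> (\<lambda>u. Comp C s k x i u) ` Hom C s k"
      using k that unfolding is_weak_kernel_def arr_def by blast
    then show ?thesis using that(1) 1 by (auto simp: arr_def)
  qed
qed

end

context weakly_abelian_category
begin

(* Objects and identities of E are no longer reduced to those of the category of morphisms. *)
declare F.Obj_quotient [simp del] F.Id_quotient [simp del]

text \<open>
  The kernel of \<open>(u, v) : (a, b, f) \<rightarrow> (a', b', f')\<close> is the image of \<open>f \<circ> k\<close>, where \<open>k\<close> is a weak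
  kernel of the diagonal.
\<close>

lemma freyd_has_kernel:
  assumes "arr E x y w"
  shows "\<exists>k i. is_kernel E x y w k i"
proof -
  obtain a b f a' b' f' where xy: "x = (a, b, f)" "y = (a', b', f')" by (cases x, cases y)
  obtain u v where w: "w = fr x y (u, v)" and uv: "arr (arrow_category C) x y (u, v)"
    "arr C a b f" "arr C a' b' f'" "arr C a a' u" "arr C b b' v" "Comp C a a' b' f' u = Comp C a b b' v f"
    using assms unfolding xy by (elim arr_freydE)
  let ?d = "Comp C a a' b' f' u"
  have d: "arr C a b' ?d" using uv by simp
  obtain k0 k where "is_weak_kernel C a b' ?d k0 k" using has_weak_kernel d arrD by metis
  note k = weak_kernelD[OF this d]
  note [simp] = uv(2-5) arrD(1,2)[OF uv(2)] arrD(1,2)[OF uv(3)] k(1) arrD(1)[OF k(1)]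
  let ?k = "(k0, b, Comp C k0 a b f k)"
  have i: "arr (arrow_category C) ?k x (k, Id C b)" by (simp add: xy arr_arrow_iff)
  have "is_kernel E x y w ?k (fr ?k x (k, Id C b))"
  proof (rule E.kernelI[OF assms])
    show "arr E ?k x (fr ?k x (k, Id C b))" using i by simp
    have c: "Comp E ?k x y w (fr ?k x (k, Id C b)) = fr ?k y (Comp C k0 a a' u k, Comp C b b b' v (Id C b))"
      using i uv by (simp add: w xy)
    have "arr (arrow_category C) ?k y (Comp C k0 a a' u k, Comp C b b b' v (Id C b))"
      using uv(6) k(2) by (simp add: xy arr_arrow_iff reassoc[OF uv(6)] assoc)
    then show "Comp E ?k x y w (fr ?k x (k, Id C b)) = Null E ?k y"
      unfolding c unfolding xy using k(2) by (subst fr_Null_iff) (simp_all add: assoc)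
  next
    fix s z assume z: "arr E s x z" and 0: "Comp E s x y w z = Null E s y"
    obtain p q r where s: "s = (p, q, r)" by (cases s)
    obtain \<alpha> \<beta> where z': "z = fr s x (\<alpha>, \<beta>)" and ab: "arr (arrow_category C) s x (\<alpha>, \<beta>)"
      "arr C p q r" "arr C p a \<alpha>" "arr C q b \<beta>" "Comp C p a b f \<alpha> = Comp C p q b \<beta> r"
      using z unfolding s xy(1) by (elim arr_freydE)
    have "arr (arrow_category C) s y (Comp (arrow_category C) s x y (u, v) (\<alpha>, \<beta>))"
      using ab(1) uv(1) by simp
    moreover have "Comp E s x y w z = fr s y (Comp (arrow_category C) s x y (u, v) (\<alpha>, \<beta>))"
      using ab(1) uv(1) by (simp add: w z')
    moreover from this have "fr s y (Comp (arrow_category C) s x y (u, v) (\<alpha>, \<beta>)) = Null E s y"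
      using 0 by simp
    ultimately have "Comp C p a' b' f' (Comp C p a a' u \<alpha>) = Null C p b'"
      unfolding s xy by (simp add: fr_Null_iff)
    then have "Comp C p a b' ?d \<alpha> = Null C p b'" using ab by (simp add: assoc)
    then obtain \<gamma> where g: "arr C p k0 \<gamma>" "Comp C p k0 a k \<gamma> = \<alpha>" using k(3) ab(3) by blast
    have sg: "arr (arrow_category C) s ?k (\<gamma>, \<beta>)"
      using ab(2-5) g by (simp add: s arr_arrow_iff assoc)
    have "Comp E s ?k x (fr ?k x (k, Id C b)) (fr s ?k (\<gamma>, \<beta>)) = z"
      using ab(4) by (simp add: F.Comp_quotient[OF sg i]) (simp add: z' s xy g)
    then show "\<exists>u. arr E s ?k u \<and> Comp E s ?k x (fr ?k x (k, Id C b)) u = z"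
      using sg by (intro exI[of _ "fr s ?k (\<gamma>, \<beta>)"]) simp
  next
    fix s z z' assume z: "arr E s ?k z" "arr E s ?k z'"
      and eq: "Comp E s ?k x (fr ?k x (k, Id C b)) z = Comp E s ?k x (fr ?k x (k, Id C b)) z'"
    obtain p q r where s: "s = (p, q, r)" by (cases s)
    obtain \<alpha> \<beta> where z1: "z = fr s ?k (\<alpha>, \<beta>)" and ab: "arr (arrow_category C) s ?k (\<alpha>, \<beta>)"
      "arr C p q r" "arr C p k0 \<alpha>" "arr C q b \<beta>"
      using z(1) unfolding s by (elim arr_freydE)
    obtain \<alpha>' \<beta>' where z2: "z' = fr s ?k (\<alpha>', \<beta>')" and ab': "arr (arrow_category C) s ?k (\<alpha>', \<beta>')"
      "arr C p k0 \<alpha>'" "arr C q b \<beta>'"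
      using z(2) unfolding s by (elim arr_freydE)
    have c: "arr (arrow_category C) s x (Comp (arrow_category C) s ?k x (k, Id C b) (\<alpha>, \<beta>))"
      "arr (arrow_category C) s x (Comp (arrow_category C) s ?k x (k, Id C b) (\<alpha>', \<beta>'))"
      using ab(1) ab'(1) i by simp_all
    have "fr s x (Comp (arrow_category C) s ?k x (k, Id C b) (\<alpha>, \<beta>)) = fr s x (Comp (arrow_category C) s ?k x (k, Id C b) (\<alpha>', \<beta>'))"
      using eq unfolding z1 z2 F.Comp_quotient[OF ab(1) i] F.Comp_quotient[OF ab'(1) i] .
    then have "Comp C p a b f (Comp C p k0 a k \<alpha>) = Comp C p a b f (Comp C p k0 a k \<alpha>')"
      using c by (simp add: s xy fr_eq_iff)
    then show "z = z'"
      unfolding z1 z2 using ab ab' unfolding s by (subst fr_eq_iff) (simp_all add: assoc)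
  qed
  then show ?thesis by blast
qed

lemma ex_kernel_choice: "\<exists>ker. kernel_choice E ker"
proof -
  have "\<forall>x y w. \<exists>p. arr E x y w \<longrightarrow> is_kernel E x y w (fst p) (snd p)"
    using freyd_has_kernel by (metis fst_conv snd_conv)
  then obtain ker where "\<And>x y w. arr E x y w \<Longrightarrow> is_kernel E x y w (fst (ker x y w)) (snd (ker x y w))"
    by metis
  then show ?thesis by (auto simp: kernel_choice_def arr_def simp del: F.Obj_quotient intro!: exI[of _ ker])
qed

text \<open>
  Since \<open>p\<close> is a weak cokernel, a morphism that kills all that \<open>p\<close> kills extends along \<open>p\<close>.
\<close>

lemma factor_through:
  assumes p: "arr C x y p" and h: "arr C x z h"
    and 0: "\<And>s \<alpha>. \<lbrakk>arr C s x \<alpha>; Comp C s x y p \<alpha> = Null C s y\<rbrakk> \<Longrightarrow> Comp C s x z h \<alpha> = Null C s z"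
  obtains t where "arr C y z t" "Comp C x y z t p = h"
proof -
  obtain w g where w: "w \<in> Obj C" "g \<in> Hom C w x" and wc: "is_weak_cokernel C w x g y p"
    using weak_cokernel p arrD by metis
  have g: "arr C w x g" using w p by (simp add: arr_def)
  have "Comp C x y y (Id C y) p \<in> {v \<in> Hom C x y. Comp C w x y v g = Null C w y}"
    using wc p Id_in_Hom unfolding is_weak_cokernel_def arr_def by blast
  then have "Comp C w x y p g = Null C w y" using p by simp
  then have "Comp C w x z h g = Null C w z" using 0 g by blast
  then have "h \<in> (\<lambda>u. Comp C x y z u p) ` Hom C y z"
    using wc h unfolding is_weak_cokernel_def arr_def by blast
  then show thesis using that p h by (auto simp: arr_def)
qed

text \<open>
  Objects of \<open>C\<close> are injective in the Freyd category. Here \<open>h : x \<rightarrow> y\<close> and \<open>g : e \<rightarrow> y\<close> are extended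
  simultaneously along \<open>p : x \<rightarrow> x'\<close> and \<open>k : e \<rightarrow> x'\<close>, provided that they agree where \<open>p\<close> and \<open>k\<close> do.
  Replacing \<open>e\<close> by an object \<open>a\<close> of \<open>C\<close> of which it is a quotient reduces this to the extension of
  \<open>(h, g) : x \<oplus> a \<rightarrow> y\<close> along \<open>(p, k) : x \<oplus> a \<rightarrow> x'\<close>.
\<close>

lemma extension:
  assumes p: "arr C x x' p" and k: "arr E e J$x' k"
    and h: "arr C x y h" and g: "arr E e J$y g"
    and agree: "\<And>s \<alpha> \<beta>. \<lbrakk>arr C s x \<alpha>; arr E J$s e \<beta>;
        mmap J s x' (Comp C s x x' p \<alpha>) = Comp E J$s e J$x' k \<beta>\<rbrakk>
      \<Longrightarrow> mmap J s y (Comp C s x y h \<alpha>) = Comp E J$s e J$y g \<beta>"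
  obtains t where "arr C x' y t" "Comp C x x' y t p = h"
    "Comp E e J$x' J$y (mmap J x' y t) k = g"
proof -
  obtain a b f where e: "e = (a, b, f)" by (cases e)
  have f: "arr C a b f" using arrD(1)[OF k] by (simp add: e Obj_freyd)
  obtain \<pi> where \<pi>: "arr E J$a e \<pi>"
    and epi: "\<And>d g h. \<lbrakk>arr E e d g; arr E e d h;
      Comp E J$a e d g \<pi> = Comp E J$a e d h \<pi>\<rbrakk> \<Longrightarrow> g = h"
    unfolding e using f by (elim freyd_image) blast
  note o [simp] = arrD(1,2)[OF p] arrD(1,2)[OF f] arrD(2)[OF h]
  obtain k' where k': "arr C a x' k'" "Comp E J$a e J$x' k \<pi> = mmap J a x' k'"
    by (rule J_full[OF E.arr_Comp[OF \<pi> k]]) simp_all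
  obtain g' where g': "arr C a y g'" "Comp E J$a e J$y g \<pi> = mmap J a y g'"
    by (rule J_full[OF E.arr_Comp[OF \<pi> g]]) simp_all
  obtain s i1 i2 p1 p2 where s: "is_direct_sum C x a s i1 i2 p1 p2" using direct_sum o by blast
  note d [simp] = is_direct_sumD[OF s]
  note [simp] = p h k'(1) g'(1)
  let ?q = "Plus C s x' (Comp C s x x' p p1) (Comp C s a x' k' p2)"
  let ?h = "Plus C s y (Comp C s x y h p1) (Comp C s a y g' p2)"
  have "Comp C w s y ?h \<alpha> = Null C w y" if \<alpha>: "arr C w s \<alpha>" and 0: "Comp C w s x' ?q \<alpha> = Null C w x'" for w \<alpha>
  proof -
    let ?n = "Neg C w a (Comp C w s a p2 \<alpha>)"
    note [simp] = \<alpha> arrD(1)[OF \<alpha>]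
    have "Plus C w x' (Comp C w x x' p (Comp C w s x p1 \<alpha>)) (Neg C w x' (Comp C w a x' k' ?n)) = Null C w x'"
      using 0 by (simp add: assoc)
    then have "Comp C w x x' p (Comp C w s x p1 \<alpha>) = Comp C w a x' k' ?n"
      by (subst (asm) Neg_eq_iff) simp_all
    moreover have n: "arr C w a ?n" by simp
    ultimately have "mmap J w x' (Comp C w x x' p (Comp C w s x p1 \<alpha>)) =
        Comp E J$w e J$x' k (Comp E J$w J$a e \<pi> (mmap J w a ?n))"
      using \<pi> k J(2)[OF n] J(4)[OF n k'(1)] by (simp add: E.reassoc[OF k'(2)] del: Comp_Neg)
    then have "mmap J w y (Comp C w x y h (Comp C w s x p1 \<alpha>)) =
        Comp E J$w e J$y g (Comp E J$w J$a e \<pi> (mmap J w a ?n))"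
      using \<pi> J(2)[OF n] by (intro agree) simp_all
    also have "\<dots> = mmap J w y (Comp C w a y g' ?n)"
      using \<pi> g J(2)[OF n] J(4)[OF n g'(1)] by (simp add: E.reassoc[OF g'(2)] del: Comp_Neg)
    finally have "Comp C w x y h (Comp C w s x p1 \<alpha>) = Comp C w a y g' ?n"
      by (subst (asm) J_eq_iff) simp_all
    then show ?thesis by (simp add: assoc)
  qed
  then obtain t where t: "arr C x' y t" "Comp C s x' y t ?q = ?h"
    using factor_through[of s x' ?q y ?h] by auto
  have "Comp C x x' y t (Comp C x s x' ?q i1) = Comp C x s y ?h i1"
    using t by (subst reassoc[OF t(2)]) (simp_all del: Comp_Plus)
  then have 1: "Comp C x x' y t p = h" by (simp add: assoc)
  have "Comp C a x' y t (Comp C a s x' ?q i2) = Comp C a s y ?h i2"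
    using t by (subst reassoc[OF t(2)]) (simp_all del: Comp_Plus)
  then have 2: "Comp C a x' y t k' = g'" by (simp add: assoc)
  have "Comp E e J$x' J$y (mmap J x' y t) k = g"
  proof (rule epi)
    show "Comp E J$a e J$y (Comp E e J$x' J$y (mmap J x' y t) k) \<pi> =
        Comp E J$a e J$y g \<pi>"
      using t(1) k \<pi> J(2)[OF t(1)] J(4)[of a x' k' y t] by (simp add: E.assoc k'(2) g'(2) 2)
  qed (use k g J(2)[OF t(1)] in simp_all)
  then show thesis using that t(1) 1 by blast
qed

end

section \<open>Split morphisms\<close>

context preadditive
begin

text \<open>
  Von Neumann regularity, which is splitness up to the existence of images of idempotents.
\<close>

definition regular :: "'o \<Rightarrow> 'o \<Rightarrow> 'm \<Rightarrow> bool" where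
  "regular a b f \<longleftrightarrow> (\<exists>g. arr C b a g \<and> Comp C a b b (Comp C b a b f g) f = f)"

text \<open>
  The morphism \<open>X \<oplus> Y \<rightarrow> Y \<oplus> Z\<close> with \<open>id\<^sub>Y\<close> as its only component has the quasi-inverse with
  \<open>id\<^sub>Y\<close> as its only component, and quasi-inverses are transported along isomorphisms.
\<close>

lemma split_imp_regular:
  assumes "is_split C a b f" and f: "arr C a b f"
  shows "regular a b f"
proof -
  obtain x y z s ix iy px py t jy jz qy qz g
    where g: "g \<in> Hom C s t"
      and s: "is_direct_sum C x y s ix iy px py" and t: "is_direct_sum C y z t jy jz qy qz"
      and 0: "Comp C x t y qy (Comp C x s t g ix) = Null C x y"
        "Comp C x t z qz (Comp C x s t g ix) = Null C x z"
        "Comp C y t y qy (Comp C y s t g iy) = Id C y"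
        "Comp C y t z qz (Comp C y s t g iy) = Null C y z"
      and iso: "isomorphic (arrow_category C) (a, b, f) (s, t, g)"
    using assms(1) unfolding is_split_def by blast
  note [simp] = is_direct_sumD[OF s] is_direct_sumD[OF t]
  have g [simp]: "arr C s t g" using g by (simp add: arr_def)
  have decomp: "h = Plus C w t (Comp C w y t jy (Comp C w t y qy h)) (Comp C w z t jz (Comp C w t z qz h))"
    if "arr C w t h" for w h
  proof -
    have "h = Comp C w t t (Plus C t t (Comp C t y t jy qy) (Comp C t z t jz qz)) h"
      using that by simp
    then show ?thesis using that by (simp add: assoc del: is_direct_sumD(12)[OF t])
  qed
  have gx: "Comp C x s t g ix = Null C x t" using decomp[of x "Comp C x s t g ix"] by (simp add: 0)
  have gy: "Comp C y s t g iy = jy" using decomp[of y "Comp C y s t g iy"] by (simp add: 0)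
  have "g = Comp C s s t g (Plus C s s (Comp C s x s ix px) (Comp C s y s iy py))" by simp
  also have "\<dots> = Comp C s y t jy py"
    by (simp add: reassoc[OF gx] reassoc[OF gy] del: is_direct_sumD(12)[OF s])
  finally have geq: "g = Comp C s y t jy py" .
  let ?r = "Comp C t y s iy qy"
  have grg: "Comp C s s t g (Comp C s t s ?r g) = g"
    by (simp add: geq assoc reassoc[OF is_direct_sumD(8)[OF t]] reassoc[OF is_direct_sumD(9)[OF s]])
  interpret A: preadditive "arrow_category C" by (rule preadditive_arrow)
  obtain w where "is_iso (arrow_category C) (a, b, f) (s, t, g) w" using iso by (auto simp: isomorphic_def)
  then obtain w' where w: "arr (arrow_category C) (a, b, f) (s, t, g) w"
    "arr (arrow_category C) (s, t, g) (a, b, f) w'"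
    "Comp (arrow_category C) (a, b, f) (s, t, g) (a, b, f) w' w = Id (arrow_category C) (a, b, f)"
    using f by (auto elim!: A.isoE simp: Obj_arrow)
  obtain u v u' v' where "w = (u, v)" "w' = (u', v')" by fastforce
  then have u: "arr C a s u" "arr C s a u'" "Comp C a s a u' u = Id C a"
    and v: "arr C b t v" "arr C t b v'" and c: "Comp C a s t g u = Comp C a b t v f"
      "Comp C s a b f u' = Comp C s t b v' g"
    using w by (simp_all add: arr_arrow_iff)
  have "Comp C a b b (Comp C b a b f (Comp C b s a u' (Comp C b t s ?r v))) f
      = Comp C a s b (Comp C s a b f u') (Comp C a t s ?r (Comp C a b t v f))"
    using f u v by (simp add: assoc)
  also have "\<dots> = Comp C a t b v' (Comp C a s t (Comp C s s t g (Comp C s t s ?r g)) u)"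
    using f u v by (simp add: c(2) c(1)[symmetric] assoc)
  also have "\<dots> = Comp C a s b (Comp C s a b f u') u"
    unfolding grg using u v by (simp add: c(2) assoc)
  also have "\<dots> = f" using f u by (simp add: assoc)
  finally show ?thesis
    unfolding regular_def using u v by (intro exI[of _ "Comp C b s a u' (Comp C b t s ?r v)"]) simp
qed

lemma regular_Null: "\<lbrakk>a \<in> Obj C; b \<in> Obj C\<rbrakk> \<Longrightarrow> regular a b (Null C a b)"
  unfolding regular_def by (rule exI[of _ "Null C b a"]) simp

lemma regular_Id: "a \<in> Obj C \<Longrightarrow> regular a a (Id C a)"
  unfolding regular_def by (rule exI[of _ "Id C a"]) simp

lemma regular_direct_sum:
  assumes f: "arr C a b f" "regular a b f" and f': "arr C a' b' f'" "regular a' b' f'"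
    and s: "is_direct_sum C a a' s i1 i2 p1 p2" and t: "is_direct_sum C b b' t j1 j2 q1 q2"
  shows "regular s t (Plus C s t (Comp C s b t j1 (Comp C s a b f p1)) (Comp C s b' t j2 (Comp C s a' b' f' p2)))"
proof -
  note d [simp] = is_direct_sumD[OF s] is_direct_sumD[OF t]
  obtain g g' where g [simp]: "arr C b a g" "arr C b' a' g'"
    and "Comp C a b b (Comp C b a b f g) f = f" "Comp C a' b' b' (Comp C b' a' b' f' g') f' = f'"
    using f f' by (auto simp: regular_def)
  then have r: "Comp C s a b f (Comp C s b a g (Comp C s a b f p1)) = Comp C s a b f p1"
    "Comp C s a' b' f' (Comp C s b' a' g' (Comp C s a' b' f' p2)) = Comp C s a' b' f' p2"
    using f(1) f'(1) by (simp_all flip: assoc)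
  let ?f = "Plus C s t (Comp C s b t j1 (Comp C s a b f p1)) (Comp C s b' t j2 (Comp C s a' b' f' p2))"
  let ?g = "Plus C t s (Comp C t a s i1 (Comp C t b a g q1)) (Comp C t a' s i2 (Comp C t b' a' g' q2))"
  have "Comp C s t t (Comp C t s t ?f ?g) ?f = ?f"
    using f(1) f'(1) by (simp add: assoc r
      reassoc[OF is_direct_sumD(8)[OF s]] reassoc[OF is_direct_sumD(9)[OF s]]
      reassoc[OF is_direct_sumD(10)[OF s]] reassoc[OF is_direct_sumD(11)[OF s]]
      reassoc[OF is_direct_sumD(8)[OF t]] reassoc[OF is_direct_sumD(9)[OF t]]
      reassoc[OF is_direct_sumD(10)[OF t]] reassoc[OF is_direct_sumD(11)[OF t]])
  then show ?thesis unfolding regular_def using f(1) f'(1) by (intro exI[of _ ?g]) simp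
qed

end

context weakly_abelian_category
begin

text \<open>The image \<open>(a, a, e)\<close> of \<open>e\<close> splits it, since \<open>i \<circ> p \<circ> i \<circ> p = i \<circ> p\<close> can be cancelled on both sides.\<close>

lemma split_idempotent:
  assumes e: "arr C a a e" "Comp C a a a e e = e"
  obtains y i p where "arr E y J$a i" "arr E J$a y p"
    "Comp E y J$a y p i = Id E y"
    "Comp E J$a y J$a i p = mmap J a a e"
proof -
  obtain p i where pi: "arr E J$a (a, a, e) p" "arr E (a, a, e) J$a i"
    "Comp E J$a (a, a, e) J$a i p = mmap J a a e"
    and epi: "\<And>d g h. \<lbrakk>arr E (a, a, e) d g; arr E (a, a, e) d h;
      Comp E J$a (a, a, e) d g p = Comp E J$a (a, a, e) d h p\<rbrakk> \<Longrightarrow> g = h"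
    and mono: "\<And>d g h. \<lbrakk>arr E d (a, a, e) g; arr E d (a, a, e) h;
      Comp E d (a, a, e) J$a i g = Comp E d (a, a, e) J$a i h\<rbrakk> \<Longrightarrow> g = h"
    by (rule freyd_image[OF e(1)]) blast
  let ?y = "(a, a, e)"
  have y: "?y \<in> Obj E" using arrD(2)[OF pi(1)] .
  have ee: "Comp E J$a J$a J$a (mmap J a a e) (mmap J a a e) = mmap J a a e"
    using J(4)[OF e(1) e(1)] e(2) by simp
  have "Comp E ?y J$a ?y p i = Id E ?y"
  proof (rule epi, rule_tac [3] mono)
    show "Comp E J$a ?y J$a i (Comp E J$a ?y ?y (Comp E ?y J$a ?y p i) p) =
      Comp E J$a ?y J$a i (Comp E J$a ?y ?y (Id E ?y) p)"
      using pi(1,2) ee by (simp add: E.assoc pi(3) E.reassoc[OF pi(3)] J(2)[OF e(1)] del: F.Id_quotient)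
  qed (use pi y in \<open>simp_all del: F.Id_quotient F.Obj_quotient\<close>)
  then show thesis using that pi by blast
qed

text \<open>
  If \<open>V\<close> and \<open>W\<close> are images of idempotents \<open>e\<close> and \<open>e'\<close>, the component \<open>V \<rightarrow> W\<close> of \<open>m\<close> is that of
  \<open>e' \<circ> m \<circ> e\<close>.
\<close>

lemma retract_Null:
  assumes i: "arr E V J$c i" and p: "arr E J$c V p"
    and "Comp E V J$c V p i = Id E V"
    and ip: "Comp E J$c V J$c i p = mmap J c c e"
    and i': "arr E W J$d i'" and p': "arr E J$d W p'"
    and "Comp E W J$d W p' i' = Id E W"
    and ip': "Comp E J$d W J$d i' p' = mmap J d d e'"
    and m: "arr C c d m" "arr C c c e" "arr C d d e'"
    and 0: "Comp C c d d e' (Comp C c c d m e) = Null C c d"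
  shows "Comp E V J$d W p' (Comp E V J$c J$d (mmap J c d m) i) = Null E V W"
proof -
  note Jm = J(2)[OF m(1)] J(2)[OF m(2)] J(2)[OF m(3)]
  note o = arrD(1,2)[OF i] arrD(1,2)[OF i'] arrD(1,2)[OF m(1)]
  have "Comp E V J$d W p' (Comp E V J$c J$d (mmap J c d m) i)
      = Comp E V J$d W (Comp E J$d W W (Comp E W J$d W p' i') p')
          (Comp E V J$c J$d (mmap J c d m)
            (Comp E V V J$c i (Comp E V J$c V p i)))"
    using assms(3,7) i i' p p' Jm o by simp
  also have "\<dots> = Comp E V J$d W p' (Comp E V J$c J$d
      (Comp E J$c J$d J$d (Comp E J$d W J$d i' p')
        (Comp E J$c J$c J$d (mmap J c d m)
          (Comp E J$c V J$c i p))) i)"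
    using i i' p p' Jm o by (simp add: E.assoc del: assms(3,7))
  also have "\<dots> = Null E V W"
    unfolding ip ip' using m J(4)[OF m(2,1)] J(4)[OF _ m(3), of c "Comp C c c d m e"] 0 i i' p' o
    by (simp add: J_Null flip: J(4))
  finally show ?thesis .
qed

text \<open>
  If \<open>f \<circ> g \<circ> f = f\<close> in \<open>C\<close>, then \<open>X\<close>, \<open>Y\<close> and \<open>Z\<close> are the images of the idempotents \<open>1 - g \<circ> f\<close>,
  \<open>g \<circ> f\<close> and \<open>1 - f \<circ> g\<close>. They need not belong to \<open>C\<close>, but they exist in the Freyd category.
\<close>

lemma regular_imp_split:
  assumes f: "arr C a b f" and reg: "regular a b f"
  shows "is_split E J$a J$b (mmap J a b f)"
proof -
  obtain g where g: "arr C b a g" and fgf: "Comp C a b b (Comp C b a b f g) f = f"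
    using reg by (auto simp: regular_def)
  note o [simp] = arrD(1,2)[OF f] f g
  have fgf': "Comp C a a b f (Comp C a b a g f) = f" using fgf by (simp add: assoc)
  have fgf'': "Comp C w a b f (Comp C w b a g (Comp C w a b f h)) = Comp C w a b f h"
    if h: "arr C w a h" for w h
  proof -
    have "Comp C w a b (Comp C a a b f (Comp C a b a g f)) h = Comp C w a b f h" by (simp only: fgf')
    then show ?thesis using h by (simp add: assoc)
  qed
  let ?e = "Comp C a b a g f" and ?e' = "Comp C b a b f g"
  let ?x = "Plus C a a (Id C a) (Neg C a a ?e)" and ?z = "Plus C b b (Id C b) (Neg C b b ?e')"
  obtain Y iy py where y: "arr E Y J$a iy" "arr E J$a Y py"
    "Comp E Y J$a Y py iy = Id E Y"
    "Comp E J$a Y J$a iy py = mmap J a a ?e"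
    by (rule split_idempotent[of a ?e]) (simp_all add: assoc fgf')
  obtain X ix px where x: "arr E X J$a ix" "arr E J$a X px"
    "Comp E X J$a X px ix = Id E X"
    "Comp E J$a X J$a ix px = mmap J a a ?x"
    by (rule split_idempotent[of a ?x]) (simp_all add: assoc fgf' Plus_assoc)
  obtain Z iz pz where z: "arr E Z J$b iz" "arr E J$b Z pz"
    "Comp E Z J$b Z pz iz = Id E Z"
    "Comp E J$b Z J$b iz pz = mmap J b b ?z"
    by (rule split_idempotent[of b ?z]) (simp_all add: assoc fgf'' Plus_assoc)
  note [simp] = x(1-3) y(1-3) z(1-3) arrD(1)[OF x(1)] arrD(1)[OF y(1)] arrD(1)[OF z(1)]
  have [simp]: "J$a \<in> Obj E" "J$b \<in> Obj E" by (simp_all add: J)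
  have Jf [simp]: "arr E J$a J$b (mmap J a b f)"
    "arr E J$b J$a (mmap J b a g)" by (simp_all add: J)
  have Jgf: "Comp E J$a J$b J$a (mmap J b a g) (mmap J a b f) = mmap J a a ?e"
    by (simp add: J)
  have xy: "Comp E X J$a Y py ix = Null E X Y"
    using retract_Null[OF x(1,2) x(3,4) y(1,2) y(3,4) arr_Id] by (simp add: J fgf' assoc)
  have yx: "Comp E Y J$a X px iy = Null E Y X"
    using retract_Null[OF y(1,2) y(3,4) x(1,2) x(3,4) arr_Id] by (simp add: J fgf' assoc)
  have fx: "Comp E X J$b Y (Comp E J$b J$a Y py (mmap J b a g))
      (Comp E X J$a J$b (mmap J a b f) ix) = Null E X Y"
    using retract_Null[OF x(1,2) x(3,4) y(1,2) y(3,4), of ?e]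
    by (simp add: J E.assoc fgf' fgf'' assoc)
  have fxz: "Comp E X J$b Z pz (Comp E X J$a J$b (mmap J a b f) ix)
      = Null E X Z"
    using retract_Null[OF x(1,2) x(3,4) z(1,2) z(3,4), of f] by (simp add: fgf' fgf'' assoc)
  have fyz: "Comp E Y J$b Z pz (Comp E Y J$a J$b (mmap J a b f) iy)
      = Null E Y Z"
    using retract_Null[OF y(1,2) y(3,4) z(1,2) z(3,4), of f] by (simp add: fgf' fgf'' assoc)
  have zy: "Comp E Z J$b Y (Comp E J$b J$a Y py (mmap J b a g)) iz
      = Null E Z Y"
    using retract_Null[OF z(1,2) z(3,4) y(1,2) y(3,4), of g] by (simp add: E.assoc fgf' fgf'' assoc)
  have yy: "Comp E Y J$b Y (Comp E J$b J$a Y py (mmap J b a g))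
      (Comp E Y J$a J$b (mmap J a b f) iy) = Id E Y"
    by (simp add: E.assoc E.reassoc[OF Jgf] y(4)[symmetric] E.reassoc[OF y(3)])
  have sum_a: "Plus E J$a J$a (mmap J a a ?x) (mmap J a a ?e) = Id E J$a"
    using J_Plus[of a a ?x ?e] J(3)[of a] by (simp add: Plus_assoc)
  have "mmap J b b ?e' = Comp E J$b Y J$b
      (Comp E Y J$a J$b (mmap J a b f) iy)
      (Comp E J$b J$a Y py (mmap J b a g))"
  proof -
    have e: "arr E J$a J$a (mmap J a a ?e)" by (simp add: J(2))
    have "mmap J b b ?e' = mmap J b b (Comp C b a b f (Comp C b a a ?e g))"
      using fgf''[of b g] by (simp add: assoc)
    also have "\<dots> = Comp E J$b J$a J$b (mmap J a b f)
      (Comp E J$b J$a J$a (mmap J a a ?e) (mmap J b a g))"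
      using J(4)[of b a "Comp C b a a ?e g" b f] J(4)[of b a g a ?e] by simp
    also have "\<dots> = Comp E J$b Y J$b
      (Comp E Y J$a J$b (mmap J a b f) iy)
      (Comp E J$b J$a Y py (mmap J b a g))"
      by (simp add: E.assoc E.reassoc[OF y(4)] e)
    finally show ?thesis .
  qed
  then have sum_b: "Plus E J$b J$b (Comp E J$b Y J$b
      (Comp E Y J$a J$b (mmap J a b f) iy)
      (Comp E J$b J$a Y py (mmap J b a g))) (mmap J b b ?z) = Id E J$b"
    using J_Plus[of b b ?e' ?z] J(3)[of b] by (simp add: Plus_lcomm)
  show ?thesis
    unfolding is_split_def
  proof (intro bexI exI conjI)
    show "is_direct_sum E X Y J$a ix iy px py"
      by (rule is_direct_sumI) (simp_all add: xy yx x(4) y(4) sum_a del: E.Comp_Plus)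
    show "is_direct_sum E Y Z J$b
      (Comp E Y J$a J$b (mmap J a b f) iy) iz
      (Comp E J$b J$a Y py (mmap J b a g)) pz"
      by (rule is_direct_sumI) (simp_all add: fyz zy yy z(4) sum_b)
    show "isomorphic (arrow_category E) (J$a, J$b, mmap J a b f) (J$a, J$b, mmap J a b f)"
      using E.preadditive_arrow by (intro category.isomorphic_refl) (simp_all add: preadditive_def Obj_arrow)
  qed (simp_all add: fx fxz fyz yy arrD(3)[OF Jf(1)])
qed

lemma split_freyd_iff:
  assumes f: "arr C a b f"
  shows "is_split E J$a J$b (mmap J a b f) \<longleftrightarrow> regular a b f"
proof
  assume "is_split E J$a J$b (mmap J a b f)"
  then obtain G where G: "arr E J$b J$a G"
    "Comp E J$a J$b J$b
      (Comp E J$b J$a J$b (mmap J a b f) G) (mmap J a b f) = mmap J a b f"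
    using E.split_imp_regular[OF _ J(2)[OF f]] by (auto simp: E.regular_def)
  obtain g where g: "arr C b a g" "G = mmap J b a g"
    by (rule J_full[OF G(1)]) (use arrD(1,2)[OF f] in simp_all)
  have "mmap J a b (Comp C a b b (Comp C b a b f g) f) = mmap J a b f"
    using G(2) f g J(4)[of b a g b f] J(4)[of a b f b "Comp C b a b f g"] by simp
  then show "regular a b f"
    using f g by (auto simp: J_eq_iff regular_def)
qed (rule regular_imp_split[OF f])

end

section \<open>Diagrams over a finite chain\<close>

(* Keeps the bound 1 of chains and of their indices in the same form. *)
declare One_nat_def [simp del]

lemma poset_category_simps [simp]:
  "Obj (poset_category P) = P"
  "Hom (poset_category P) i j = (if i \<le> j then {()} else {})"
  "Id (poset_category P) i = ()"
  "Comp (poset_category P) i j k g f = ()"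
  by (simp_all add: poset_category_def)

lemma arr_poset_category [simp]: "arr (poset_category P) i j e \<longleftrightarrow> i \<in> P \<and> j \<in> P \<and> i \<le> j"
  by (auto simp: arr_def)

lemma category_poset: "category (poset_category P)"
  by unfold_locales (auto split: if_splits)

lemma chain_functorD:
  assumes "is_functor (chain n) A X"
  shows "\<lbrakk>1 \<le> i; i \<le> n\<rbrakk> \<Longrightarrow> X$i \<in> Obj A"
    "\<lbrakk>1 \<le> i; i \<le> j; j \<le> n\<rbrakk> \<Longrightarrow> arr A X$i X$j (mmap X i j e)"
    "\<lbrakk>1 \<le> i; i \<le> n\<rbrakk> \<Longrightarrow> mmap X i i e = Id A X$i"
    "\<lbrakk>1 \<le> i; i \<le> j; j \<le> k; k \<le> n\<rbrakk> \<Longrightarrow>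
      Comp A X$i X$j X$k (mmap X j k e) (mmap X i j e') = mmap X i k e''"
  using is_functorD(4)[OF assms, of i] is_functorD(5)[OF assms, of i j e] is_functorD(6)[OF assms, of i]
    is_functorD(7)[OF assms, of i j e' k e] by auto

lemma chain_functorI:
  assumes "category A" "\<And>i. \<lbrakk>1 \<le> i; i \<le> n\<rbrakk> \<Longrightarrow> F i \<in> Obj A"
    "\<And>i j. \<lbrakk>1 \<le> i; i \<le> j; j \<le> n\<rbrakk> \<Longrightarrow> arr A (F i) (F j) (F' i j ())"
    "\<And>i. \<lbrakk>1 \<le> i; i \<le> n\<rbrakk> \<Longrightarrow> F' i i () = Id A (F i)"
    "\<And>i j k. \<lbrakk>1 \<le> i; i \<le> j; j \<le> k; k \<le> n\<rbrakk> \<Longrightarrow>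
      F' i k () = Comp A (F i) (F j) (F k) (F' j k ()) (F' i j ())"
  shows "is_functor (chain n) A (mk_functor (chain n) F F')"
proof (rule is_functor_mkI)
  show "category (chain n)" "category A" by (rule category_poset, fact)
  fix i j k e e' assume ij: "arr (chain n) i j e" and jk: "arr (chain n) j k e'"
  show "F' i k (Comp (chain n) i j k e' e) = Comp A (F i) (F j) (F k) (F' j k e') (F' i j e)"
    using assms(5)[of i j k] ij jk by simp
next
  fix i j e assume ij: "arr (chain n) i j e"
  show "arr A (F i) (F j) (F' i j e)" using assms(3)[of i j] ij by simp
qed (use assms(2,4) in simp_all)

lemma arr_chain_diagramI:
  assumes "is_functor (chain n) A X" "is_functor (chain n) A Y" "t \<in> extensional {1..n}"
    "\<And>i. \<lbrakk>1 \<le> i; i \<le> n\<rbrakk> \<Longrightarrow> arr A X$i Y$i (t i)"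
    "\<And>i j. \<lbrakk>1 \<le> i; i < j; j \<le> n\<rbrakk> \<Longrightarrow> Comp A X$i Y$i Y$j (mmap Y i j ()) (t i)
      = Comp A X$i X$j Y$j (t j) (mmap X i j ())"
  shows "arr (diagram_category (chain n) A) X Y t"
proof (rule arr_diagramI)
  interpret category A by (rule is_functorD[OF assms(1)])
  fix i j e assume "arr (chain n) i j e"
  then show "Comp A X$i Y$i Y$j (mmap Y i j e) (t i)
      = Comp A X$i X$j Y$j (t j) (mmap X i j e)"
    using assms(4)[of i] assms(5)[of i j] chain_functorD(3)[OF assms(1), of i] chain_functorD(3)[OF assms(2), of i]
    by (cases "i = j") auto
qed (use assms in auto)

lemma arr_chain_diagramD:
  assumes "arr (diagram_category (chain n) A) X Y t"
  shows "is_functor (chain n) A X" "is_functor (chain n) A Y" "t \<in> extensional {1..n}"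
    "\<lbrakk>1 \<le> i; i \<le> n\<rbrakk> \<Longrightarrow> arr A X$i Y$i (t i)"
    "\<lbrakk>1 \<le> i; i \<le> j; j \<le> n\<rbrakk> \<Longrightarrow> Comp A X$i Y$i Y$j (mmap Y i j e) (t i)
      = Comp A X$i X$j Y$j (t j) (mmap X i j e)"
  using arr_diagramD[OF assms] by auto

lemma arr_chain_diagram_stepI:
  assumes X: "is_functor (chain n) A X" and Y: "is_functor (chain n) A Y" and t: "t \<in> extensional {1..n}"
    "\<And>i. \<lbrakk>1 \<le> i; i \<le> n\<rbrakk> \<Longrightarrow> arr A X$i Y$i (t i)"
    and step: "\<And>i. \<lbrakk>1 \<le> i; Suc i \<le> n\<rbrakk> \<Longrightarrow>
      Comp A X$i Y$i Y$(Suc i) (mmap Y i (Suc i) ()) (t i)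
      = Comp A X$i X$(Suc i) Y$(Suc i) (t (Suc i)) (mmap X i (Suc i) ())"
  shows "arr (diagram_category (chain n) A) X Y t"
proof (rule arr_chain_diagramI[OF X Y t])
  interpret category A by (rule is_functorD[OF X])
  note X' = chain_functorD[OF X] and Y' = chain_functorD[OF Y]
  have "i \<le> j \<Longrightarrow> 1 \<le> i \<Longrightarrow> j \<le> n \<Longrightarrow> Comp A X$i Y$i Y$j (mmap Y i j ()) (t i)
      = Comp A X$i X$j Y$j (t j) (mmap X i j ())" for i j
  proof (induction j rule: dec_induct)
    case base
    then show ?case using t(2) X'(3) Y'(3) by simp
  next
    case (step j)
    have j: "1 \<le> j" "j \<le> n" "Suc j \<le> n" "i \<le> n" "1 \<le> i" "i \<le> j" using step by auto
    have "Comp A X$i Y$i Y$(Suc j) (mmap Y i (Suc j) ()) (t i) =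
        Comp A X$i Y$j Y$(Suc j) (mmap Y j (Suc j) ())
          (Comp A X$i Y$i Y$j (mmap Y i j ()) (t i))"
      using j t(2) X' Y' by (subst reassoc[OF Y'(4)]) auto
    also have "\<dots> = Comp A X$i Y$j Y$(Suc j) (mmap Y j (Suc j) ())
          (Comp A X$i X$j Y$j (t j) (mmap X i j ()))"
      using step j by simp
    also have "\<dots> = Comp A X$i X$j Y$(Suc j)
        (Comp A X$j X$(Suc j) Y$(Suc j) (t (Suc j)) (mmap X j (Suc j) ())) (mmap X i j ())"
      using j t(2) X' Y' by (subst reassoc[OF assms(5)[of j]]) auto
    also have "\<dots> = Comp A X$i X$(Suc j) Y$(Suc j) (t (Suc j)) (mmap X i (Suc j) ())"
      using j t(2) X' by (simp add: assoc)
    finally show ?case .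
  qed
  then show "Comp A X$i Y$i Y$j (mmap Y i j ()) (t i)
      = Comp A X$i X$j Y$j (t j) (mmap X i j ())" if "1 \<le> i" "i < j" "j \<le> n" for i j
    using that by simp
qed

lemma (in category) chain_functor_from_steps:
  assumes x: "\<And>i. \<lbrakk>1 \<le> i; i \<le> n\<rbrakk> \<Longrightarrow> x i \<in> Obj C"
    and u: "\<And>i. \<lbrakk>1 \<le> i; Suc i \<le> n\<rbrakk> \<Longrightarrow> arr C (x i) (x (Suc i)) (u i)"
  obtains X where "is_functor (chain n) C X" "\<And>i. \<lbrakk>1 \<le> i; i \<le> n\<rbrakk> \<Longrightarrow> X$i = x i"
    "\<And>i. \<lbrakk>1 \<le> i; Suc i \<le> n\<rbrakk> \<Longrightarrow> mmap X i (Suc i) () = u i"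
proof -
  define p where "p i d = rec_nat (Id C (x i)) (\<lambda>d q. Comp C (x i) (x (i + d)) (x (i + Suc d)) (u (i + d)) q) d" for i d
  have p0: "p i 0 = Id C (x i)" and pS: "p i (Suc d) = Comp C (x i) (x (i + d)) (x (i + Suc d)) (u (i + d)) (p i d)"
    for i d by (simp_all add: p_def)
  have p: "arr C (x i) (x (i + d)) (p i d)" if "1 \<le> i" "i + d \<le> n" for i d
    using that
  proof (induction d)
    case 0
    then show ?case using x by (simp add: p0)
  next
    case (Suc d)
    then show ?case using u[of "i + d"] by (simp add: pS)
  qed
  have pp: "p i (d + d') = Comp C (x i) (x (i + d)) (x (i + d + d')) (p (i + d) d') (p i d)"
    if "1 \<le> i" "i + d + d' \<le> n" for i d d'
    using that
  proof (induction d')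
    case 0
    then show ?case using p by (simp add: p0)
  next
    case (Suc d')
    then show ?case using u[of "i + d + d'"] p[of i d] p[of "i + d" d']
      by (simp add: pS assoc add.assoc)
  qed
  let ?X = "mk_functor (chain n) x (\<lambda>i j e. p i (j - i))"
  have "is_functor (chain n) C ?X"
  proof (rule chain_functorI[OF category_axioms])
    show "p i (k - i) = Comp C (x i) (x j) (x k) (p j (k - j)) (p i (j - i))"
      if "1 \<le> i" "i \<le> j" "j \<le> k" "k \<le> n" for i j k
      using pp[of i "j - i" "k - j"] that by simp
    show "arr C (x i) (x j) (p i (j - i))" if "1 \<le> i" "i \<le> j" "j \<le> n" for i j
      using p[of i "j - i"] that by simp
  qed (simp_all add: x p0)
  moreover have "mmap ?X i (Suc i) () = u i" if "1 \<le> i" "Suc i \<le> n" for i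
    using that u[OF that] by (simp add: Suc_diff_le pS p0)
  ultimately show thesis using that[of ?X] by simp
qed

section \<open>Pointwise kernels of the maps to the last object\<close>

context weakly_abelian_category
begin

lemma preadditive_chain_diagrams:
  "preadditive (Diag m)" "preadditive (EDiag m)"
  by (simp_all add: preadditive_diagram category_poset preadditive_axioms E.preadditive_axioms)

lemma is_functor_truncated:
  assumes "is_functor (chain (Suc m)) C X"
  shows "is_functor (chain m) E (emb m X)"
proof -
  note X = chain_functorD[OF assms]
  have "is_functor (chain m) E (mk_functor (chain m) (\<lambda>i. X$$i)
      (\<lambda>i j e. mmap J X$i X$j (mmap X i j e)))"
  proof (rule chain_functorI[OF E.category_axioms])
    show "Jmor X i k = Comp E X$$i X$$j
      X$$k (Jmor X j k) (Jmor X i j)"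
      if "1 \<le> i" "i \<le> j" "j \<le> k" "k \<le> m" for i j k
      using that X(2)[of i j "()"] X(2)[of j k "()"] X(4)[of i j k "()" "()" "()"] by (simp flip: J(4))
  qed (use X J in simp_all)
  then show ?thesis by (simp add: comp_functor_def)
qed

text \<open>
  \<open>K\<close> consists of kernels of \<open>X\<^sub>i \<rightarrow> X\<^sub>m\<^sub>+\<^sub>1\<close> for \<open>i \<le> m\<close>. Arbitrary such \<open>K\<close> are admitted, and not only
  those from a choice of kernels, because a diagram whose maps to the last object are zero
  is to be viewed as its own kernel.
\<close>

definition kernel_system where
  "kernel_system m X K \<iota> \<longleftrightarrow> is_functor (chain (Suc m)) C X \<and>
     arr (EDiag m) K (emb m X) \<iota> \<and>
     (\<forall>i. 1 \<le> i \<and> i \<le> m \<longrightarrow> is_kernel E X$$i X$$(Suc m)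
        (Jmor X i (Suc m)) K$i (\<iota> i))"

lemma kernel_systemD:
  assumes "kernel_system m X K \<iota>"
  shows "is_functor (chain (Suc m)) C X" "is_functor (chain m) E K"
    "\<lbrakk>1 \<le> i; i \<le> m\<rbrakk> \<Longrightarrow> arr E K$i X$$i (\<iota> i)"
    "\<lbrakk>1 \<le> i; i \<le> j; j \<le> m\<rbrakk> \<Longrightarrow>
      Comp E K$i X$$i X$$j (Jmor X i j) (\<iota> i)
      = Comp E K$i K$j X$$j (\<iota> j) (mmap K i j ())"
    "\<lbrakk>1 \<le> i; i \<le> m\<rbrakk> \<Longrightarrow> Comp E K$i X$$i X$$(Suc m)
      (Jmor X i (Suc m)) (\<iota> i) = Null E K$i X$$(Suc m)"
    "\<lbrakk>1 \<le> i; i \<le> m; arr E s X$$i v;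
      Comp E s X$$i X$$(Suc m)
        (Jmor X i (Suc m)) v = Null E s X$$(Suc m)\<rbrakk>
      \<Longrightarrow> \<exists>u. arr E s K$i u \<and> Comp E s K$i X$$i (\<iota> i) u = v"
    "\<lbrakk>1 \<le> i; i \<le> m; arr E s K$i u; arr E s K$i u';
      Comp E s K$i X$$i (\<iota> i) u = Comp E s K$i X$$i (\<iota> i) u'\<rbrakk>
      \<Longrightarrow> u = u'"
    "\<lbrakk>1 \<le> i; i \<le> m; arr C c X$i \<alpha>;
      Comp C c X$i X$(Suc m) (mmap X i (Suc m) ()) \<alpha> = Null C c X$(Suc m)\<rbrakk>
      \<Longrightarrow> \<exists>u. arr E J$c K$i u \<and>
        Comp E J$c K$i X$$i (\<iota> i) u = mmap J c X$i \<alpha>"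
proof -
  show X: "is_functor (chain (Suc m)) C X" using assms by (simp add: kernel_system_def)
  have \<iota>: "arr (EDiag m) K (emb m X) \<iota>"
    using assms by (simp add: kernel_system_def)
  note \<iota>' = arr_chain_diagramD[OF \<iota>]
  show "is_functor (chain m) E K" by (rule \<iota>'(1))
  show i: "arr E K$i X$$i (\<iota> i)" if "1 \<le> i" "i \<le> m" for i
    using \<iota>'(4)[OF that] that by simp
  show "\<lbrakk>1 \<le> i; i \<le> j; j \<le> m\<rbrakk> \<Longrightarrow>
      Comp E K$i X$$i X$$j (Jmor X i j) (\<iota> i)
      = Comp E K$i K$j X$$j (\<iota> j) (mmap K i j ())"
    using \<iota>'(5)[of i j "()"] by simp
  have k: "is_kernel E X$$i X$$(Suc m)
        (Jmor X i (Suc m)) K$i (\<iota> i)"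
    and a: "arr E X$$i X$$(Suc m) (Jmor X i (Suc m))"
    if "1 \<le> i" "i \<le> m" for i
    using that assms chain_functorD[OF X] J by (simp_all add: kernel_system_def)
  note kD = E.kernelD[OF k a]
  show "Comp E K$i X$$i X$$(Suc m)
      (Jmor X i (Suc m)) (\<iota> i) = Null E K$i X$$(Suc m)"
    if "1 \<le> i" "i \<le> m" using kD(3) that by blast
  show u: "\<exists>u. arr E s K$i u \<and> Comp E s K$i X$$i (\<iota> i) u = v"
    if "1 \<le> i" "i \<le> m" "arr E s X$$i v"
      "Comp E s X$$i X$$(Suc m)
        (Jmor X i (Suc m)) v = Null E s X$$(Suc m)" for i s v
    using kD(4) that by blast
  show "u = u'" if "1 \<le> i" "i \<le> m" "arr E s K$i u" "arr E s K$i u'"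
      "Comp E s K$i X$$i (\<iota> i) u = Comp E s K$i X$$i (\<iota> i) u'"
    using kD(5) that by blast
  show "\<exists>u. arr E J$c K$i u \<and>
        Comp E J$c K$i X$$i (\<iota> i) u = mmap J c X$i \<alpha>"
    if "1 \<le> i" "i \<le> m" and \<alpha>: "arr C c X$i \<alpha>"
      "Comp C c X$i X$(Suc m) (mmap X i (Suc m) ()) \<alpha> = Null C c X$(Suc m)"
  proof (rule u[OF that(1,2) J(2)[OF \<alpha>(1)]])
    have a: "arr C X$i X$(Suc m) (mmap X i (Suc m) ())" using that chain_functorD[OF X] by simp
    then show "Comp E J$c X$$i X$$(Suc m)
      (Jmor X i (Suc m)) (mmap J c X$i \<alpha>) =
      Null E J$c X$$(Suc m)"
      using \<alpha> arrD[OF \<alpha>(1)] arrD(2)[OF a] by (simp add: J_Null flip: J(4))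
  qed
qed

text \<open>
  Fullness: \<open>t\<^sub>i\<close> is constructed by induction on \<open>i\<close>. The maps \<open>X\<^sub>i \<rightarrow> X\<^sub>i\<^sub>+\<^sub>1\<close> and \<open>K\<^sub>i\<^sub>+\<^sub>1 \<rightarrow> X\<^sub>i\<^sub>+\<^sub>1\<close> meet only
  in \<open>K\<^sub>i\<close>, where the values prescribed for \<open>t\<^sub>i\<^sub>+\<^sub>1\<close> agree.
\<close>

lemma kernel_system_full:
  assumes XK: "kernel_system m X K \<iota>" and YL: "kernel_system m Y L \<kappa>"
    and u: "arr (EDiag m) K L u" and m: "1 \<le> m"
  obtains t where "arr (Diag (Suc m)) X Y t"
    "\<And>i. \<lbrakk>1 \<le> i; i \<le> m\<rbrakk> \<Longrightarrow>
      Comp E K$i X$$i Y$$i (mmap J X$i Y$i (t i)) (\<iota> i)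
      = Comp E K$i L$i Y$$i (\<kappa> i) (u i)"
proof -
  note k = kernel_systemD[OF XK] and l = kernel_systemD[OF YL] and u' = arr_chain_diagramD[OF u]
  note X = chain_functorD[OF k(1)] and Y = chain_functorD[OF l(1)]
  note K = chain_functorD[OF k(2)] and L = chain_functorD[OF l(2)]
  define good where "good i s \<longleftrightarrow> arr C X$i Y$i s \<and> (i \<le> m \<longrightarrow>
      Comp E K$i X$$i Y$$i (mmap J X$i Y$i s) (\<iota> i)
      = Comp E K$i L$i Y$$i (\<kappa> i) (u i))" for i s
  have g: "arr E K$i Y$$i (Comp E K$i L$i Y$$i (\<kappa> i) (u i))"
    if "1 \<le> i" "i \<le> m" for i
    using that u'(4) l(3) by simp
  have base: "\<exists>s. good 1 s"
  proof -
    have n: "arr C X$1 X$1 (Null C X$1 X$1)"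
      "arr C X$1 Y$1 (Null C X$1 Y$1)" using X Y by simp_all
    show ?thesis
    \<comment> \<open>\<open>X\<^sub>1\<close> has no predecessor; with a zero map in its place, \<open>extension\<close> asks for \<open>\<iota> 1\<close> to be monomorphic.\<close>
    proof (rule extension[OF n(1) k(3)[OF order_refl m] n(2) g[OF order_refl m]])
      fix c \<alpha> \<beta> assume \<alpha>: "arr C c X$1 \<alpha>" and \<beta>: "arr E J$c K$1 \<beta>"
        and eq: "mmap J c X$1 (Comp C c X$1 X$1 (Null C X$1 X$1) \<alpha>) =
          Comp E J$c K$1 X$$1 (\<iota> 1) \<beta>"
      note [simp] = \<alpha> \<beta> arrD(1)[OF \<alpha>] arrD(1)[OF \<beta>] X(1)[of 1] Y(1)[of 1] k(3)[OF order_refl m] l(3)[OF order_refl m]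
        u'(4)[OF order_refl m] K(1)[of 1] m L(1)[of 1] J(1)
      have "\<beta> = Null E J$c K$1"
        by (rule k(7)[OF order_refl m \<beta>]) (use eq m in \<open>simp_all add: J_Null\<close>)
      then show "mmap J c Y$1 (Comp C c X$1 Y$1 (Null C X$1 Y$1) \<alpha>) =
          Comp E J$c K$1 Y$$1
            (Comp E K$1 L$1 Y$$1 (\<kappa> 1) (u 1)) \<beta>"
        using m by (simp add: J_Null)
    qed (auto simp: good_def)
  qed
  have step: "\<exists>s'. good (Suc i) s' \<and> Comp C X$i Y$i Y$(Suc i) (mmap Y i (Suc i) ()) s
      = Comp C X$i X$(Suc i) Y$(Suc i) s' (mmap X i (Suc i) ())"
    if i: "1 \<le> i" "i \<le> m" and s: "good i s" for i s
  proof -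
    have s1: "arr C X$i Y$i s" and s2: "Comp E K$i X$$i Y$$i (mmap J X$i Y$i s) (\<iota> i)
      = Comp E K$i L$i Y$$i (\<kappa> i) (u i)" using s i by (auto simp: good_def)
    note [simp] = s1 X(2)[of i "Suc i" "()"] Y(2)[of i "Suc i" "()"] i J(1,2)
    let ?p = "mmap X i (Suc i) ()" and ?q = "mmap Y i (Suc i) ()"
    let ?h = "Comp C X$i Y$i Y$(Suc i) ?q s"
    have p: "arr C X$i X$(Suc i) ?p" and h: "arr C X$i Y$(Suc i) ?h" using i by simp_all
    \<comment> \<open>What \<open>X\<^sub>i \<rightarrow> X\<^sub>m\<^sub>+\<^sub>1\<close> kills is contained in \<open>K\<^sub>i\<close>, where \<open>t\<^sub>i\<close> is known.\<close>
    have lift: "\<exists>\<gamma>. arr E J$c K$i \<gamma> \<and>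
        Comp E J$c K$i X$$i (\<iota> i) \<gamma> = mmap J c X$i \<alpha> \<and>
        mmap J c Y$(Suc i) (Comp C c X$i Y$(Suc i) ?h \<alpha>) =
          Comp E J$c L$i Y$$(Suc i)
            (Comp E L$i Y$$i Y$$(Suc i) (mmap J Y$i Y$(Suc i) ?q) (\<kappa> i))
            (Comp E J$c K$i L$i (u i) \<gamma>)"
      if \<alpha>: "arr C c X$i \<alpha>"
        and 0: "Comp C c X$i X$(Suc m) (mmap X i (Suc m) ()) \<alpha> = Null C c X$(Suc m)" for c \<alpha>
    proof -
      obtain \<gamma> where \<gamma>: "arr E J$c K$i \<gamma>"
        "Comp E J$c K$i X$$i (\<iota> i) \<gamma> = mmap J c X$i \<alpha>"
        using k(8)[OF i \<alpha> 0] by blast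
      note [simp] = k(3)[OF i] l(3)[OF i] u'(4)[OF i] \<gamma>(1) \<alpha>
      have "mmap J c Y$(Suc i) (Comp C c X$i Y$(Suc i) ?h \<alpha>) =
        Comp E J$c Y$$i Y$$(Suc i) (mmap J Y$i Y$(Suc i) ?q)
          (Comp E J$c X$$i Y$$i (mmap J X$i Y$i s)
          (Comp E J$c K$i X$$i (\<iota> i) \<gamma>))"
        by (simp add: assoc J(4) \<gamma>(2))
      also have "\<dots> = Comp E J$c L$i Y$$(Suc i)
            (Comp E L$i Y$$i Y$$(Suc i) (mmap J Y$i Y$(Suc i) ?q) (\<kappa> i))
            (Comp E J$c K$i L$i (u i) \<gamma>)"
        by (simp add: E.reassoc[OF s2] E.assoc)
      finally show ?thesis using \<gamma> by blast
    qed
    show ?thesis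
    proof (cases "Suc i \<le> m")
      case True
      have i': "1 \<le> Suc i" by simp
      note [simp] = k(3)[OF i] l(3)[OF i] u'(4)[OF i] k(3)[OF i' True] l(3)[OF i' True] u'(4)[OF i' True]
        K(2)[of i "Suc i" "()"] L(2)[of i "Suc i" "()"] X(2)[of "Suc i" "Suc m" "()"] X(2)[of i "Suc m" "()"] True
      show ?thesis
      proof (rule extension[OF p k(3)[OF i' True] h g[OF i' True]])
        fix c \<alpha> \<beta> assume \<alpha>: "arr C c X$i \<alpha>" and \<beta>: "arr E J$c K$(Suc i) \<beta>"
          and eq: "mmap J c X$(Suc i) (Comp C c X$i X$(Suc i) ?p \<alpha>) =
            Comp E J$c K$(Suc i) X$$(Suc i) (\<iota> (Suc i)) \<beta>"
        have xm [simp]: "arr C X$i X$(Suc m) (mmap X i (Suc m) ())" by (rule X(2)) (use i in linarith)+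
        note o [simp] = \<alpha> \<beta> arrD(1)[OF \<alpha>] arrD(1)[OF \<beta>] X(1)[of "Suc m"] X(1)[of "Suc i"]
        have "mmap J c X$(Suc m) (Comp C c X$i X$(Suc m) (mmap X i (Suc m) ()) \<alpha>)
          = Comp E J$c X$$(Suc i) X$$(Suc m)
            (Jmor X (Suc i) (Suc m))
            (mmap J c X$(Suc i) (Comp C c X$i X$(Suc i) ?p \<alpha>))"
          using X(4)[of i "Suc i" "Suc m" "()" "()" "()"] by (simp add: reassoc flip: J(4))
        also have "\<dots> = Null E J$c X$$(Suc m)"
          unfolding eq using k(5)[OF i' True] by (simp add: E.reassoc)
        finally have "Comp C c X$i X$(Suc m) (mmap X i (Suc m) ()) \<alpha> = Null C c X$(Suc m)"
          by (simp add: J_eq_Null_iff)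
        then obtain \<gamma> where \<gamma>: "arr E J$c K$i \<gamma>"
          "Comp E J$c K$i X$$i (\<iota> i) \<gamma> = mmap J c X$i \<alpha>"
          "mmap J c Y$(Suc i) (Comp C c X$i Y$(Suc i) ?h \<alpha>) =
          Comp E J$c L$i Y$$(Suc i)
            (Comp E L$i Y$$i Y$$(Suc i) (mmap J Y$i Y$(Suc i) ?q) (\<kappa> i))
            (Comp E J$c K$i L$i (u i) \<gamma>)" using lift[OF \<alpha>] by blast
        note [simp] = \<gamma>(1)
        have "\<beta> = Comp E J$c K$i K$(Suc i) (mmap K i (Suc i) ()) \<gamma>"
        proof (rule k(7)[OF i' True \<beta>])
          show "Comp E J$c K$(Suc i) X$$(Suc i) (\<iota> (Suc i)) \<beta> =
            Comp E J$c K$(Suc i) X$$(Suc i) (\<iota> (Suc i))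
              (Comp E J$c K$i K$(Suc i) (mmap K i (Suc i) ()) \<gamma>)"
            using eq by (simp add: J(4) \<gamma>(2)[symmetric] E.reassoc[OF k(4)[OF i(1) le_SucI[OF order_refl] True]] E.assoc)
        qed simp
        then show "mmap J c Y$(Suc i) (Comp C c X$i Y$(Suc i) ?h \<alpha>) =
            Comp E J$c K$(Suc i) Y$$(Suc i)
              (Comp E K$(Suc i) L$(Suc i) Y$$(Suc i) (\<kappa> (Suc i)) (u (Suc i))) \<beta>"
          unfolding \<gamma>(3)
          by (simp add: E.assoc E.reassoc[OF l(4)[OF i(1) le_SucI[OF order_refl] True]]
              E.reassoc[OF u'(5)[OF i(1) le_SucI[OF order_refl] True]])
      qed (auto simp: good_def)
    next
      case False
      then have im: "i = m" using i by linarith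
      have n: "arr E X$$i X$$(Suc i) (Null E X$$i X$$(Suc i))"
        "arr E X$$i Y$$(Suc i) (Null E X$$i Y$$(Suc i))"
        using X(1)[of i] X(1)[of "Suc i"] Y(1)[of "Suc i"] i by simp_all
      show ?thesis
      \<comment> \<open>The last object carries no kernel, so that there is no second map to extend.\<close>
      proof (rule extension[OF p n(1) h n(2)])
        fix c \<alpha> \<beta> assume \<alpha>: "arr C c X$i \<alpha>" and \<beta>: "arr E J$c X$$i \<beta>"
          and eq: "mmap J c X$(Suc i) (Comp C c X$i X$(Suc i) ?p \<alpha>) =
            Comp E J$c X$$i X$$(Suc i) (Null E X$$i X$$(Suc i)) \<beta>"
        note [simp] = \<alpha> \<beta> arrD(1)[OF \<alpha>] X(1)[of i] X(1)[of "Suc i"] Y(1)[of "Suc i"] k(3)[OF i] l(3)[OF i] u'(4)[OF i]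
        have "Comp C c X$i X$(Suc m) (mmap X i (Suc m) ()) \<alpha> = Null C c X$(Suc m)"
          using eq unfolding im[symmetric] by (simp add: J_eq_Null_iff)
        then obtain \<gamma> where \<gamma>: "arr E J$c K$i \<gamma>"
          "mmap J c Y$(Suc i) (Comp C c X$i Y$(Suc i) ?h \<alpha>) =
          Comp E J$c L$i Y$$(Suc i)
            (Comp E L$i Y$$i Y$$(Suc i) (mmap J Y$i Y$(Suc i) ?q) (\<kappa> i))
            (Comp E J$c K$i L$i (u i) \<gamma>)" using lift[OF \<alpha>] by blast
        have "Comp E L$i Y$$i Y$$(Suc i) (mmap J Y$i Y$(Suc i) ?q) (\<kappa> i)
          = Null E L$i Y$$(Suc i)"
          using l(5)[OF i] unfolding im .
        then show "mmap J c Y$(Suc i) (Comp C c X$i Y$(Suc i) ?h \<alpha>) =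
            Comp E J$c X$$i Y$$(Suc i) (Null E X$$i Y$$(Suc i)) \<beta>"
          unfolding \<gamma>(2) using \<gamma>(1) by simp
      qed (use False in \<open>auto simp: good_def\<close>)
    qed
  qed
  have "\<exists>f. \<forall>j. (j \<le> m \<longrightarrow> good (Suc j) (f j)) \<and> (j < m \<longrightarrow>
      Comp C X$(Suc j) Y$(Suc j) Y$(Suc (Suc j)) (mmap Y (Suc j) (Suc (Suc j)) ()) (f j)
      = Comp C X$(Suc j) X$(Suc (Suc j)) Y$(Suc (Suc j)) (f (Suc j)) (mmap X (Suc j) (Suc (Suc j)) ()))"
  proof (rule dependent_nat_choice)
    show "\<exists>x. 0 \<le> m \<longrightarrow> good (Suc 0) x" using base by (simp add: One_nat_def)
    fix x j assume x: "j \<le> m \<longrightarrow> good (Suc j) x"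
    show "\<exists>y. (Suc j \<le> m \<longrightarrow> good (Suc (Suc j)) y) \<and> (j < m \<longrightarrow>
      Comp C X$(Suc j) Y$(Suc j) Y$(Suc (Suc j)) (mmap Y (Suc j) (Suc (Suc j)) ()) x
      = Comp C X$(Suc j) X$(Suc (Suc j)) Y$(Suc (Suc j)) y (mmap X (Suc j) (Suc (Suc j)) ()))"
    proof (cases "j < m")
      case True
      then show ?thesis using step[of "Suc j" x] x by auto
    qed auto
  qed
  then obtain f where f: "\<And>j. j \<le> m \<Longrightarrow> good (Suc j) (f j)"
    "\<And>j. j < m \<Longrightarrow> Comp C X$(Suc j) Y$(Suc j) Y$(Suc (Suc j)) (mmap Y (Suc j) (Suc (Suc j)) ()) (f j)
      = Comp C X$(Suc j) X$(Suc (Suc j)) Y$(Suc (Suc j)) (f (Suc j)) (mmap X (Suc j) (Suc (Suc j)) ())"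
    by blast
  define t where "t = (\<lambda>i\<in>{1..Suc m}. f (i - 1))"
  have t: "good i (t i)" if "1 \<le> i" "i \<le> Suc m" for i
    using that f(1)[of "i - 1"] by (simp add: t_def)
  show thesis
  proof (rule that[of t])
    show "arr (Diag (Suc m)) X Y t"
    proof (rule arr_chain_diagram_stepI[OF k(1) l(1)])
      fix i assume "1 \<le> i" "Suc i \<le> Suc m"
      then show "Comp C X$i Y$i Y$(Suc i) (mmap Y i (Suc i) ()) (t i) =
         Comp C X$i X$(Suc i) Y$(Suc i) (t (Suc i)) (mmap X i (Suc i) ())"
        using f(2)[of "i - 1"] by (simp add: t_def)
    qed (use t in \<open>auto simp: good_def t_def\<close>)
  qed (use t in \<open>simp add: good_def\<close>)
qed

lemma kernel_system_arr_eqI: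
  assumes L: "kernel_system m Y L \<kappa>"
    and u: "arr (EDiag m) K L u" "arr (EDiag m) K L u'"
    and eq: "\<And>i. \<lbrakk>1 \<le> i; i \<le> m\<rbrakk> \<Longrightarrow> Comp E K$i L$i Y$$i (\<kappa> i) (u i)
      = Comp E K$i L$i Y$$i (\<kappa> i) (u' i)"
  shows "u = u'"
proof (rule diagram_eqI[OF u])
  fix i assume "i \<in> Obj (chain m)"
  then have i: "1 \<le> i" "i \<le> m" by auto
  show "u i = u' i"
    by (rule kernel_systemD(7)[OF L i arr_chain_diagramD(4)[OF u(1) i] arr_chain_diagramD(4)[OF u(2) i] eq[OF i]])
qed

text \<open>
  Functoriality of kernels, for kernels of \<open>X\<close> and of \<open>Y\<close> that are chosen independently.
\<close>

lemma kernel_system_lift: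
  assumes XK: "kernel_system m X K \<iota>" and YL: "kernel_system m Y L \<kappa>"
    and t: "arr (Diag (Suc m)) X Y t"
  obtains u where "arr (EDiag m) K L u"
    "\<And>i. \<lbrakk>1 \<le> i; i \<le> m\<rbrakk> \<Longrightarrow> Comp E K$i L$i Y$$i (\<kappa> i) (u i)
      = Comp E K$i X$$i Y$$i (mmap J X$i Y$i (t i)) (\<iota> i)"
proof -
  note k = kernel_systemD[OF XK] and l = kernel_systemD[OF YL] and t' = arr_chain_diagramD[OF t]
  note X = chain_functorD[OF k(1)] and Y = chain_functorD[OF l(1)]
  note K = chain_functorD[OF k(2)] and L = chain_functorD[OF l(2)]
  have "\<exists>u. arr E K$i L$i u \<and>
      Comp E K$i L$i Y$$i (\<kappa> i) u
      = Comp E K$i X$$i Y$$i (mmap J X$i Y$i (t i)) (\<iota> i)"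
    if i: "1 \<le> i" "i \<le> m" for i
  proof (rule l(6)[OF i])
    have i': "i \<le> Suc m" "1 \<le> Suc m" using i by simp_all
    note [simp] = k(3)[OF i] t'(4)[OF i(1) i'(1)] t'(4)[OF i'(2) order_refl] X(2)[OF i(1) i'(1) order_refl]
      Y(2)[OF i(1) i'(1) order_refl] J(2) X(1)[OF i'(2) order_refl] Y(1)[OF i'(2) order_refl] J(1)
    show "arr E K$i Y$$i
      (Comp E K$i X$$i Y$$i (mmap J X$i Y$i (t i)) (\<iota> i))"
      by simp
    have c: "Comp E X$$i Y$$i Y$$(Suc m)
        (Jmor Y i (Suc m)) (mmap J X$i Y$i (t i)) =
      Comp E X$$i X$$(Suc m) Y$$(Suc m)
        (mmap J X$(Suc m) Y$(Suc m) (t (Suc m))) (Jmor X i (Suc m))"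
      using t'(5)[OF i(1) i'(1) order_refl, of "()"] by (simp flip: J(4))
    show "Comp E K$i Y$$i Y$$(Suc m)
       (Jmor Y i (Suc m))
       (Comp E K$i X$$i Y$$i (mmap J X$i Y$i (t i)) (\<iota> i)) =
      Null E K$i Y$$(Suc m)"
      using K(1)[OF i] by (simp add: E.reassoc[OF c] E.assoc k(5)[OF i])
  qed
  then obtain v where v: "\<And>i. \<lbrakk>1 \<le> i; i \<le> m\<rbrakk> \<Longrightarrow> arr E K$i L$i (v i)"
    "\<And>i. \<lbrakk>1 \<le> i; i \<le> m\<rbrakk> \<Longrightarrow> Comp E K$i L$i Y$$i (\<kappa> i) (v i)
      = Comp E K$i X$$i Y$$i (mmap J X$i Y$i (t i)) (\<iota> i)"
    by metis
  let ?u = "\<lambda>i\<in>{1..m}. v i"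
  have "arr (EDiag m) K L ?u"
  proof (rule arr_chain_diagramI[OF k(2) l(2)])
    fix i j assume "1 \<le> i" "i < j" "j \<le> m"
    then have i: "1 \<le> i" "i \<le> m" and j: "1 \<le> j" "j \<le> m" and ij: "i \<le> j" and i': "i \<le> Suc m" and j': "j \<le> Suc m"
      by simp_all
    note [simp] = k(3)[OF i] k(3)[OF j] l(3)[OF i] l(3)[OF j] v(1)[OF i] v(1)[OF j] t'(4)[OF i(1) i'] t'(4)[OF j(1) j']
      X(2)[OF i(1) ij j'] Y(2)[OF i(1) ij j'] K(2)[OF i(1) ij j(2)] L(2)[OF i(1) ij j(2)] J(2)
    have c: "Comp E X$$i Y$$i Y$$j
        (Jmor Y i j) (mmap J X$i Y$i (t i)) =
      Comp E X$$i X$$j Y$$j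
        (mmap J X$j Y$j (t j)) (Jmor X i j)"
      using t'(5)[OF i(1) ij j', of "()"] by (simp flip: J(4))
    have "Comp E K$i L$i L$j (mmap L i j ()) (v i)
      = Comp E K$i K$j L$j (v j) (mmap K i j ())"
    proof (rule l(7)[OF j])
      show "Comp E K$i L$j Y$$j (\<kappa> j)
          (Comp E K$i L$i L$j (mmap L i j ()) (v i)) =
        Comp E K$i L$j Y$$j (\<kappa> j)
          (Comp E K$i K$j L$j (v j) (mmap K i j ()))"
        by (simp add: E.reassoc[OF l(4)[OF i(1) ij j(2), symmetric]] E.assoc v(2)[OF i] E.reassoc[OF v(2)[OF j]]
            E.reassoc[OF c] k(4)[OF i(1) ij j(2)])
    qed simp_all
    then show "Comp E K$i L$i L$j (mmap L i j ()) (?u i)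
      = Comp E K$i K$j L$j (?u j) (mmap K i j ())"
      using i j by simp
  qed (use v in auto)
  then show thesis by (rule that) (use v in simp)
qed

lemma kernel_system_unique:
  assumes K: "kernel_system m X K \<iota>" and L: "kernel_system m X L \<kappa>"
  shows "isomorphic (EDiag m) K L"
proof -
  let ?E = "EDiag m" and ?D = "Diag (Suc m)"
  interpret DE: preadditive ?E by (rule preadditive_chain_diagrams)
  interpret D: preadditive ?D by (rule preadditive_chain_diagrams)
  have "X \<in> Obj ?D" using kernel_systemD(1)[OF K] by (simp add: diagram_category_simps)
  then have Id: "arr ?D X X (Id ?D X)" by (rule D.arr_Id)
  obtain u where u: "arr ?E K L u" "\<And>i. \<lbrakk>1 \<le> i; i \<le> m\<rbrakk> \<Longrightarrow>
    Comp E K$i L$i X$$i (\<kappa> i) (u i) =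
      Comp E K$i X$$i X$$i (mmap J X$i X$i (Id ?D X i)) (\<iota> i)"
    by (rule kernel_system_lift[OF K L Id]) blast
  obtain v where v: "arr ?E L K v" "\<And>i. \<lbrakk>1 \<le> i; i \<le> m\<rbrakk> \<Longrightarrow>
    Comp E L$i K$i X$$i (\<iota> i) (v i) =
      Comp E L$i X$$i X$$i (mmap J X$i X$i (Id ?D X i)) (\<kappa> i)"
    by (rule kernel_system_lift[OF L K Id]) blast
  note k = kernel_systemD[OF K] and l = kernel_systemD[OF L]
  have Ji: "mmap J X$i X$i (Id ?D X i) = Id E X$$i" if "1 \<le> i" "i \<le> m" for i
    using that chain_functorD(1)[OF k(1)] by (simp add: diagram_category_simps J(3))
  have u2: "Comp E K$i L$i X$$i (\<kappa> i) (u i) = \<iota> i"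
    and v2: "Comp E L$i K$i X$$i (\<iota> i) (v i) = \<kappa> i" if "1 \<le> i" "i \<le> m" for i
    using u(2)[OF that] v(2)[OF that] k(3)[OF that] l(3)[OF that] by (simp_all add: Ji[OF that])
  have o: "K \<in> Obj ?E" "L \<in> Obj ?E" using arrD[OF u(1)] by simp_all
  have "is_iso ?E K L u"
  proof (rule DE.isoI[OF u(1) v(1)])
    show "Comp ?E K L K v u = Id ?E K"
    proof (rule kernel_system_arr_eqI[OF K])
      fix i assume i: "1 \<le> i" "i \<le> m"
      show "Comp E K$i K$i X$$i (\<iota> i) (Comp ?E K L K v u i) =
        Comp E K$i K$i X$$i (\<iota> i) (Id ?E K i)"
        using i arr_chain_diagramD(4)[OF u(1) i] arr_chain_diagramD(4)[OF v(1) i] k(3)[OF i]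
        by (simp add: diagram_category_simps E.reassoc[OF v2[OF i]] u2[OF i])
    qed (use u v o in simp_all)
    show "Comp ?E L K L u v = Id ?E L"
    proof (rule kernel_system_arr_eqI[OF L])
      fix i assume i: "1 \<le> i" "i \<le> m"
      show "Comp E L$i L$i X$$i (\<kappa> i) (Comp ?E L K L u v i) =
        Comp E L$i L$i X$$i (\<kappa> i) (Id ?E L i)"
        using i arr_chain_diagramD(4)[OF u(1) i] arr_chain_diagramD(4)[OF v(1) i] l(3)[OF i]
        by (simp add: diagram_category_simps E.reassoc[OF u2[OF i]] v2[OF i])
    qed (use u v o in simp_all)
  qed
  then show ?thesis by (auto simp: isomorphic_def)
qed

section \<open>Every diagram is a diagram of kernels\<close>

text \<open>
  The morphism \<open>f\<close> in \<open>e = (a, b, f)\<close> is a weak kernel of some \<open>c\<close>, hence \<open>e\<close> is a kernel of \<open>c\<close>.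
\<close>

lemma freyd_kernel_of_embedded:
  assumes "e \<in> Obj E"
  obtains b d c i where "arr C b d c" "is_kernel E J$b J$d (mmap J b d c) e i"
proof -
  obtain a b f where e: "e = (a, b, f)" by (cases e)
  have f: "arr C a b f" using assms by (simp add: e Obj_freyd)
  obtain d c where c: "d \<in> Obj C" "c \<in> Hom C b d" and k: "is_weak_kernel C b d c a f"
    using weak_kernel f arrD by metis
  have c: "arr C b d c" using c f by (simp add: arr_def)
  show thesis
  proof (rule freyd_image[OF f])
    fix i assume "\<And>c d. \<lbrakk>arr C b d c; is_weak_kernel C b d c a f\<rbrakk> \<Longrightarrow>
      is_kernel E J$b J$d (mmap J b d c) (a, b, f) i"
    from this[OF c k] show thesis by (intro that[OF c]) (simp add: e)
  qed
qed

text \<open>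
  Whatever \<open>g\<close> kills is killed by \<open>f = q \<circ> g\<close>, hence factors over \<open>e = Ker f\<close>, which \<open>g\<close> kills.
\<close>

lemma kernel_of_left_factor:
  assumes k: "is_kernel E x y f e i" and f: "arr E x y f"
    and g: "arr E x z g" and q: "arr E z y q" "Comp E x z y q g = f"
    and 0: "Comp E e x z g i = Null E e z"
  shows "is_kernel E x z g e i"
proof (rule E.kernelI[OF g])
  note k' = E.kernelD[OF k f]
  show "arr E e x i" by (rule k')
  show "\<exists>u. arr E s e u \<and> Comp E s e x i u = v"
    if v: "arr E s x v" and "Comp E s x z g v = Null E s z" for s v
  proof (rule k'(4)[OF v])
    have "Comp E s x y (Comp E x z y q g) v = Comp E s z y q (Comp E s x z g v)"
      using v g q(1) by (simp add: E.assoc)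
    then show "Comp E s x y f v = Null E s y"
      using that q arrD(1)[OF v] by simp
  qed
  show "u = v" if "arr E s e u" "arr E s e v" "Comp E s e x i u = Comp E s e x i v" for s u v
    using k'(5) that by blast
qed (rule 0)

text \<open>
  Given \<open>e = Ker (c : x \<rightarrow> D)\<close> and \<open>e \<rightarrow> e'\<close>, write \<open>e' = Ker (c' : b \<rightarrow> d)\<close>, extend \<open>e \<rightarrow> e' \<rightarrow> b\<close> to
  \<open>F : x \<rightarrow> b\<close>, and replace \<open>b\<close> by \<open>b \<oplus> D\<close> and \<open>x \<rightarrow> b\<close> by \<open>(F, c)\<close>. The second summand keeps
  the kernel of the composite \<open>x \<rightarrow> b \<oplus> D \<rightarrow> d \<oplus> D\<close> equal to \<open>e\<close>.
\<close>

lemma kernel_step: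
  assumes c: "arr C x D c" and k: "is_kernel E J$x J$D (mmap J x D c) e \<iota>"
    and y: "arr E e e' y"
  obtains x' D' c' \<iota>' u q where "arr C x' D' c'"
    "is_kernel E J$x' J$D' (mmap J x' D' c') e' \<iota>'"
    "arr C x x' u" "arr C D' D q" "Comp C x D' D q (Comp C x x' D' c' u) = c"
    "Comp E e J$x J$x' (mmap J x x' u) \<iota> = Comp E e e' J$x' \<iota>' y"
proof -
  obtain b d cb ib where cb: "arr C b d cb" and kb: "is_kernel E J$b J$d (mmap J b d cb) e' ib"
    using freyd_kernel_of_embedded[OF arrD(2)[OF y]] by blast
  note k' = E.kernelD[OF k J(2)[OF c]] and kb' = E.kernelD[OF kb J(2)[OF cb]]
  note [simp] = c cb k'(1,2) kb'(1,2) y arrD(1,2)[OF c] arrD(1,2)[OF cb] J(1,2)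
  have n: "arr C x x (Null C x x)" "arr C x b (Null C x b)" by simp_all
  obtain F where F: "arr C x b F" "Comp E e J$x J$b (mmap J x b F) \<iota> = Comp E e e' J$b ib y"
  proof (rule extension[OF n(1) k'(2) n(2)])
    fix s \<alpha> \<beta> assume \<alpha>: "arr C s x \<alpha>" and \<beta>: "arr E J$s e \<beta>"
      and eq: "mmap J s x (Comp C s x x (Null C x x) \<alpha>) = Comp E J$s e J$x \<iota> \<beta>"
    note [simp] = \<alpha> \<beta> arrD(1)[OF \<alpha>] arrD(1)[OF \<beta>]
    have "\<beta> = Null E J$s e"
      by (rule k'(5)[OF \<beta>]) (use eq in \<open>simp_all add: J_Null\<close>)
    then show "mmap J s b (Comp C s x b (Null C x b) \<alpha>) =
        Comp E J$s e J$b (Comp E e e' J$b ib y) \<beta>"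
      by (simp add: J_Null arrD[OF y])
  qed simp_all
  obtain x' i1 i2 p1 p2 where s: "is_direct_sum C b D x' i1 i2 p1 p2" using direct_sum by (metis arrD(1,2) c cb)
  obtain D' j1 j2 q1 q2 where t: "is_direct_sum C d D D' j1 j2 q1 q2" using direct_sum by (metis arrD(1,2) c cb)
  note [simp] = is_direct_sumD[OF s] is_direct_sumD[OF t] F(1)
  note r = reassoc[OF is_direct_sumD(8)[OF s]] reassoc[OF is_direct_sumD(9)[OF s]]
      reassoc[OF is_direct_sumD(10)[OF s]] reassoc[OF is_direct_sumD(11)[OF s]]
      reassoc[OF is_direct_sumD(8)[OF t]] reassoc[OF is_direct_sumD(9)[OF t]]
      reassoc[OF is_direct_sumD(10)[OF t]] reassoc[OF is_direct_sumD(11)[OF t]] assoc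
  let ?u = "Plus C x x' (Comp C x b x' i1 F) (Comp C x D x' i2 c)"
  let ?c = "Plus C x' D' (Comp C x' d D' j1 (Comp C x' b d cb p1)) (Comp C x' D D' j2 p2)"
  let ?i = "Comp E e' J$b J$x' (mmap J b x' i1) ib"
  have cc: "arr C x' D' ?c" by simp
  have proj: "Comp C x' D' d q1 ?c = Comp C x' b d cb p1" "Comp C x' D' D q2 ?c = p2"
    by (simp_all add: r)
  have ci: "Comp C b x' D' ?c i1 = Comp C b d D' j1 cb" by (simp add: r)
  show thesis
  proof (rule that[OF cc])
    show "arr C x x' ?u" "arr C D' D q2" by simp_all
    show "Comp C x D' D q2 (Comp C x x' D' ?c ?u) = c" by (simp add: r)
    have "Comp E e J$x J$x' (mmap J x x' ?u) \<iota> =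
      Plus E e J$x'
        (Comp E e J$b J$x' (mmap J b x' i1) (Comp E e J$x J$b (mmap J x b F) \<iota>))
        (Comp E e J$D J$x' (mmap J D x' i2) (Comp E e J$x J$D (mmap J x D c) \<iota>))"
      by (simp add: J_Plus J(4) E.assoc)
    then show "Comp E e J$x J$x' (mmap J x x' ?u) \<iota> = Comp E e e' J$x' ?i y"
      unfolding F(2) k'(3) by (simp add: E.assoc)
    show "is_kernel E J$x' J$D' (mmap J x' D' ?c) e' ?i"
    proof (rule E.kernelI)
      show "Comp E e' J$x' J$D' (mmap J x' D' ?c) ?i = Null E e' J$D'"
      proof -
        have "Comp E e' J$x' J$D' (mmap J x' D' ?c) ?i =
          Comp E e' J$b J$D' (mmap J b D' (Comp C b x' D' ?c i1)) ib"
          using cc by (simp add: J(4) E.assoc del: Comp_Plus arr_Plus)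
        then show ?thesis unfolding ci by (simp add: J(4) E.assoc kb'(3))
      qed
      show "\<exists>w. arr E s e' w \<and> Comp E s e' J$x' ?i w = v"
        if v: "arr E s J$x' v"
          and 0: "Comp E s J$x' J$D' (mmap J x' D' ?c) v = Null E s J$D'" for s v
      proof -
        note [simp] = v arrD(1)[OF v]
        have p: "Comp E s J$x' J$z (mmap J x' z (Comp C x' D' z q ?c)) v = Null E s J$z"
          if q: "arr C D' z q" for z q
          using q 0 cc arrD(2)[OF q] by (simp add: J(4) E.assoc del: Comp_Plus arr_Plus)
        have p2: "Comp E s J$x' J$D (mmap J x' D p2) v = Null E s J$D"
          using p[of D q2] unfolding proj by simp
        have "Comp E s J$b J$d (mmap J b d cb) (Comp E s J$x' J$b (mmap J x' b p1) v)
          = Null E s J$d"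
          using p[of d q1] unfolding proj by (simp add: J(4) E.assoc)
        then obtain w where w: "arr E s e' w"
          "Comp E s e' J$b ib w = Comp E s J$x' J$b (mmap J x' b p1) v"
          using kb'(4)[of s "Comp E s J$x' J$b (mmap J x' b p1) v"] by auto
        have "v = Comp E s J$x' J$x' (mmap J x' x' (Plus C x' x' (Comp C x' b x' i1 p1) (Comp C x' D x' i2 p2))) v"
          by (simp add: J(3))
        also have "\<dots> = Plus E s J$x'
            (Comp E s J$b J$x' (mmap J b x' i1) (Comp E s J$x' J$b (mmap J x' b p1) v))
            (Comp E s J$D J$x' (mmap J D x' i2) (Comp E s J$x' J$D (mmap J x' D p2) v))"
          by (simp add: J_Plus J(4) E.assoc del: is_direct_sumD(12)[OF s])
        also have "\<dots> = Comp E s e' J$x' ?i w"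
          unfolding p2 w(2)[symmetric] using w(1) by (simp add: E.assoc)
        finally show ?thesis using w(1) by auto
      qed
      show "w = w'" if w: "arr E s e' w" "arr E s e' w'"
        and eq: "Comp E s e' J$x' ?i w = Comp E s e' J$x' ?i w'" for s w w'
      proof (rule kb'(5)[OF w])
        have pi: "Comp E J$b J$x' J$b (mmap J x' b p1) (mmap J b x' i1) = Id E J$b"
          by (simp add: J(3) flip: J(4))
        have "Comp E s J$x' J$b (mmap J x' b p1) (Comp E s e' J$x' ?i w) =
          Comp E s J$x' J$b (mmap J x' b p1) (Comp E s e' J$x' ?i w')" by (simp only: eq)
        then show "Comp E s e' J$b ib w = Comp E s e' J$b ib w'"
          using w by (simp add: E.assoc E.reassoc[OF pi])
      qed
    qed (use cc in simp_all)
  qed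
qed

text \<open>
  Iterating the preceding construction yields \<open>X\<^sub>1 \<rightarrow> \<dots> \<rightarrow> X\<^sub>m\<close> and maps \<open>c\<^sub>i\<close> with kernels \<open>Y\<^sub>i\<close>;
  the target of \<open>c\<^sub>m\<close> is the last object.
\<close>

lemma kernel_system_dense:
  assumes Y: "is_functor (chain m) E Y" and m: "1 \<le> m"
  obtains X \<iota> where "kernel_system m X Y \<iota>"
proof -
  note Y' = chain_functorD[OF Y]
  define P where "P j s \<longleftrightarrow> (case s of (x, D, c, i) \<Rightarrow> arr C x D c \<and>
      is_kernel E J$x J$D (mmap J x D c) Y$(Suc j) i)" for j s
  define Q where "Q j s s' \<longleftrightarrow> (case s of (x, D, c, i) \<Rightarrow> case s' of (x', D', c', i') \<Rightarrow>
      \<exists>u q. arr C x x' u \<and> arr C D' D q \<and> Comp C x D' D q (Comp C x x' D' c' u) = c \<and>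
      Comp E Y$(Suc j) J$x J$x' (mmap J x x' u) i
        = Comp E Y$(Suc j) Y$(Suc (Suc j)) J$x' i' (mmap Y (Suc j) (Suc (Suc j)) ()))" for j s s'
  have "\<exists>f. \<forall>j. (j < m \<longrightarrow> P j (f j)) \<and> (Suc j < m \<longrightarrow> Q j (f j) (f (Suc j)))"
  proof (rule dependent_nat_choice)
    obtain b d c i where "arr C b d c" "is_kernel E J$b J$d (mmap J b d c) Y$1 i"
      using freyd_kernel_of_embedded[OF Y'(1)[OF order_refl m]] by blast
    then show "\<exists>s. 0 < m \<longrightarrow> P 0 s"
      by (intro exI[of _ "(b, d, c, i)"]) (simp add: P_def One_nat_def)
    fix s j assume s: "j < m \<longrightarrow> P j s"
    show "\<exists>s'. (Suc j < m \<longrightarrow> P (Suc j) s') \<and> (Suc j < m \<longrightarrow> Q j s s')"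
    proof (cases "Suc j < m")
      case True
      obtain x D c i where x: "s = (x, D, c, i)" "arr C x D c"
        "is_kernel E J$x J$D (mmap J x D c) Y$(Suc j) i"
        using s True by (cases s) (auto simp: P_def)
      have y: "arr E Y$(Suc j) Y$(Suc (Suc j)) (mmap Y (Suc j) (Suc (Suc j)) ())"
        using True by (intro Y'(2)) simp_all
      obtain x' D' c' i' u q where "arr C x' D' c'"
        "is_kernel E J$x' J$D' (mmap J x' D' c') Y$(Suc (Suc j)) i'"
        "arr C x x' u" "arr C D' D q" "Comp C x D' D q (Comp C x x' D' c' u) = c"
        "Comp E Y$(Suc j) J$x J$x' (mmap J x x' u) i
          = Comp E Y$(Suc j) Y$(Suc (Suc j)) J$x' i' (mmap Y (Suc j) (Suc (Suc j)) ())"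
        by (rule kernel_step[OF x(2,3) y])
      then show ?thesis by (intro exI[of _ "(x', D', c', i')"]) (auto simp: P_def Q_def x(1))
    qed auto
  qed
  then obtain f where f: "\<And>j. j < m \<Longrightarrow> P j (f j)" "\<And>j. Suc j < m \<Longrightarrow> Q j (f j) (f (Suc j))" by blast
  define x where "x i = fst (f (i - 1))" for i
  define D where "D i = fst (snd (f (i - 1)))" for i
  define c where "c i = fst (snd (snd (f (i - 1))))" for i
  define \<iota> where "\<iota> = (\<lambda>i\<in>{1..m}. snd (snd (snd (f (i - 1)))))"
  have c: "arr C (x i) (D i) (c i)"
    and k: "is_kernel E J$(x i) J$(D i) (mmap J (x i) (D i) (c i)) Y$i (\<iota> i)"
    if i: "1 \<le> i" "i \<le> m" for i
  proof -
    have "P (i - 1) (f (i - 1))" using f(1) i by simp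
    then show "arr C (x i) (D i) (c i)"
      "is_kernel E J$(x i) J$(D i) (mmap J (x i) (D i) (c i)) Y$i (\<iota> i)"
      using i by (auto simp: P_def x_def D_def c_def \<iota>_def split_beta)
  qed
  have "\<forall>i. \<exists>u q. 1 \<le> i \<longrightarrow> i < m \<longrightarrow> arr C (x i) (x (Suc i)) u \<and> arr C (D (Suc i)) (D i) q \<and>
      Comp C (x i) (D (Suc i)) (D i) q (Comp C (x i) (x (Suc i)) (D (Suc i)) (c (Suc i)) u) = c i \<and>
      Comp E Y$i J$(x i) J$(x (Suc i)) (mmap J (x i) (x (Suc i)) u) (\<iota> i)
        = Comp E Y$i Y$(Suc i) J$(x (Suc i)) (\<iota> (Suc i)) (mmap Y i (Suc i) ())"
  proof
    fix i
    show "\<exists>u q. 1 \<le> i \<longrightarrow> i < m \<longrightarrow> arr C (x i) (x (Suc i)) u \<and> arr C (D (Suc i)) (D i) q \<and>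
      Comp C (x i) (D (Suc i)) (D i) q (Comp C (x i) (x (Suc i)) (D (Suc i)) (c (Suc i)) u) = c i \<and>
      Comp E Y$i J$(x i) J$(x (Suc i)) (mmap J (x i) (x (Suc i)) u) (\<iota> i)
        = Comp E Y$i Y$(Suc i) J$(x (Suc i)) (\<iota> (Suc i)) (mmap Y i (Suc i) ())"
    proof (cases "1 \<le> i \<and> i < m")
      case True
      then obtain j where "i = Suc j" by (cases i) auto
      then show ?thesis using f(2)[of j] True
        by (simp add: Q_def x_def D_def c_def \<iota>_def split_beta)
    qed auto
  qed
  then obtain u q where uq: "arr C (x i) (x (Suc i)) (u i) \<and> arr C (D (Suc i)) (D i) (q i) \<and>
      Comp C (x i) (D (Suc i)) (D i) (q i) (Comp C (x i) (x (Suc i)) (D (Suc i)) (c (Suc i)) (u i)) = c i \<and>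
      Comp E Y$i J$(x i) J$(x (Suc i)) (mmap J (x i) (x (Suc i)) (u i)) (\<iota> i)
        = Comp E Y$i Y$(Suc i) J$(x (Suc i)) (\<iota> (Suc i)) (mmap Y i (Suc i) ())"
    if "1 \<le> i" "i < m" for i by metis
  define z where "z i = (if i \<le> m then x i else D m)" for i
  define v where "v i = (if i < m then u i else c m)" for i
  have cm: "arr C (x m) (D m) (c m)" using c m by simp
  obtain X where X: "is_functor (chain (Suc m)) C X" "\<And>i. \<lbrakk>1 \<le> i; i \<le> Suc m\<rbrakk> \<Longrightarrow> X$i = z i"
    "\<And>i. \<lbrakk>1 \<le> i; Suc i \<le> Suc m\<rbrakk> \<Longrightarrow> mmap X i (Suc i) () = v i"
  proof (rule chain_functor_from_steps[of "Suc m" z v])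
    show "z i \<in> Obj C" if "1 \<le> i" "i \<le> Suc m" for i
      using that c[of i] c[of m] m by (auto simp: z_def dest: arrD)
    show "arr C (z i) (z (Suc i)) (v i)" if "1 \<le> i" "Suc i \<le> Suc m" for i
    proof (cases "i < m")
      case True
      then show ?thesis using uq[of i] that by (simp add: z_def v_def)
    next
      case False
      then have "i = m" using that by simp
      then show ?thesis using cm by (simp add: z_def v_def)
    qed
  qed blast
  note X' = chain_functorD[OF X(1)]
  have Xx: "X$i = x i" if "1 \<le> i" "i \<le> m" for i using X(2)[of i] that by (simp add: z_def)
  have XD: "X$(Suc m) = D m" using X(2)[of "Suc m"] m by (simp add: z_def)
  have Xu: "mmap X i (Suc i) () = u i" if "1 \<le> i" "i < m" for i using X(3)[of i] that by (simp add: v_def)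
  have Xc: "mmap X m (Suc m) () = c m" using X(3)[of m] m by (simp add: v_def)
  have \<iota>: "arr (EDiag m) Y (emb m X) \<iota>"
  proof (rule arr_chain_diagram_stepI[OF Y is_functor_truncated[OF X(1)]])
    show "\<iota> \<in> extensional {1..m}" by (simp add: \<iota>_def)
    show "arr E Y$i (emb m X)$i (\<iota> i)" if "1 \<le> i" "i \<le> m" for i
      using E.kernelD(2)[OF k[OF that] J(2)[OF c[OF that]]] that by (simp add: Xx)
    show "Comp E Y$i (emb m X)$i (emb m X)$(Suc i)
        (mmap (emb m X) i (Suc i) ()) (\<iota> i) =
      Comp E Y$i Y$(Suc i) (emb m X)$(Suc i) (\<iota> (Suc i)) (mmap Y i (Suc i) ())"
      if "1 \<le> i" "Suc i \<le> m" for i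
      using that uq[of i] by (simp add: Xx Xu)
  qed
  \<comment> \<open>The kernel of \<open>X\<^sub>i \<rightarrow> X\<^sub>m\<^sub>+\<^sub>1\<close> is that of \<open>c i\<close>, which factors over \<open>X\<^sub>i \<rightarrow> X\<^sub>m\<^sub>+\<^sub>1\<close>.\<close>
  have factor: "\<exists>p. arr C (D m) (D i) p \<and> Comp C (x i) (D m) (D i) p (mmap X i (Suc m) ()) = c i"
    if "i \<le> m" "1 \<le> i" for i
    using that
  proof (induction i rule: inc_induct)
    case base
    then show ?case using cm Xc by (intro exI[of _ "Id C (D m)"]) (auto dest: arrD)
  next
    case (step i)
    then obtain p where p: "arr C (D m) (D (Suc i)) p"
      "Comp C (x (Suc i)) (D m) (D (Suc i)) p (mmap X (Suc i) (Suc m) ()) = c (Suc i)" by auto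
    have i: "1 \<le> i" "i < m" using step by simp_all
    have a: "arr C (x (Suc i)) (D m) (mmap X (Suc i) (Suc m) ())"
      using X'(2)[of "Suc i" "Suc m" "()"] i by (simp add: Xx XD)
    have "mmap X i (Suc m) () = Comp C (x i) (x (Suc i)) (D m) (mmap X (Suc i) (Suc m) ()) (u i)"
      using X'(4)[of i "Suc i" "Suc m" "()" "()" "()"] i by (simp add: Xx XD Xu)
    then have "Comp C (x i) (D m) (D i) (Comp C (D m) (D (Suc i)) (D i) (q i) p) (mmap X i (Suc m) ()) =
      Comp C (x i) (D (Suc i)) (D i) (q i) (Comp C (x i) (x (Suc i)) (D (Suc i)) (c (Suc i)) (u i))"
      using p a uq[OF i] by (simp add: assoc reassoc[OF p(2)])
    then show ?case using uq[OF i] p(1) by (intro exI[of _ "Comp C (D m) (D (Suc i)) (D i) (q i) p"]) simp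
  qed
  have "is_kernel E X$$i X$$(Suc m)
        (Jmor X i (Suc m)) Y$i (\<iota> i)" if i: "1 \<le> i" "i \<le> m" for i
  proof -
    obtain p where p: "arr C (D m) (D i) p" "Comp C (x i) (D m) (D i) p (mmap X i (Suc m) ()) = c i"
      using factor i by blast
    have a: "arr C (x i) (D m) (mmap X i (Suc m) ())" "arr C (x i) (x m) (mmap X i m ())"
      using X'(2)[of i "Suc m" "()"] X'(2)[of i m "()"] i m by (simp_all add: Xx XD)
    have km: "arr E Y$m J$(x m) (\<iota> m)"
      "Comp E Y$m J$(x m) J$(D m) (mmap J (x m) (D m) (c m)) (\<iota> m) = Null E Y$m J$(D m)"
      using E.kernelD(2,3)[OF k[OF m order_refl] J(2)[OF cm]] by simp_all
    have ki: "arr E Y$i J$(x i) (\<iota> i)"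
      using E.kernelD(2)[OF k[OF i] J(2)[OF c[OF i]]] .
    have nat: "Comp E Y$i J$(x i) J$(x m) (mmap J (x i) (x m) (mmap X i m ())) (\<iota> i) =
      Comp E Y$i Y$m J$(x m) (\<iota> m) (mmap Y i m ())"
      using arr_chain_diagramD(5)[OF \<iota>, of i m "()"] i m by (simp add: Xx)
    have "mmap X i (Suc m) () = Comp C (x i) (x m) (D m) (c m) (mmap X i m ())"
      using X'(4)[of i m "Suc m" "()" "()" "()"] i m by (simp add: Xx XD Xc)
    then have "Comp E Y$i J$(x i) J$(D m) (mmap J (x i) (D m) (mmap X i (Suc m) ())) (\<iota> i)
      = Null E Y$i J$(D m)"
      using J(1)[of "D m"] arrD(2)[OF cm] Y'(2)[of i m "()"] i m
      by (simp add: J(4)[OF a(2) cm] E.assoc[OF ki J(2)[OF a(2)] J(2)[OF cm]] nat E.reassoc[OF km(2) km(1) J(2)[OF cm]])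
    moreover have "Comp E J$(x i) J$(D m) J$(D i) (mmap J (D m) (D i) p)
      (mmap J (x i) (D m) (mmap X i (Suc m) ())) = mmap J (x i) (D i) (c i)"
      using p(2) J(4)[OF a(1) p(1)] by simp
    ultimately show ?thesis
      unfolding Xx[OF i] XD
      by (intro kernel_of_left_factor[OF k[OF i] J(2)[OF c[OF i]] J(2)[OF a(1)] J(2)[OF p(1)]])
  qed
  then have "kernel_system m X Y \<iota>" using X(1) \<iota> by (simp add: kernel_system_def)
  then show thesis by (rule that)
qed

section \<open>The ideals generated by split diagrams\<close>

lemma split_diagrams_iff:
  "X \<in> split_diagrams C m \<longleftrightarrow> is_functor (chain m) C X \<and>
    (\<forall>i j. 1 \<le> i \<and> i \<le> j \<and> j \<le> m \<longrightarrow> regular X$i X$j (mmap X i j ()))"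
  using split_freyd_iff chain_functorD(2)
  unfolding split_diagrams_def diagram_category_simps mem_Collect_eq by metis

text \<open>Quasi-inverses of \<open>X\<^sub>i \<rightarrow> X\<^sub>j\<close> and \<open>Y\<^sub>i \<rightarrow> Y\<^sub>j\<close> give one for the pointwise direct sum.\<close>

lemma split_diagrams_ideal: "factoring_ideal (Diag m) (split_diagrams C m)"
proof (rule factoring_ideal.intro[OF preadditive_chain_diagrams(1)], unfold_locales)
  show "split_diagrams C m \<subseteq> Obj (Diag m)"
    by (auto simp: split_diagrams_def)
  obtain z where "z \<in> Obj C" using zero_object by (auto simp: is_zero_object_def)
  then have "mk_functor (chain m) (\<lambda>i. z) (\<lambda>i j e. Id C z) \<in> split_diagrams C m"
    unfolding split_diagrams_iff by (auto intro!: chain_functorI category_axioms regular_Id)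
  then show "split_diagrams C m \<noteq> {}" by blast
next
  fix X Y assume X: "X \<in> split_diagrams C m" and Y: "Y \<in> split_diagrams C m"
  then have XY: "is_functor (chain m) C X" "is_functor (chain m) C Y" by (simp_all add: split_diagrams_iff)
  obtain S i1 i2 p1 p2 where S: "is_direct_sum (Diag m) X Y S i1 i2 p1 p2"
    and d: "\<And>d. d \<in> Obj (chain m) \<Longrightarrow> is_direct_sum C X$d Y$d S$d (i1 d) (i2 d) (p1 d) (p2 d)"
    and e: "\<And>d d' e. arr (chain m) d d' e \<Longrightarrow> mmap S d d' e = Plus C S$d S$d'
      (Comp C S$d X$d' S$d' (i1 d') (Comp C S$d X$d X$d' (mmap X d d' e) (p1 d)))
      (Comp C S$d Y$d' S$d' (i2 d') (Comp C S$d Y$d Y$d' (mmap Y d d' e) (p2 d)))"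
    by (rule diagram_direct_sum[OF category_poset additive_category_axioms XY]) blast
  have "S \<in> split_diagrams C m"
    unfolding split_diagrams_iff
  proof (intro conjI allI impI)
    show "is_functor (chain m) C S" using is_direct_sumD(3)[OF S] by (simp add: diagram_category_simps)
    fix i j assume ij: "1 \<le> i \<and> i \<le> j \<and> j \<le> m"
    then have "arr (chain m) i j ()" by simp
    then show "regular S$i S$j (mmap S i j ())"
      unfolding e[OF \<open>arr (chain m) i j ()\<close>]
      using X Y ij by (intro regular_direct_sum[OF _ _ _ _ d d] chain_functorD(2)[OF XY(1)] chain_functorD(2)[OF XY(2)])
        (simp_all add: split_diagrams_iff)
  qed
  then show "\<exists>S\<in>split_diagrams C m. \<exists>i1 i2 p1 p2. is_direct_sum (Diag m) X Y S i1 i2 p1 p2"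
    using S by blast
qed

abbreviation JD where "JD m \<equiv> postcomp (chain m) C J"

lemma is_functor_JD: "is_functor (Diag m) (EDiag m) (JD m)"
  by (rule is_functor_postcomp[OF category_poset preadditive_axioms E.preadditive_axioms is_functor_J])

lemma additive_JD: "additive (Diag m) (EDiag m) (JD m)"
  by (rule additive_postcomp[OF category_poset preadditive_axioms additive_J])

lemma omap_JD: "is_functor (chain m) C X \<Longrightarrow> (JD m)$X = emb m X"
  by (simp add: postcomp_def diagram_category_simps)

lemma embedded_split_ideal:
  "factoring_ideal (EDiag m) (emb m ` split_diagrams C m)"
proof (rule factoring_ideal.intro[OF preadditive_chain_diagrams(2)], unfold_locales)
  interpret I: factoring_ideal "Diag m" "split_diagrams C m" by (rule split_diagrams_ideal)
  have JD: "(JD m)$X = emb m X" if "X \<in> split_diagrams C m" for X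
    using that omap_JD by (simp add: split_diagrams_iff)
  show "emb m ` split_diagrams C m \<subseteq> Obj (EDiag m)"
    using I.B_Obj is_functorD(4)[OF is_functor_JD] JD by fastforce
  show "emb m ` split_diagrams C m \<noteq> {}" using I.B_nonempty by simp
  fix X' Y' assume "X' \<in> emb m ` split_diagrams C m"
    "Y' \<in> emb m ` split_diagrams C m"
  then obtain X Y where XY: "X \<in> split_diagrams C m" "Y \<in> split_diagrams C m"
    "X' = (JD m)$X" "Y' = (JD m)$Y" using JD by auto
  obtain S i1 i2 p1 p2 where S: "S \<in> split_diagrams C m"
    "is_direct_sum (Diag m) X Y S i1 i2 p1 p2" using I.B_sum XY by blast
  then have "is_direct_sum (EDiag m) X' Y' (JD m)$S
    (mmap (JD m) X S i1) (mmap (JD m) Y S i2) (mmap (JD m) S X p1) (mmap (JD m) S Y p2)"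
    unfolding XY
    using additive_direct_sum[OF is_functor_JD additive_JD preadditive_chain_diagrams] by blast
  moreover have "(JD m)$S \<in> emb m ` split_diagrams C m" using S JD by blast
  ultimately show "\<exists>s\<in>emb m ` split_diagrams C m. \<exists>i1 i2 p1 p2.
      is_direct_sum (EDiag m) X' Y' s i1 i2 p1 p2" by blast
qed

text \<open>
  As \<open>S\<^sub>i \<rightarrow> S\<^sub>m\<^sub>+\<^sub>1\<close> is regular, \<open>K\<^sub>i\<close> is the image of an idempotent \<open>e\<^sub>i\<close> of \<open>S\<^sub>i\<close>. It need not belong to
  \<open>C\<close>, so let \<open>V\<close> have the objects \<open>S\<^sub>i\<close>, and the maps of \<open>S\<close> preceded by \<open>e\<^sub>i\<close>: these agree with the
  maps of \<open>K\<close> on \<open>K\<^sub>i\<close> and vanish on its complement. A quasi-inverse of \<open>S\<^sub>i \<rightarrow> S\<^sub>j\<close> is also one of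
  \<open>V\<^sub>i \<rightarrow> V\<^sub>j\<close>.
\<close>

lemma split_kernel_retract:
  assumes S: "S \<in> split_diagrams C (Suc m)" and K: "kernel_system m S K \<iota>"
  obtains V \<beta> where "V \<in> split_diagrams C m"
    "arr (EDiag m) K (emb m V) \<iota>"
    "arr (EDiag m) (emb m V) K \<beta>"
    "Comp (EDiag m) K (emb m V) K \<beta> \<iota>
      = Id (EDiag m) K"
proof -
  note k = kernel_systemD[OF K]
  note X = chain_functorD[OF k(1)] and K' = chain_functorD[OF k(2)]
  let ?n = "Suc m"
  have "\<forall>i. \<exists>g. 1 \<le> i \<longrightarrow> i \<le> m \<longrightarrow> arr C S$?n S$i g \<and>
      Comp C S$i S$?n S$?n (Comp C S$?n S$i S$?n (mmap S i ?n ()) g) (mmap S i ?n ()) = mmap S i ?n ()"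
    using S by (auto simp: split_diagrams_iff regular_def)
  then obtain g where g: "\<And>i. \<lbrakk>1 \<le> i; i \<le> m\<rbrakk> \<Longrightarrow> arr C S$?n S$i (g i)"
    and sgs: "\<And>i. \<lbrakk>1 \<le> i; i \<le> m\<rbrakk> \<Longrightarrow> Comp C S$i S$?n S$?n
      (Comp C S$?n S$i S$?n (mmap S i ?n ()) (g i)) (mmap S i ?n ()) = mmap S i ?n ()" by metis
  define e where "e i = Plus C S$i S$i (Id C S$i)
    (Neg C S$i S$i (Comp C S$i S$?n S$i (g i) (mmap S i ?n ())))" for i
  have s: "arr C S$i S$?n (mmap S i ?n ())" if "1 \<le> i" "i \<le> m" for i using X(2) that by simp
  have e: "arr C S$i S$i (e i)" if "1 \<le> i" "i \<le> m" for i
    using g[OF that] s[OF that] arrD[OF s[OF that]] by (simp add: e_def)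
  have se: "Comp C S$i S$i S$?n (mmap S i ?n ()) (e i) = Null C S$i S$?n"
    if "1 \<le> i" "i \<le> m" for i
  proof -
    note [simp] = g[OF that] s[OF that] arrD(1,2)[OF s[OF that]]
    have "Comp C S$i S$i S$?n (mmap S i ?n ())
      (Comp C S$i S$?n S$i (g i) (mmap S i ?n ())) = mmap S i ?n ()"
      using sgs[OF that] by (simp add: assoc)
    then show ?thesis by (simp add: e_def)
  qed
  have ea: "Comp C c S$i S$i (e i) h = h"
    if i: "1 \<le> i" "i \<le> m" and h: "arr C c S$i h" "Comp C c S$i S$?n (mmap S i ?n ()) h = Null C c S$?n"
    for i c h
    using g[OF i] s[OF i] arrD(1,2)[OF s[OF i]] h arrD(1)[OF h(1)] by (simp add: e_def assoc)
  have tr: "arr C S$i S$j (mmap S i j ())" if "1 \<le> i" "i \<le> j" "j \<le> m" for i j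
    using X(2)[of i j "()"] that by simp
  have kill: "Comp C S$i S$j S$?n (mmap S j ?n ()) (Comp C S$i S$i S$j (mmap S i j ()) (e i))
      = Null C S$i S$?n" if "1 \<le> i" "i \<le> j" "j \<le> m" for i j
  proof -
    have "Comp C S$i S$j S$?n (mmap S j ?n ()) (mmap S i j ()) = mmap S i ?n ()"
      using X(4)[of i j ?n] that by simp
    from reassoc[OF this tr[OF that] s e] show ?thesis using that se by simp
  qed
  define v where "v i j = (if i = j then Id C S$i else Comp C S$i S$i S$j (mmap S i j ()) (e i))" for i j
  have v: "arr C S$i S$j (v i j)" if "1 \<le> i" "i \<le> j" "j \<le> m" for i j
    using that X(1) tr[OF that] e[of i] by (simp add: v_def)
  have vI: "v i i = Id C S$i" for i by (simp add: v_def)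
  define V where "V = mk_functor (chain m) (omap S) (\<lambda>i j _. v i j)"
  have V: "is_functor (chain m) C V" unfolding V_def
  proof (rule chain_functorI[OF category_axioms])
    show "v i k = Comp C S$i S$j S$k (v j k) (v i j)"
      if ijk: "1 \<le> i" "i \<le> j" "j \<le> k" "k \<le> m" for i j k
    proof (cases "i = j \<or> j = k")
      case True
      then show ?thesis using v[of i k] ijk by (auto simp: vI)
    next
      case False
      have "Comp C S$i S$j S$k (v j k) (v i j)
        = Comp C S$i S$j S$k (mmap S j k ())
          (Comp C S$i S$j S$j (e j) (Comp C S$i S$i S$j (mmap S i j ()) (e i)))"
        using False ijk tr[of i j] tr[of j k] e[of i] e[of j] by (simp add: v_def assoc)
      also have "\<dots> = Comp C S$i S$j S$k (mmap S j k ()) (Comp C S$i S$i S$j (mmap S i j ()) (e i))"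
        using ijk tr[of i j] e[of i] by (subst ea[OF _ _ _ kill]) simp_all
      also have "\<dots> = Comp C S$i S$i S$k (mmap S i k ()) (e i)"
        using ijk tr[of i j] tr[of j k] e[of i] X(4)[of i j k] by (subst reassoc[of _ _ _ _ _ "mmap S i k ()"]) simp_all
      finally show ?thesis using False ijk by (simp add: v_def)
    qed
  qed (use X v in \<open>simp_all add: v_def\<close>)
  have Vo: "V$i = S$i" if "1 \<le> i" "i \<le> m" for i using that by (simp add: V_def)
  have Vm: "mmap V i j () = v i j" if "1 \<le> i" "i \<le> j" "j \<le> m" for i j using that by (simp add: V_def)
  have Vsplit: "V \<in> split_diagrams C m" unfolding split_diagrams_iff
  proof (intro conjI allI impI)
    fix i j assume "1 \<le> i \<and> i \<le> j \<and> j \<le> m"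
    then have ij: "1 \<le> i" "i \<le> j" "j \<le> m" "i \<le> m" "1 \<le> j" by auto
    show "regular V$i V$j (mmap V i j ())"
    proof (cases "i = j")
      case True
      then show ?thesis using ij X(1)[of i] by (simp add: Vo Vm v_def regular_Id)
    next
      case False
      have "regular S$i S$j (mmap S i j ())"
        using S ij(1,2) le_SucI[OF ij(3)] unfolding split_diagrams_iff by blast
      then obtain h where h: "arr C S$j S$i h"
        "Comp C S$i S$j S$j (Comp C S$j S$i S$j (mmap S i j ()) h) (mmap S i j ()) = mmap S i j ()"
        by (auto simp: regular_def)
      note [simp] = h(1) tr[OF ij(1-3)] e[OF ij(1,4)] s[OF ij(1,4)] s[OF ij(5,3)]
      let ?h = "Comp C S$i S$j S$i h (Comp C S$i S$i S$j (mmap S i j ()) (e i))"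
      have shs: "Comp C S$i S$i S$j (mmap S i j ()) ?h = Comp C S$i S$i S$j (mmap S i j ()) (e i)"
        using reassoc[OF h(2), of "S$i" "e i"] by (simp add: assoc)
      \<comment> \<open>\<open>h \<circ> v i j\<close> has values in \<open>K\<^sub>i\<close>, because \<open>v i j\<close> has values in \<open>K\<^sub>j\<close>.\<close>
      have c: "Comp C S$i S$j S$?n (mmap S j ?n ()) (mmap S i j ()) = mmap S i ?n ()"
        using X(4)[of i j ?n] ij by simp
      have "Comp C S$i S$i S$?n (mmap S i ?n ()) ?h =
        Comp C S$i S$j S$?n (mmap S j ?n ()) (Comp C S$i S$i S$j (mmap S i j ()) ?h)"
        by (rule reassoc[OF c, symmetric]) simp_all
      also have "\<dots> = Null C S$i S$?n" unfolding shs by (rule kill[OF ij(1-3)])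
      finally have "Comp C S$i S$i S$i (e i) ?h = ?h" by (intro ea ij) simp_all
      then have "Comp C S$i S$j S$j (Comp C S$j S$i S$j (v i j) h) (v i j) = v i j"
        using False shs by (simp add: v_def assoc)
      then have "regular S$i S$j (v i j)" unfolding regular_def using h(1) by blast
      then show ?thesis using ij by (simp add: Vo Vm)
    qed
  qed (rule V)
  have JV: "is_functor (chain m) E (emb m V)"
    by (rule is_functor_comp[OF V is_functor_J])
  have Je: "Comp E K$i S$$i S$$i (mmap J S$i S$i (e i)) (\<iota> i) = \<iota> i"
    if i: "1 \<le> i" "i \<le> m" for i
  proof -
    note [simp] = g[OF i] s[OF i] arrD(1,2)[OF s[OF i]] k(3)[OF i] J(1,2) K'(1)[OF i]
    have "mmap J S$i S$i (e i) = Plus E S$$i S$$i (Id E S$$i)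
      (Comp E S$$i S$$?n S$$i
        (mmap J S$?n S$i (Neg C S$?n S$i (g i))) (Jmor S i ?n))"
      by (simp add: e_def J_Plus J(3) flip: J(4))
    moreover have "arr E S$$?n S$$i (mmap J S$?n S$i (Neg C S$?n S$i (g i)))"
      by (rule J(2)) simp
    ultimately show ?thesis by (simp add: E.assoc k(5)[OF i])
  qed
  have "\<exists>b. arr E S$$i K$i b \<and>
    Comp E S$$i K$i S$$i (\<iota> i) b = mmap J S$i S$i (e i)"
    if i: "1 \<le> i" "i \<le> m" for i
    by (rule k(8)[OF i e[OF i] se[OF i]])
  then obtain b where b: "\<And>i. \<lbrakk>1 \<le> i; i \<le> m\<rbrakk> \<Longrightarrow> arr E S$$i K$i (b i)"
    "\<And>i. \<lbrakk>1 \<le> i; i \<le> m\<rbrakk> \<Longrightarrow> Comp E S$$i K$i S$$i (\<iota> i) (b i) = mmap J S$i S$i (e i)"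
    by metis
  let ?b = "\<lambda>i\<in>{1..m}. b i"
  have \<iota>V: "arr (EDiag m) K (emb m V) \<iota>"
  proof (rule arr_chain_diagramI[OF k(2) JV])
    show "\<iota> \<in> extensional {1..m}" using K arr_chain_diagramD(3) by (auto simp: kernel_system_def)
    show "arr E K$i (emb m V)$i (\<iota> i)" if "1 \<le> i" "i \<le> m" for i
      using k(3)[OF that] that by (simp add: Vo)
    fix i j assume "1 \<le> i" "i < j" "j \<le> m"
    then have ij: "1 \<le> i" "i \<le> j" "j \<le> m" "i \<le> m" "1 \<le> j" "i \<noteq> j" by auto
    have "Comp E K$i S$$i S$$j (mmap J S$i S$j (v i j)) (\<iota> i)
      = Comp E K$i S$$i S$$j (Jmor S i j) (\<iota> i)"
      using ij k(3)[OF ij(1,4)] by (simp add: v_def J(4)[OF e[OF ij(1,4)] tr[OF ij(1-3)]] E.assoc J(2) e tr Je)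
    then show "Comp E K$i (emb m V)$i (emb m V)$j
        (mmap (emb m V) i j ()) (\<iota> i) =
      Comp E K$i K$j (emb m V)$j (\<iota> j) (mmap K i j ())"
      using ij k(4)[OF ij(1-3)] by (simp add: Vo Vm)
  qed
  have bV: "arr (EDiag m) (emb m V) K ?b"
  proof (rule arr_chain_diagramI[OF JV k(2)])
    show "arr E (emb m V)$i K$i (?b i)" if "1 \<le> i" "i \<le> m" for i
      using b(1)[OF that] that by (simp add: Vo)
    fix i j assume "1 \<le> i" "i < j" "j \<le> m"
    then have ij: "1 \<le> i" "i \<le> j" "j \<le> m" "i \<le> m" "1 \<le> j" "i \<noteq> j" by auto
    note [simp] = k(3)[OF ij(1,4)] k(3)[OF ij(5,3)] b(1)[OF ij(1,4)] b(1)[OF ij(5,3)] K'(2)[OF ij(1-3)]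
      J(2)[OF v[OF ij(1-3)]] J(2)[OF tr[OF ij(1-3)]] tr[OF ij(1-3)] e[OF ij(1,4)] e[OF ij(5,3)] J(2)
    have "Comp E S$$i K$i K$j (mmap K i j ()) (b i) =
      Comp E S$$i S$$j K$j (b j) (mmap J S$i S$j (v i j))"
    proof (rule k(7)[OF ij(5,3)])
      have "Comp E S$$i K$j S$$j (\<iota> j)
          (Comp E S$$i K$i K$j (mmap K i j ()) (b i)) =
        mmap J S$i S$j (Comp C S$i S$i S$j (mmap S i j ()) (e i))"
        by (simp add: E.reassoc[OF k(4)[OF ij(1-3), symmetric]] E.assoc b(2)[OF ij(1,4)] J(4))
      also have "\<dots> = mmap J S$i S$j (Comp C S$i S$j S$j (e j) (v i j))"
        using ij by (simp add: v_def ea[OF ij(5,3) _ kill[OF ij(1-3)]])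
      also have "\<dots> = Comp E S$$i K$j S$$j (\<iota> j)
          (Comp E S$$i S$$j K$j (b j) (mmap J S$i S$j (v i j)))"
        using v[OF ij(1-3)] by (simp add: E.reassoc[OF b(2)[OF ij(5,3)]] J(4))
      finally show "Comp E S$$i K$j S$$j (\<iota> j)
          (Comp E S$$i K$i K$j (mmap K i j ()) (b i)) =
        Comp E S$$i K$j S$$j (\<iota> j)
          (Comp E S$$i S$$j K$j (b j) (mmap J S$i S$j (v i j)))" .
    qed simp_all
    then show "Comp E (emb m V)$i K$i K$j (mmap K i j ()) (?b i) =
      Comp E (emb m V)$i (emb m V)$j K$j (?b j)
        (mmap (emb m V) i j ())"
      using ij by (simp add: Vo Vm)
  qed simp
  interpret DE: preadditive "EDiag m" by (rule preadditive_chain_diagrams)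
  have "Comp (EDiag m) K (emb m V) K ?b \<iota>
      = Id (EDiag m) K"
  proof (rule kernel_system_arr_eqI[OF K])
    show "arr (EDiag m) K K (Id (EDiag m) K)"
      using arrD(1)[OF \<iota>V] by simp
    fix i assume i: "1 \<le> i" "i \<le> m"
    show "Comp E K$i K$i S$$i (\<iota> i)
        (Comp (EDiag m) K (emb m V) K ?b \<iota> i) =
      Comp E K$i K$i S$$i (\<iota> i) (Id (EDiag m) K i)"
      using i k(3)[OF i] b(1)[OF i] by (simp add: diagram_category_simps Vo E.reassoc[OF b(2)[OF i]] Je)
  qed (use bV \<iota>V in simp)
  then show thesis using that Vsplit \<iota>V bV by blast
qed

text \<open>
  If \<open>r\<close> kills the kernels of \<open>X\<^sub>i \<rightarrow> X\<^sub>n\<close>, then it is a sum of morphisms that factor over diagrams of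
  the form \<open>0 \<rightarrow> \<dots> \<rightarrow> 0 \<rightarrow> Y\<^sub>j = \<dots> = Y\<^sub>j\<close>. For minimal \<open>j\<close> with \<open>r\<^sub>j \<noteq> 0\<close>, extend \<open>r\<^sub>j\<close> to
  \<open>w : X\<^sub>n \<rightarrow> Y\<^sub>j\<close> and subtract the morphism \<open>X\<^sub>i \<rightarrow> X\<^sub>n \<rightarrow> Y\<^sub>j \<rightarrow> Y\<^sub>i\<close> for \<open>i \<ge> j\<close>. Zero objects are
  avoided by using \<open>Y\<^sub>j\<close> with zero morphisms in the places below \<open>j\<close>.
\<close>

lemma kernel_killing_factors:
  assumes r: "arr (Diag n) X Y r" and n: "1 \<le> n"
    and kill: "\<And>i s \<alpha>. \<lbrakk>1 \<le> i; i \<le> n; arr C s X$i \<alpha>;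
        Comp C s X$i X$n (mmap X i n ()) \<alpha> = Null C s X$n\<rbrakk>
      \<Longrightarrow> Comp C s X$i Y$i (r i) \<alpha> = Null C s Y$i"
  shows "r \<in> factoring (Diag n) (split_diagrams C n) X Y"
proof -
  let ?D = "Diag n"
  interpret I: factoring_ideal ?D "split_diagrams C n" by (rule split_diagrams_ideal)
  note X = chain_functorD[OF arr_chain_diagramD(1)[OF r]] and Y = chain_functorD[OF arr_chain_diagramD(2)[OF r]]
  define kills where "kills r \<longleftrightarrow> (\<forall>i s \<alpha>. 1 \<le> i \<longrightarrow> i \<le> n \<longrightarrow> arr C s X$i \<alpha> \<longrightarrow>
        Comp C s X$i X$n (mmap X i n ()) \<alpha> = Null C s X$n
      \<longrightarrow> Comp C s X$i Y$i (r i) \<alpha> = Null C s Y$i)" for r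
  have o: "X \<in> Obj ?D" "Y \<in> Obj ?D" using arrD[OF r] by simp_all
  have "\<exists>q\<in>factoring ?D (split_diagrams C n) X Y. \<exists>r'. arr ?D X Y r' \<and> r = Plus ?D X Y q r' \<and> kills r' \<and>
      (\<forall>i. 1 \<le> i \<longrightarrow> i \<le> j \<longrightarrow> r' i = Null C X$i Y$i)" if "j \<le> n" for j
    using that
  proof (induction j)
    case 0
    have "kills r" unfolding kills_def using kill by blast
    then show ?case using r o by (intro bexI[of _ "Null ?D X Y"] exI[of _ r]) (simp_all add: I.factoring_Null)
  next
    case (Suc j)
    then obtain q r' where q: "q \<in> factoring ?D (split_diagrams C n) X Y" and r': "arr ?D X Y r'"
      and rq: "r = Plus ?D X Y q r'" and k: "kills r'"
      and 0: "\<And>i. \<lbrakk>1 \<le> i; i \<le> j\<rbrakk> \<Longrightarrow> r' i = Null C X$i Y$i" by auto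
    note ar = arr_chain_diagramD[OF r']
    let ?j = "Suc j"
    have j: "1 \<le> ?j" "?j \<le> n" using Suc by simp_all
    have p: "arr C X$?j X$n (mmap X ?j n ())" using X(2) j by simp
    obtain w where w: "arr C X$n Y$?j w" "Comp C X$?j X$n Y$?j w (mmap X ?j n ()) = r' ?j"
      by (rule factor_through[OF p ar(4)[OF j]]) (use k j in \<open>auto simp: kills_def\<close>)
    define W where "W = mk_functor (chain n) (\<lambda>i. Y$?j)
      (\<lambda>i k _. if i = k \<or> ?j \<le> i then Id C Y$?j else Null C Y$?j Y$?j)"
    have Yj [simp]: "Y$?j \<in> Obj C" using Y(1) j by simp
    have WF: "is_functor (chain n) C W" unfolding W_def
      by (rule chain_functorI[OF category_axioms]) auto
    have Wo: "W$i = Y$?j" if "1 \<le> i" "i \<le> n" for i using that by (simp add: W_def)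
    have Wm: "mmap W i k () = (if i = k \<or> ?j \<le> i then Id C Y$?j else Null C Y$?j Y$?j)"
      if "1 \<le> i" "i \<le> k" "k \<le> n" for i k using that by (simp add: W_def)
    have W: "W \<in> split_diagrams C n"
      using WF by (auto simp: split_diagrams_iff Wo Wm regular_Id regular_Null)
    define g where "g = (\<lambda>i\<in>{1..n}. Comp C X$i X$n Y$?j w (mmap X i n ()))"
    define h where "h = (\<lambda>i\<in>{1..n}. if ?j \<le> i then mmap Y ?j i () else Null C Y$?j Y$i)"
    have wX: "Comp C X$i X$n Y$?j w (mmap X i n ()) = Null C X$i Y$?j"
      if i: "1 \<le> i" "i \<le> j" for i
    proof -
      have a: "arr C X$i X$?j (mmap X i ?j ())" "arr C Y$i Y$?j (mmap Y i ?j ())"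
        using X(2) Y(2) i j by simp_all
      have "mmap X i n () = Comp C X$i X$?j X$n (mmap X ?j n ()) (mmap X i ?j ())"
        using X(4)[of i ?j n "()" "()" "()"] i j by simp
      then have "Comp C X$i X$n Y$?j w (mmap X i n ()) =
        Comp C X$i X$?j Y$?j (r' ?j) (mmap X i ?j ())"
        using reassoc[OF w(2) p w(1) a(1)] by simp
      also have "\<dots> = Comp C X$i Y$i Y$?j (mmap Y i ?j ()) (r' i)"
        using ar(5)[of i ?j "()"] i j by simp
      also have "\<dots> = Null C X$i Y$?j" using 0[OF i] a(2) X(1)[of i] i j by simp
      finally show ?thesis .
    qed
    have ga: "arr C X$i Y$?j (Comp C X$i X$n Y$?j w (mmap X i n ()))"
      if "1 \<le> i" "i \<le> n" for i using X(2)[of i n "()"] w(1) that by simp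
    have g: "arr ?D X W g"
    proof (rule arr_chain_diagramI[OF ar(1) WF])
      fix i k assume ik: "1 \<le> i" "i < k" "k \<le> n"
      then have ik': "i \<le> n" "1 \<le> k" "i \<le> k" by simp_all
      have kn: "arr C X$k X$n (mmap X k n ())" "arr C X$i X$k (mmap X i k ())" using X(2) ik by simp_all
      have c: "Comp C X$i X$k X$n (mmap X k n ()) (mmap X i k ()) = mmap X i n ()"
        using X(4)[of i k n "()" "()" "()"] ik by simp
      have eq: "Comp C X$i X$k Y$?j (Comp C X$k X$n Y$?j w (mmap X k n ())) (mmap X i k ())
        = Comp C X$i X$n Y$?j w (mmap X i n ())"
        using kn w(1) c by (simp add: assoc)
      have "Comp C X$i Y$?j Y$?j (mmap W i k ()) (Comp C X$i X$n Y$?j w (mmap X i n ()))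
        = Comp C X$i X$n Y$?j w (mmap X i n ())"
      proof (cases "?j \<le> i")
        case True
        then show ?thesis using ik ik' ga[OF ik(1) ik'(1)] by (simp add: Wm)
      next
        case False
        then show ?thesis using ik ik' wX[of i] X(1)[of i] by (simp add: Wm)
      qed
      then show "Comp C X$i W$i W$k (mmap W i k ()) (g i) = Comp C X$i X$k W$k (g k) (mmap X i k ())"
        using ik ik' eq by (simp add: g_def Wo)
    qed (use ga Wo in \<open>auto simp: g_def\<close>)
    have h: "arr ?D W Y h"
    proof (rule arr_chain_diagramI[OF WF ar(2)])
      show "arr C W$i Y$i (h i)" if "1 \<le> i" "i \<le> n" for i
        using that Y(1)[of i] Y(2)[of ?j i "()"] j by (simp add: h_def Wo)
      fix i k assume ik: "1 \<le> i" "i < k" "k \<le> n"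
      then have ik': "i \<le> n" "1 \<le> k" "i \<le> k" by simp_all
      have y: "arr C Y$i Y$k (mmap Y i k ())" using Y(2) ik by simp
      show "Comp C W$i Y$i Y$k (mmap Y i k ()) (h i) = Comp C W$i W$k Y$k (h k) (mmap W i k ())"
      proof (cases "?j \<le> i")
        case True
        then show ?thesis using ik ik' j Y(2)[of ?j k "()"] Y(4)[of ?j i k "()" "()" "()"] by (simp add: h_def Wo Wm)
      next
        case False
        then show ?thesis using ik ik' j y Y(1)[of k] Y(2)[of ?j k "()"] by (auto simp: h_def Wo Wm)
      qed
    qed (simp add: h_def)
    let ?q = "Comp ?D X W Y h g"
    have q': "?q \<in> factoring ?D (split_diagrams C n) X Y" by (rule factoringI[OF W g h])
    have qa: "arr ?D X Y ?q" using g h by simp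
    have qi: "?q i = Comp C X$i Y$?j Y$i (h i) (Comp C X$i X$n Y$?j w (mmap X i n ()))"
      if "1 \<le> i" "i \<le> n" for i using that by (simp add: diagram_category_simps Wo g_def)
    let ?r = "Plus ?D X Y r' (Neg ?D X Y ?q)"
    have ra: "arr ?D X Y ?r" using r' qa by simp
    have ri: "?r i = Plus C X$i Y$i (r' i) (Neg C X$i Y$i (?q i))" if "1 \<le> i" "i \<le> n" for i
      using that diagram_Neg[OF category_poset preadditive_axioms qa, of i] by (simp add: diagram_category_simps)
    have "arr ?D X Y q" using I.factoring_arr[OF q o] .
    then have "r = Plus ?D X Y (Plus ?D X Y q ?q) ?r"
      using qa r' by (simp add: rq I.Plus_assoc I.Plus_lcomm[of X Y ?q r'])
    moreover have "Plus ?D X Y q ?q \<in> factoring ?D (split_diagrams C n) X Y" by (rule I.factoring_Plus[OF q q' o])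
    moreover have "kills ?r" unfolding kills_def
    proof (intro allI impI)
      fix i s \<alpha> assume i: "1 \<le> i" "i \<le> n" and \<alpha>: "arr C s X$i \<alpha>"
        "Comp C s X$i X$n (mmap X i n ()) \<alpha> = Null C s X$n"
      have hi: "arr C Y$?j Y$i (h i)" using arr_chain_diagramD(4)[OF h i] i by (simp add: Wo)
      note [simp] = \<alpha>(1) arrD(1)[OF \<alpha>(1)] hi ga[OF i] ar(4)[OF i] Y(1)[OF i] w(1) X(2)[OF i(1,2) order_refl, of "()"]
      have "Comp C s X$i Y$i (?q i) \<alpha> = Null C s Y$i"
        by (simp add: qi[OF i] assoc \<alpha>(2))
      moreover have "Comp C s X$i Y$i (r' i) \<alpha> = Null C s Y$i"
        using k i \<alpha> by (simp add: kills_def)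
      moreover have "arr C X$i Y$i (?q i)" by (simp add: qi[OF i])
      ultimately show "Comp C s X$i Y$i (?r i) \<alpha> = Null C s Y$i"
        by (simp add: ri[OF i])
    qed
    moreover have "?r i = Null C X$i Y$i" if "1 \<le> i" "i \<le> ?j" for i
    proof (cases "i = ?j")
      case True
      have i: "1 \<le> i" "i \<le> n" using that j by simp_all
      have "?q i = r' i"
        unfolding qi[OF i] using j w(2) ar(4)[OF j] Y(3)[OF j] by (simp add: True h_def)
      then show ?thesis using ar(4)[OF i] by (simp add: ri[OF i])
    next
      case False
      then have i: "1 \<le> i" "i \<le> n" "i \<le> j" "\<not> ?j \<le> i" using that j by simp_all
      have "?q i = Null C X$i Y$i"
        unfolding qi[OF i(1,2)] using i ga[OF i(1,2)] Y(1)[OF i(1,2)] by (simp add: h_def)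
      then show ?thesis using ar(4)[OF i(1,2)] X(1)[OF i(1,2)] Y(1)[OF i(1,2)] 0[OF i(1,3)] by (simp add: ri[OF i(1,2)])
    qed
    ultimately show ?case using ra by blast
  qed
  from this[OF order_refl] obtain q r' where q: "q \<in> factoring ?D (split_diagrams C n) X Y" and r': "arr ?D X Y r'"
    "r = Plus ?D X Y q r'" and 0: "\<And>i. \<lbrakk>1 \<le> i; i \<le> n\<rbrakk> \<Longrightarrow> r' i = Null C X$i Y$i" by auto
  have "r' = Null ?D X Y"
    by (rule diagram_eqI[OF r'(1) I.arr_Null[OF o]]) (simp add: 0 diagram_category_simps)
  then show ?thesis using q r' I.factoring_arr[OF q o] by simp
qed

end

section \<open>The kernel functor\<close>

lemma (in preadditive) kernel_map_characterisation:
  assumes ker: "kernel_choice C ker" and f: "arr C x y f" and f': "arr C x' y' f'" and v: "arr C x x' v"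
    and 0: "Comp C (fst (ker x y f)) x' y' f' (Comp C (fst (ker x y f)) x x' v (snd (ker x y f)))
      = Null C (fst (ker x y f)) y'"
  shows "arr C (fst (ker x y f)) (fst (ker x' y' f')) (kernel_map C ker x y f x' y' f' v)"
    "Comp C (fst (ker x y f)) (fst (ker x' y' f')) x' (snd (ker x' y' f')) (kernel_map C ker x y f x' y' f' v)
      = Comp C (fst (ker x y f)) x x' v (snd (ker x y f))"
proof -
  have k: "is_kernel C x y f (fst (ker x y f)) (snd (ker x y f))"
    and k': "is_kernel C x' y' f' (fst (ker x' y' f')) (snd (ker x' y' f'))"
    using ker f f' by (simp_all add: kernel_choice_def arr_def)
  note kD = kernelD[OF k f] and kD' = kernelD[OF k' f']
  have "arr C (fst (ker x y f)) x' (Comp C (fst (ker x y f)) x x' v (snd (ker x y f)))"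
    using kD v by simp
  then have "\<exists>!u. u \<in> Hom C (fst (ker x y f)) (fst (ker x' y' f')) \<and>
      Comp C (fst (ker x y f)) (fst (ker x' y' f')) x' (snd (ker x' y' f')) u
        = Comp C (fst (ker x y f)) x x' v (snd (ker x y f))"
    using k' 0 by (auto simp: is_kernel_def arr_def)
  from theI'[OF this] show
    "arr C (fst (ker x y f)) (fst (ker x' y' f')) (kernel_map C ker x y f x' y' f' v)"
    "Comp C (fst (ker x y f)) (fst (ker x' y' f')) x' (snd (ker x' y' f')) (kernel_map C ker x y f x' y' f' v)
      = Comp C (fst (ker x y f)) x x' v (snd (ker x y f))"
    using kD(1) kD'(1) by (simp_all add: kernel_map_def arr_def)
qed

context weakly_abelian_category
begin

context
  fixes ker and m :: nat
  assumes ker: "kernel_choice E ker"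
begin

abbreviation Ker where
  "Ker X \<equiv> kernel_diagram E ker (Suc m) (emb (Suc m) X)"

abbreviation Ker_map where
  "Ker_map X Y t \<equiv> kernel_diagram_map E ker (Suc m) (emb (Suc m) X)
     (emb (Suc m) Y) (\<lambda>i. mmap J X$i Y$i (t i))"

definition incl where
  "incl X = (\<lambda>i\<in>{1..m}. snd (ker X$$i X$$(Suc m)
     (Jmor X i (Suc m))))"

lemma kernel_system_Ker:
  assumes X: "is_functor (chain (Suc m)) C X"
  shows "kernel_system m X (Ker X) (incl X)"
proof -
  note X' = chain_functorD[OF X]
  define k where "k i = fst (ker X$$i X$$(Suc m)
     (Jmor X i (Suc m)))" for i
  define f where "f i j = Jmor X i j" for i j
  define u where "u i j = kernel_map E ker X$$i X$$(Suc m) (f i (Suc m))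
    X$$j X$$(Suc m) (f j (Suc m)) (f i j)" for i j
  have Ker: "Ker X = mk_functor (chain m) k (\<lambda>i j _. u i j)"
    unfolding kernel_diagram_def diff_Suc_1 by (rule mk_functor_cong) (auto simp: k_def u_def f_def)
  have f: "arr E X$$i X$$j (f i j)" if "1 \<le> i" "i \<le> j" "j \<le> Suc m" for i j
    using that X'(2) J(2) by (simp add: f_def)
  have ff: "Comp E X$$i X$$j X$$l (f j l) (f i j) = f i l"
    if "1 \<le> i" "i \<le> j" "j \<le> l" "l \<le> Suc m" for i j l
    using that X'(2)[of i j "()"] X'(2)[of j l "()"] X'(4)[of i j l "()" "()" "()"] by (simp add: f_def flip: J(4))
  have ik: "is_kernel E X$$i X$$(Suc m) (f i (Suc m)) (k i) (incl X i)"
    if "1 \<le> i" "i \<le> m" for i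
    using ker that f[of i "Suc m"] unfolding kernel_choice_def k_def incl_def f_def arr_def by simp
  have fn: "arr E X$$i X$$(Suc m) (f i (Suc m))" if "1 \<le> i" "i \<le> m" for i
    using f that by simp
  note kD = E.kernelD[OF ik fn]
  have u: "arr E (k i) (k j) (u i j)"
    "Comp E (k i) (k j) X$$j (incl X j) (u i j) = Comp E (k i) X$$i X$$j (f i j) (incl X i)"
    if ij: "1 \<le> i" "i \<le> j" "j \<le> m" for i j
  proof -
    have i: "1 \<le> i" "i \<le> m" and j: "1 \<le> j" "j \<le> m" and j': "j \<le> Suc m" using ij by simp_all
    have "Comp E (k i) X$$j X$$(Suc m) (f j (Suc m))
        (Comp E (k i) X$$i X$$j (f i j) (incl X i)) = Null E (k i) X$$(Suc m)"
      using kD(2,3)[OF i i] by (simp add: E.reassoc[OF ff[OF ij(1,2) j' order_refl] f[OF ij(1,2) j'] fn[OF j]])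
    then show "arr E (k i) (k j) (u i j)"
      "Comp E (k i) (k j) X$$j (incl X j) (u i j) = Comp E (k i) X$$i X$$j (f i j) (incl X i)"
      using E.kernel_map_characterisation[OF ker fn[OF i] fn[OF j] f[OF ij(1,2) j']] i j
      by (simp_all add: k_def incl_def u_def f_def)
  qed
  have K: "is_functor (chain m) E (Ker X)" unfolding Ker
  proof (rule chain_functorI[OF E.category_axioms])
    show "k i \<in> Obj E" if "1 \<le> i" "i \<le> m" for i using kD(1) that by blast
    show "arr E (k i) (k j) (u i j)" if "1 \<le> i" "i \<le> j" "j \<le> m" for i j using u that by blast
    show "u i i = Id E (k i)" if i: "1 \<le> i" "i \<le> m" for i
    proof (rule kD(5)[OF i i u(1)[OF i(1) order_refl i(2)]])
      have "f i i = Id E X$$i" using X'(1,3)[of i] i J(3) by (simp add: f_def)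
      then show "Comp E (k i) (k i) X$$i (incl X i) (u i i)
        = Comp E (k i) (k i) X$$i (incl X i) (Id E (k i))"
        using u(2)[OF i(1) order_refl i(2)] kD(2)[OF i i] by simp
    qed (use kD(1)[OF i i] in simp)
    show "u i l = Comp E (k i) (k j) (k l) (u j l) (u i j)"
      if ijl: "1 \<le> i" "i \<le> j" "j \<le> l" "l \<le> m" for i j l
    proof -
      have i: "1 \<le> i" "i \<le> m" "i \<le> l" and j: "1 \<le> j" "j \<le> m" "j \<le> Suc m" and l: "1 \<le> l" "l \<le> m" "l \<le> Suc m"
        using ijl by simp_all
      note [simp] = u(1)[OF i(1,3) l(2)] u(1)[OF ijl(1,2) j(2)] u(1)[OF j(1) ijl(3,4)]
        kD(2)[OF i(1,2) i(1,2)] kD(2)[OF j(1,2) j(1,2)] kD(2)[OF l(1,2) l(1,2)]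
        f[OF ijl(1,2) j(3)] f[OF j(1) ijl(3) l(3)]
      show ?thesis
      proof (rule kD(5)[OF l(1,2) l(1,2)])
        show "Comp E (k i) (k l) X$$l (incl X l) (u i l) =
          Comp E (k i) (k l) X$$l (incl X l) (Comp E (k i) (k j) (k l) (u j l) (u i j))"
          by (simp add: E.reassoc[OF u(2)[OF j(1) ijl(3,4)]] E.assoc u(2)[OF ijl(1,2) j(2)] u(2)[OF i(1,3) l(2)]
              E.reassoc[OF ff[OF ijl(1,2,3) l(3)]])
      qed simp_all
    qed
  qed
  have ko: "(Ker X)$i = k i" if "1 \<le> i" "i \<le> m" for i using that by (simp add: Ker)
  have ku: "mmap (Ker X) i j () = u i j" if "1 \<le> i" "i \<le> j" "j \<le> m" for i j using that by (simp add: Ker)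
  have "arr (EDiag m) (Ker X) (emb m X) (incl X)"
  proof (rule arr_chain_diagramI[OF K is_functor_truncated[OF X]])
    show "incl X \<in> extensional {1..m}" by (simp add: incl_def)
    show "arr E (Ker X)$i (emb m X)$i (incl X i)" if "1 \<le> i" "i \<le> m" for i
      using kD(2)[OF that that] that by (simp add: ko)
    show "Comp E (Ker X)$i (emb m X)$i (emb m X)$j
        (mmap (emb m X) i j ()) (incl X i) =
      Comp E (Ker X)$i (Ker X)$j (emb m X)$j (incl X j) (mmap (Ker X) i j ())"
      if "1 \<le> i" "i < j" "j \<le> m" for i j
      using u(2)[of i j] that by (simp add: ko ku f_def)
  qed
  then show ?thesis using X ik by (simp add: kernel_system_def ko f_def)
qed

lemma Ker_map:
  assumes t: "arr (Diag (Suc m)) X Y t"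
  shows "arr (EDiag m) (Ker X) (Ker Y) (Ker_map X Y t)"
    and "\<lbrakk>1 \<le> i; i \<le> m\<rbrakk> \<Longrightarrow> Comp E (Ker X)$i (Ker Y)$i Y$$i (incl Y i) (Ker_map X Y t i)
      = Comp E (Ker X)$i X$$i Y$$i (mmap J X$i Y$i (t i)) (incl X i)"
proof -
  note t' = arr_chain_diagramD[OF t]
  note X = kernel_system_Ker[OF t'(1)] and Y = kernel_system_Ker[OF t'(2)]
  obtain u where u: "arr (EDiag m) (Ker X) (Ker Y) u"
    "\<And>i. \<lbrakk>1 \<le> i; i \<le> m\<rbrakk> \<Longrightarrow> Comp E (Ker X)$i (Ker Y)$i Y$$i (incl Y i) (u i)
      = Comp E (Ker X)$i X$$i Y$$i (mmap J X$i Y$i (t i)) (incl X i)"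
    by (rule kernel_system_lift[OF X Y t]) blast
  have "Ker_map X Y t i = u i" if i: "1 \<le> i" "i \<le> m" for i
  proof -
    have i': "i \<le> Suc m" using i by simp
    note [simp] = kernel_systemD(3)[OF X i] J(2)[OF t'(4)[OF i(1) i']] arr_chain_diagramD(4)[OF u(1) i]
    have o: "(Ker Z)$i = fst (ker Z$$i Z$$(Suc m) (Jmor Z i (Suc m)))"
      and s: "incl Z i = snd (ker Z$$i Z$$(Suc m) (Jmor Z i (Suc m)))" for Z
      using i by (simp_all add: kernel_diagram_def incl_def)
    have a: "arr E Z$$i Z$$(Suc m) (Jmor Z i (Suc m))" if "is_functor (chain (Suc m)) C Z" for Z
      using chain_functorD(2)[OF that i(1) i' order_refl] by (rule J(2))
    have "Comp E (Ker X)$i Y$$i Y$$(Suc m) (Jmor Y i (Suc m))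
        (Comp E (Ker X)$i X$$i Y$$i (mmap J X$i Y$i (t i)) (incl X i)) = Null E (Ker X)$i Y$$(Suc m)"
      using kernel_systemD(3)[OF Y i] a[OF t'(2)] arrD(2)[OF a[OF t'(2)]]
      by (simp add: u(2)[OF i, symmetric] E.reassoc[OF kernel_systemD(5)[OF Y i]])
    note km = E.kernel_map_characterisation[OF ker a[OF t'(1)] a[OF t'(2)] J(2)[OF t'(4)[OF i(1) i']], folded o s, OF this]
    have "kernel_map E ker X$$i X$$(Suc m) (Jmor X i (Suc m)) Y$$i Y$$(Suc m) (Jmor Y i (Suc m)) (mmap J X$i Y$i (t i)) = u i"
      by (rule kernel_systemD(7)[OF Y i km(1) arr_chain_diagramD(4)[OF u(1) i]]) (simp add: km(2) u(2)[OF i])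
    then show ?thesis using i by (simp add: kernel_diagram_map_def)
  qed
  then have "Ker_map X Y t = u"
    using arr_chain_diagramD(3)[OF u(1)] by (intro extensionalityI[of _ "{1..m}"]) (auto simp: kernel_diagram_map_def)
  then show "arr (EDiag m) (Ker X) (Ker Y) (Ker_map X Y t)"
    and "\<lbrakk>1 \<le> i; i \<le> m\<rbrakk> \<Longrightarrow> Comp E (Ker X)$i (Ker Y)$i Y$$i (incl Y i) (Ker_map X Y t i)
      = Comp E (Ker X)$i X$$i Y$$i (mmap J X$i Y$i (t i)) (incl X i)"
    using u by simp_all
qed

lemma Ker_map_eqI:
  assumes t: "arr (Diag (Suc m)) X Y t"
    and u: "arr (EDiag m) (Ker X) (Ker Y) u"
    "\<And>i. \<lbrakk>1 \<le> i; i \<le> m\<rbrakk> \<Longrightarrow> Comp E (Ker X)$i (Ker Y)$i Y$$i (incl Y i) (u i)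
      = Comp E (Ker X)$i X$$i Y$$i (mmap J X$i Y$i (t i)) (incl X i)"
  shows "Ker_map X Y t = u"
  by (rule kernel_system_arr_eqI[OF kernel_system_Ker[OF arr_chain_diagramD(2)[OF t]] Ker_map(1)[OF t] u(1)])
    (simp add: Ker_map(2)[OF t] u(2))

abbreviation "KF \<equiv> kernel_functor C ker (Suc m)"

lemma is_functor_KF: "is_functor (Diag (Suc m)) (EDiag m) KF"
  unfolding kernel_functor_def
proof (rule is_functor_mkI)
  let ?D = "Diag (Suc m)" and ?E = "EDiag m"
  interpret D: preadditive ?D by (rule preadditive_chain_diagrams)
  interpret DE: preadditive ?E by (rule preadditive_chain_diagrams)
  show "category ?D" "category ?E" by (fact D.category_axioms DE.category_axioms)+
  show K: "Ker X \<in> Obj ?E" if "X \<in> Obj ?D" for X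
    using that kernel_systemD(2)[OF kernel_system_Ker] by (simp add: diagram_category_simps)
  show "arr ?E (Ker X) (Ker Y) (Ker_map X Y t)" if "arr ?D X Y t" for X Y t by (rule Ker_map[OF that])
  show "Ker_map X X (Id ?D X) = Id ?E (Ker X)" if X: "X \<in> Obj ?D" for X
  proof (rule Ker_map_eqI)
    show "arr ?D X X (Id ?D X)" "arr ?E (Ker X) (Ker X) (Id ?E (Ker X))" using X K by simp_all
    fix i assume i: "1 \<le> i" "i \<le> m"
    have "is_functor (chain (Suc m)) C X" using X by (simp add: diagram_category_simps)
    then show "Comp E (Ker X)$i (Ker X)$i X$$i (incl X i) (Id ?E (Ker X) i) =
      Comp E (Ker X)$i X$$i X$$i (mmap J X$i X$i (Id ?D X i)) (incl X i)"
      using i kernel_systemD(3)[OF kernel_system_Ker i] chain_functorD(1)[of "Suc m" C X i]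
      by (simp add: diagram_category_simps J(3))
  qed
  show "Ker_map X Z (Comp ?D X Y Z s t) = Comp ?E (Ker X) (Ker Y) (Ker Z) (Ker_map Y Z s) (Ker_map X Y t)"
    if t: "arr ?D X Y t" and s: "arr ?D Y Z s" for X Y Z s t
  proof (rule Ker_map_eqI)
    show "arr ?D X Z (Comp ?D X Y Z s t)" using s t by simp
    show "arr ?E (Ker X) (Ker Z) (Comp ?E (Ker X) (Ker Y) (Ker Z) (Ker_map Y Z s) (Ker_map X Y t))"
      using Ker_map(1)[OF t] Ker_map(1)[OF s] by simp
    fix i assume i: "1 \<le> i" "i \<le> m"
    have i': "i \<le> Suc m" using i by simp
    note [simp] = arr_chain_diagramD(4)[OF Ker_map(1)[OF t] i] arr_chain_diagramD(4)[OF Ker_map(1)[OF s] i]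
      arr_chain_diagramD(4)[OF t i(1) i'] arr_chain_diagramD(4)[OF s i(1) i'] J(2)
      kernel_systemD(3)[OF kernel_system_Ker[OF arr_chain_diagramD(1)[OF t]] i]
      kernel_systemD(3)[OF kernel_system_Ker[OF arr_chain_diagramD(2)[OF t]] i]
      kernel_systemD(3)[OF kernel_system_Ker[OF arr_chain_diagramD(2)[OF s]] i]
    show "Comp E (Ker X)$i (Ker Z)$i Z$$i (incl Z i)
        (Comp ?E (Ker X) (Ker Y) (Ker Z) (Ker_map Y Z s) (Ker_map X Y t) i) =
      Comp E (Ker X)$i X$$i Z$$i (mmap J X$i Z$i (Comp ?D X Y Z s t i)) (incl X i)"
      using i i' by (simp add: diagram_category_simps E.reassoc[OF Ker_map(2)[OF s i]] E.assoc Ker_map(2)[OF t i] J(4))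
  qed
qed

lemma KF_simps:
  "is_functor (chain (Suc m)) C X \<Longrightarrow> KF$X = Ker X"
  "arr (Diag (Suc m)) X Y t \<Longrightarrow> mmap KF X Y t = Ker_map X Y t"
  by (simp_all add: kernel_functor_def diagram_category_simps)

lemma additive_KF: "additive (Diag (Suc m)) (EDiag m) KF"
  unfolding additive_def
proof (intro allI impI)
  let ?D = "Diag (Suc m)" and ?E = "EDiag m"
  interpret D: preadditive ?D by (rule preadditive_chain_diagrams)
  interpret DE: preadditive ?E by (rule preadditive_chain_diagrams)
  fix X Y s t assume s: "arr ?D X Y s" and t: "arr ?D X Y t"
  have "Ker_map X Y (Plus ?D X Y s t) = Plus ?E (Ker X) (Ker Y) (Ker_map X Y s) (Ker_map X Y t)"
  proof (rule Ker_map_eqI)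
    show "arr ?D X Y (Plus ?D X Y s t)" using s t by simp
    show "arr ?E (Ker X) (Ker Y) (Plus ?E (Ker X) (Ker Y) (Ker_map X Y s) (Ker_map X Y t))"
      using Ker_map(1)[OF s] Ker_map(1)[OF t] by simp
    fix i assume i: "1 \<le> i" "i \<le> m"
    have i': "i \<le> Suc m" using i by simp
    note [simp] = arr_chain_diagramD(4)[OF Ker_map(1)[OF t] i] arr_chain_diagramD(4)[OF Ker_map(1)[OF s] i]
      arr_chain_diagramD(4)[OF t i(1) i'] arr_chain_diagramD(4)[OF s i(1) i'] J(2)
      kernel_systemD(3)[OF kernel_system_Ker[OF arr_chain_diagramD(1)[OF t]] i]
      kernel_systemD(3)[OF kernel_system_Ker[OF arr_chain_diagramD(2)[OF t]] i]
    show "Comp E (Ker X)$i (Ker Y)$i Y$$i (incl Y i)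
        (Plus ?E (Ker X) (Ker Y) (Ker_map X Y s) (Ker_map X Y t) i) =
      Comp E (Ker X)$i X$$i Y$$i (mmap J X$i Y$i (Plus ?D X Y s t i)) (incl X i)"
      using i i' by (simp add: diagram_category_simps Ker_map(2)[OF s i] Ker_map(2)[OF t i] J_Plus)
  qed
  then show "mmap KF X Y (Plus ?D X Y s t) = Plus ?E KF$X KF$Y (mmap KF X Y s) (mmap KF X Y t)"
    using s t arr_chain_diagramD(1,2)[OF s] by (simp add: KF_simps)
qed

lemma KF_full:
  assumes "is_functor (chain (Suc m)) C X" "is_functor (chain (Suc m)) C Y" "1 \<le> m"
    "arr (EDiag m) KF$X KF$Y u"
  shows "\<exists>t. arr (Diag (Suc m)) X Y t \<and> mmap KF X Y t = u"
proof -
  have u: "arr (EDiag m) (Ker X) (Ker Y) u"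
    using assms by (simp add: KF_simps)
  obtain t where t: "arr (Diag (Suc m)) X Y t"
    "\<And>i. \<lbrakk>1 \<le> i; i \<le> m\<rbrakk> \<Longrightarrow>
      Comp E (Ker X)$i X$$i Y$$i (mmap J X$i Y$i (t i)) (incl X i)
      = Comp E (Ker X)$i (Ker Y)$i Y$$i (incl Y i) (u i)"
    by (rule kernel_system_full[OF kernel_system_Ker[OF assms(1)] kernel_system_Ker[OF assms(2)] u assms(3)]) blast
  have "Ker_map X Y t = u" by (rule Ker_map_eqI[OF t(1) u]) (simp add: t(2))
  then show ?thesis using t(1) by (auto simp: KF_simps)
qed

lemma KF_dense:
  assumes "is_functor (chain m) E Y" "1 \<le> m"
  shows "\<exists>X. is_functor (chain (Suc m)) C X \<and> isomorphic (EDiag m) KF$X Y"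
proof -
  obtain X \<iota> where X: "kernel_system m X Y \<iota>" by (rule kernel_system_dense[OF assms])
  note X' = kernel_systemD(1)[OF X]
  show ?thesis
    using kernel_system_unique[OF kernel_system_Ker[OF X'] X] X' by (auto simp: KF_simps)
qed

text \<open>A factorisation of \<open>K t\<close> over \<open>K S\<close> can be continued over the diagram of which \<open>K S\<close> is a retract.\<close>

lemma KF_ideal:
  assumes t: "arr (Diag (Suc m)) X Y t"
    and f: "t \<in> factoring (Diag (Suc m)) (split_diagrams C (Suc m)) X Y"
  shows "mmap KF X Y t \<in> factoring (EDiag m)
    (emb m ` split_diagrams C m) KF$X KF$Y"
proof -
  let ?D = "Diag (Suc m)" and ?E = "EDiag m"
  interpret I: factoring_ideal ?D "split_diagrams C (Suc m)" by (rule split_diagrams_ideal)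
  interpret DE: preadditive ?E by (rule preadditive_chain_diagrams)
  obtain S g h where S: "S \<in> split_diagrams C (Suc m)" and gh: "arr ?D X S g" "arr ?D S Y h" "t = Comp ?D X S Y h g"
    using f arrD(1,2)[OF t] by (elim factoringE[OF _ I.B_Obj])
  note KFf = is_functorD(5,7)[OF is_functor_KF]
  have So: "is_functor (chain (Suc m)) C S" using S by (simp add: split_diagrams_iff)
  obtain V \<beta> where V: "V \<in> split_diagrams C m"
    "arr ?E (Ker S) (emb m V) (incl S)"
    "arr ?E (emb m V) (Ker S) \<beta>"
    "Comp ?E (Ker S) (emb m V) (Ker S) \<beta> (incl S) = Id ?E (Ker S)"
    by (rule split_kernel_retract[OF S kernel_system_Ker[OF So]])
  note a = KFf(1)[OF gh(1)] KFf(1)[OF gh(2)]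
  have "mmap KF X Y t = Comp ?E KF$X (Ker S) KF$Y (mmap KF S Y h) (mmap KF X S g)"
    using KFf(2)[OF gh(1,2)] So by (simp add: gh(3) KF_simps(1))
  also have "\<dots> = Comp ?E KF$X (emb m V) KF$Y
      (Comp ?E (emb m V) (Ker S) KF$Y (mmap KF S Y h) \<beta>)
      (Comp ?E KF$X (Ker S) (emb m V) (incl S) (mmap KF X S g))"
    using a V(2,3) unfolding KF_simps(1)[OF So] by (simp add: DE.assoc DE.reassoc[OF V(4)])
  also have "\<dots> \<in> factoring ?E (emb m ` split_diagrams C m) KF$X KF$Y"
    by (rule factoringI) (use V a[unfolded KF_simps(1)[OF So]] in simp_all)
  finally show ?thesis .
qed

text \<open>
  A factorisation of \<open>K t\<close> over \<open>Z\<close> lifts to a morphism \<open>X \<rightarrow> W \<rightarrow> Y\<close> with \<open>W\<close> split, and the difference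
  of \<open>t\<close> and this morphism kills the kernels \<open>K X\<close>.
\<close>

lemma KF_reflect:
  assumes t: "arr (Diag (Suc m)) X Y t" and m: "1 \<le> m"
    and f: "mmap KF X Y t \<in> factoring (EDiag m)
      (emb m ` split_diagrams C m) KF$X KF$Y"
  shows "t \<in> factoring (Diag (Suc m)) (split_diagrams C (Suc m)) X Y"
proof -
  let ?D = "Diag (Suc m)" and ?E = "EDiag m"
  interpret I: factoring_ideal ?D "split_diagrams C (Suc m)" by (rule split_diagrams_ideal)
  interpret IE: factoring_ideal ?E "emb m ` split_diagrams C m" by (rule embedded_split_ideal)
  note t' = arr_chain_diagramD[OF t]
  have o: "X \<in> Obj ?D" "Y \<in> Obj ?D" using arrD[OF t] by simp_all
  have "mmap KF X Y t \<in> factoring ?E (emb m ` split_diagrams C m) (Ker X) (Ker Y)"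
    using f t' by (simp add: KF_simps)
  moreover have "Ker X \<in> Obj ?E" "Ker Y \<in> Obj ?E" using arrD[OF Ker_map(1)[OF t]] by simp_all
  ultimately obtain Z' g h where "Z' \<in> emb m ` split_diagrams C m"
    and gh: "arr ?E (Ker X) Z' g" "arr ?E Z' (Ker Y) h" and kt: "Ker_map X Y t = Comp ?E (Ker X) Z' (Ker Y) h g"
    unfolding KF_simps(2)[OF t] by (elim factoringE[OF _ IE.B_Obj])
  then obtain Z where Z: "Z \<in> split_diagrams C m" and Z': "Z' = emb m Z" by blast
  \<comment> \<open>Extended by zero maps to an arbitrary last object, \<open>Z\<close> becomes its own kernel.\<close>
  have Zf: "is_functor (chain m) C Z" using Z by (simp add: split_diagrams_iff)
  note Zc = chain_functorD[OF Zf]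
  define W where "W = mk_functor (chain (Suc m)) (\<lambda>i. if i = Suc m then Z$1 else Z$i)
    (\<lambda>i j _. if j = Suc m then (if i = j then Id C Z$1 else Null C Z$i Z$1) else mmap Z i j ())"
  have Z1: "Z$1 \<in> Obj C" using Zc(1) m by simp
  have WF: "is_functor (chain (Suc m)) C W" unfolding W_def
  proof (rule chain_functorI[OF category_axioms], goal_cases)
    case (4 i j k)
    then show ?case using Z1 Zc(1)[of i] Zc(2)[of i j "()"] Zc(4)[of i j k "()" "()" "()"]
      by (auto simp: le_Suc_eq)
  qed (use Z1 Zc in \<open>auto simp: le_Suc_eq\<close>)
  have Wo: "W$i = Z$i" if "1 \<le> i" "i \<le> m" for i using that by (simp add: W_def)
  have Wn: "W$(Suc m) = Z$1" by (simp add: W_def)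
  have Wm: "mmap W i j () = mmap Z i j ()" if "1 \<le> i" "i \<le> j" "j \<le> m" for i j using that by (simp add: W_def)
  have W0: "mmap W i (Suc m) () = Null C Z$i Z$1" if "1 \<le> i" "i \<le> m" for i
    using that by (simp add: W_def)
  have WI: "mmap W (Suc m) (Suc m) () = Id C Z$1" by (simp add: W_def)
  have Wsplit: "W \<in> split_diagrams C (Suc m)" unfolding split_diagrams_iff
  proof (intro conjI allI impI)
    fix i j assume "1 \<le> i \<and> i \<le> j \<and> j \<le> Suc m"
    then consider "1 \<le> i" "i \<le> j" "j \<le> m" | "1 \<le> i" "i \<le> m" "j = Suc m" | "i = Suc m" "j = Suc m" by linarith
    then show "regular W$i W$j (mmap W i j ())"
      by cases (use Z Zc(1) Z1 in \<open>auto simp: Wo Wn Wm W0 WI split_diagrams_iff regular_Null regular_Id\<close>)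
  qed (rule WF)
  have Z'F: "is_functor (chain m) E Z'" unfolding Z' by (rule is_functor_comp[OF Zf is_functor_J])
  have tW: "emb m W = Z'" unfolding Z'
    by (rule functor_eqI[OF is_functor_truncated[OF WF] is_functor_comp[OF Zf is_functor_J]]) (auto simp: Wo Wm)
  have ZW: "kernel_system m W Z' (Id ?E Z')" unfolding kernel_system_def tW
  proof (intro conjI allI impI WF)
    show "arr ?E Z' Z' (Id ?E Z')" using Z'F by (intro IE.arr_Id) (simp add: diagram_category_simps)
    fix i assume i: "1 \<le> i \<and> i \<le> m"
    then have Zi: "Z$i \<in> Obj C" "Z'$i = Z$$i" using Zc(1) by (simp_all add: Z')
    have Ji: "Z$$i \<in> Obj E" "Z$$1 \<in> Obj E" using Zi Z1 J(1) by blast+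
    show "is_kernel E W$$i W$$(Suc m)
      (Jmor W i (Suc m)) Z'$i (Id ?E Z' i)"
      by (rule E.kernelI) (use i Zi Z1 Ji in \<open>auto simp: Wo Wn W0 J_Null diagram_category_simps\<close>)
  qed
  have kX: "kernel_system m X (Ker X) (incl X)" and kY: "kernel_system m Y (Ker Y) (incl Y)"
    using kernel_system_Ker t' by blast+
  obtain G where G: "arr ?D X W G" "\<And>i. \<lbrakk>1 \<le> i; i \<le> m\<rbrakk> \<Longrightarrow>
      Comp E (Ker X)$i X$$i W$$i (mmap J X$i W$i (G i)) (incl X i)
      = Comp E (Ker X)$i Z'$i W$$i (Id ?E Z' i) (g i)"
    by (rule kernel_system_full[OF kX ZW gh(1) m]) blast
  obtain H where H: "arr ?D W Y H" "\<And>i. \<lbrakk>1 \<le> i; i \<le> m\<rbrakk> \<Longrightarrow>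
      Comp E Z'$i W$$i Y$$i (mmap J W$i Y$i (H i)) (Id ?E Z' i)
      = Comp E Z'$i (Ker Y)$i Y$$i (incl Y i) (h i)"
    by (rule kernel_system_full[OF ZW kY gh(2) m]) blast
  let ?q = "Comp ?D X W Y H G"
  let ?r = "Plus ?D X Y t (Neg ?D X Y ?q)"
  have qa: "arr ?D X Y ?q" using G H by simp
  have q: "?q \<in> factoring ?D (split_diagrams C (Suc m)) X Y" by (rule factoringI[OF Wsplit G(1) H(1)])
  have r: "arr ?D X Y ?r" using t qa by simp
  \<comment> \<open>\<open>t\<close> and \<open>H \<circ> G\<close> agree on \<open>KX\<close>.\<close>
  have tq: "Comp E (Ker X)$i X$$i Y$$i (mmap J X$i Y$i (?q i)) (incl X i)
    = Comp E (Ker X)$i X$$i Y$$i (mmap J X$i Y$i (t i)) (incl X i)"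
    if i: "1 \<le> i" "i \<le> m" for i
  proof -
    have i': "i \<le> Suc m" using i by simp
    have Zi: "Z'$i = Z$$i" "Z$$i \<in> Obj E" "Id ?E Z' i = Id E Z$$i"
      using i Zc(1) J(1) by (simp_all add: Z' diagram_category_simps)
    have gi: "arr E (Ker X)$i Z$$i (g i)" "arr E Z$$i (Ker Y)$i (h i)"
      using arr_chain_diagramD(4)[OF gh(1) i] arr_chain_diagramD(4)[OF gh(2) i] by (simp_all add: Zi)
    note GH = arr_chain_diagramD(4)[OF G(1) i(1) i'] arr_chain_diagramD(4)[OF H(1) i(1) i']
    note [simp] = kernel_systemD(3)[OF kX i] kernel_systemD(3)[OF kY i] gi GH[unfolded Wo[OF i]] J(2) Zi(2)
    have G': "Comp E (Ker X)$i X$$i Z$$i (mmap J X$i Z$i (G i)) (incl X i) = g i"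
      using G(2)[OF i] by (simp add: Wo[OF i] Zi)
    have H': "mmap J Z$i Y$i (H i) = Comp E Z$$i (Ker Y)$i Y$$i (incl Y i) (h i)"
      using H(2)[OF i] by (simp add: Wo[OF i] Zi)
    have "?q i = Comp C X$i Z$i Y$i (H i) (G i)" using i i' by (simp add: diagram_category_simps Wo)
    then have "Comp E (Ker X)$i X$$i Y$$i (mmap J X$i Y$i (?q i)) (incl X i)
      = Comp E (Ker X)$i Z$$i Y$$i (mmap J Z$i Y$i (H i)) (g i)"
      by (simp add: J(4) E.assoc G')
    also have "\<dots> = Comp E (Ker X)$i (Ker Y)$i Y$$i (incl Y i) (Ker_map X Y t i)"
      using i by (simp add: H' E.assoc kt diagram_category_simps Zi)
    finally show ?thesis using Ker_map(2)[OF t i] by simp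
  qed
  have "?r \<in> factoring ?D (split_diagrams C (Suc m)) X Y"
  proof (rule kernel_killing_factors[OF r])
    fix i s \<alpha> assume i: "1 \<le> i" "i \<le> Suc m" and \<alpha>: "arr C s X$i \<alpha>"
      and 0: "Comp C s X$i X$(Suc m) (mmap X i (Suc m) ()) \<alpha> = Null C s X$(Suc m)"
    note ti = t'(4)[OF i] and qi = arr_chain_diagramD(4)[OF qa i]
    note [simp] = \<alpha> ti qi arrD(1,2)[OF \<alpha>] arrD(2)[OF ti] J(1,2)
    have eq: "Comp C s X$i Y$i (?q i) \<alpha> = Comp C s X$i Y$i (t i) \<alpha>"
    proof (cases "i = Suc m")
      case True
      then have "\<alpha> = Null C s X$i" using 0 chain_functorD(3)[OF t'(1) i] \<alpha> by simp
      then show ?thesis by simp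
    next
      case False
      then have im: "1 \<le> i" "i \<le> m" using i by simp_all
      obtain \<gamma> where \<gamma>: "arr E J$s (Ker X)$i \<gamma>"
        "Comp E J$s (Ker X)$i X$$i (incl X i) \<gamma> = mmap J s X$i \<alpha>"
        using kernel_systemD(8)[OF kX im \<alpha> 0] by blast
      note [simp] = \<gamma>(1) kernel_systemD(3)[OF kX im]
      have "mmap J s Y$i (Comp C s X$i Y$i (?q i) \<alpha>) = mmap J s Y$i (Comp C s X$i Y$i (t i) \<alpha>)"
        by (simp add: J(4) \<gamma>(2)[symmetric] E.reassoc[OF tq[OF im]] E.assoc)
      then show ?thesis by (subst (asm) J_eq_iff) simp_all
    qed
    have "?r i = Plus C X$i Y$i (t i) (Neg C X$i Y$i (?q i))"
      using i diagram_Neg[OF category_poset preadditive_axioms qa, of i] by (simp add: diagram_category_simps)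
    then show "Comp C s X$i Y$i (?r i) \<alpha> = Null C s Y$i"
      by (simp add: eq)
  qed simp
  from I.factoring_Plus[OF this q o] show ?thesis
    using t qa by (simp add: I.Plus_assoc)
qed

end

end

theorem proposition16:
  fixes C :: "('o, 'm) acat" and n :: nat
  assumes "weakly_abelian_category C" and "n \<ge> 2"
  shows "(\<exists>ker. kernel_choice (freyd C) ker) \<and>
    (\<forall>ker. kernel_choice (freyd C) ker \<longrightarrow>
       is_functor (diagram_category (chain n) C) (diagram_category (chain (n - 1)) (freyd C))
         (kernel_functor C ker n) \<and>
       is_equivalence (stable_diagrams C n) (stable_freyd_diagrams C (n - 1))
         (stable_kernel_functor C ker n))"
proof -
  interpret weakly_abelian_category C by fact
  define m where "m = n - 1"
  have n: "n = Suc m" "n - 1 = m" "1 \<le> m" using assms(2) by (simp_all add: m_def)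
  have "is_functor (diagram_category (chain (Suc m)) C) (diagram_category (chain m) (freyd C)) (kernel_functor C ker (Suc m)) \<and>
    is_equivalence (stable_diagrams C (Suc m)) (stable_freyd_diagrams C m) (stable_kernel_functor C ker (Suc m))"
    if ker: "kernel_choice (freyd C) ker" for ker
    unfolding stable_diagrams_def stable_freyd_diagrams_def stable_kernel_functor_def diff_Suc_1
    using KF_full[OF ker _ _ n(3)] KF_dense[OF ker _ n(3)] KF_ideal[OF ker] KF_reflect[OF ker _ n(3)]
    by (intro conjI is_functor_KF[OF ker] induced_equivalence additive_KF[OF ker]
        split_diagrams_ideal embedded_split_ideal) (auto simp: diagram_category_simps)
  then show ?thesis using ex_kernel_choice unfolding n(2) unfolding n(1) by blast
qed

end
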